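(* Let $\mathfrak{R}$ be an expansion of $(\mathbb{R},<)$. The following are equivalent. (1) $\mathfrak{R}$ is locally o-minimal. (2) If $E\subseteq\mathbb{R}^n$ is bounded and definable, then the expansion of $(\mathbb{R},<)$ by all definable subsets of $E$ is o-minimal. (3) Every definable set is locally path connected. (4) For every definable set, its connected components are the same as its path components and its quasicomponents. (5) Connected components of bounded definable subsets of $\mathbb{R}^2$ are path connected. (6) Quasicomponents of bounded definable subsets of $\mathbb{R}^2$ are connected. (7) If $A\subseteq\mathbb{R}$ is definable and has empty interior, then $A$ is closed and discrete.
   Context: "Definable" means definable in $\mathfrak{R}$ with parameters; definable sets are subsets of $\mathbb{R}^n$ for arbitrary $n$. Each $\mathbb{R}^n$ has its usual topology and subsets carry the subspace topology. $\mathfrak{R}$ is locally o-minimal if for each definable $E\subseteq\mathbb{R}$ and each $x\in\mathbb{R}$ there is an open neighborhood $U$ of $x$ such that $E\cap U$ is a finite union of points and open intervals. An expansion of $(\mathbb{R},<)$ is o-minimal if every subset of $\mathbb{R}$ definable in it is a finite union of points and open intervals. A set is locally path connected if, in its subspace topology, it has a basis consisting of path-connected sets. The quasicomponent of a point $x$ in a space $E$ is the intersection of all clopen subsets of $E$ containing $x$. *)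

theory Defs
  imports "HOL-Analysis.Analysis"
begin

section \<open>First-order expansions of the ordered real line\<close>

text \<open>
  A first-order structure with universe the type of reals and language the order symbol together
  with the function and relation symbols below. Constants are function symbols of arity 0. Only
  the values of the interpretations at symbols of the language and at argument lists of the
  correct length matter.
\<close>

record ('f, 'r) expansion =
  fun_syms :: "'f set"
  fun_arity :: "'f \<Rightarrow> nat"
  fun_interp :: "'f \<Rightarrow> real list \<Rightarrow> real"
  rel_syms :: "'r set"
  rel_arity :: "'r \<Rightarrow> nat"
  rel_interp :: "'r \<Rightarrow> real list \<Rightarrow> bool"

datatype 'f tm = Var nat | App 'f "'f tm list"

datatype ('f, 'r) fm =
    Eq "'f tm" "'f tm"
  | Less "'f tm" "'f tm"
  | Rel 'r "'f tm list"
  | Neg "('f, 'r) fm"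
  | Conj "('f, 'r) fm" "('f, 'r) fm"
  | Exi nat "('f, 'r) fm"

fun wf_tm :: "('f, 'r) expansion \<Rightarrow> 'f tm \<Rightarrow> bool" where
  "wf_tm \<RR> (Var i) \<longleftrightarrow> True"
| "wf_tm \<RR> (App f ts) \<longleftrightarrow>
     f \<in> fun_syms \<RR> \<and> length ts = fun_arity \<RR> f \<and> (\<forall>t\<in>set ts. wf_tm \<RR> t)"

fun wf_fm :: "('f, 'r) expansion \<Rightarrow> ('f, 'r) fm \<Rightarrow> bool" where
  "wf_fm \<RR> (Eq s t) \<longleftrightarrow> wf_tm \<RR> s \<and> wf_tm \<RR> t"
| "wf_fm \<RR> (Less s t) \<longleftrightarrow> wf_tm \<RR> s \<and> wf_tm \<RR> t"
| "wf_fm \<RR> (Rel r ts) \<longleftrightarrow>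
     r \<in> rel_syms \<RR> \<and> length ts = rel_arity \<RR> r \<and> (\<forall>t\<in>set ts. wf_tm \<RR> t)"
| "wf_fm \<RR> (Neg \<phi>) \<longleftrightarrow> wf_fm \<RR> \<phi>"
| "wf_fm \<RR> (Conj \<phi> \<psi>) \<longleftrightarrow> wf_fm \<RR> \<phi> \<and> wf_fm \<RR> \<psi>"
| "wf_fm \<RR> (Exi i \<phi>) \<longleftrightarrow> wf_fm \<RR> \<phi>"

fun eval_tm :: "('f, 'r) expansion \<Rightarrow> (nat \<Rightarrow> real) \<Rightarrow> 'f tm \<Rightarrow> real" where
  "eval_tm \<RR> e (Var i) = e i"
| "eval_tm \<RR> e (App f ts) = fun_interp \<RR> f (map (eval_tm \<RR> e) ts)"

fun sat :: "('f, 'r) expansion \<Rightarrow> (nat \<Rightarrow> real) \<Rightarrow> ('f, 'r) fm \<Rightarrow> bool" where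
  "sat \<RR> e (Eq s t) \<longleftrightarrow> eval_tm \<RR> e s = eval_tm \<RR> e t"
| "sat \<RR> e (Less s t) \<longleftrightarrow> eval_tm \<RR> e s < eval_tm \<RR> e t"
| "sat \<RR> e (Rel r ts) \<longleftrightarrow> rel_interp \<RR> r (map (eval_tm \<RR> e) ts)"
| "sat \<RR> e (Neg \<phi>) \<longleftrightarrow> \<not> sat \<RR> e \<phi>"
| "sat \<RR> e (Conj \<phi> \<psi>) \<longleftrightarrow> sat \<RR> e \<phi> \<and> sat \<RR> e \<psi>"
| "sat \<RR> e (Exi i \<phi>) \<longleftrightarrow> (\<exists>a. sat \<RR> (e(i := a)) \<phi>)"


section \<open>Definable sets\<close>

text \<open>
  The points of \<^term>\<open>Euclidean_space n\<close> are the sequences vanishing from index n on. In a formula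
  defining a subset of it, the free variables with index below n are the coordinates; the others
  take the parameters p as values. A formula has finitely many variables, so only finitely many
  parameters are used.
\<close>

definition definable :: "('f, 'r) expansion \<Rightarrow> nat \<Rightarrow> (nat \<Rightarrow> real) set \<Rightarrow> bool" where
  "definable \<RR> n E \<longleftrightarrow>
     (\<exists>\<phi> p. wf_fm \<RR> \<phi> \<and>
        E = {x \<in> topspace (Euclidean_space n). sat \<RR> (\<lambda>i. if i < n then x i else p i) \<phi>})"

text \<open>Subsets of the type of reals, via the identification with \<^term>\<open>Euclidean_space 1\<close>.\<close>

definition definable_real :: "('f, 'r) expansion \<Rightarrow> real set \<Rightarrow> bool" where
  "definable_real \<RR> A \<longleftrightarrow> definable \<RR> 1 {x \<in> topspace (Euclidean_space 1). x 0 \<in> A}"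

text \<open>
  The constant \<^const>\<open>bounded\<close> is not usable here: the metric that the library puts on
  \<^typ>\<open>nat \<Rightarrow> real\<close> is a bounded one.
\<close>

definition bounded_in_space :: "nat \<Rightarrow> (nat \<Rightarrow> real) set \<Rightarrow> bool" where
  "bounded_in_space n E \<longleftrightarrow> (\<exists>B. \<forall>x\<in>E. \<forall>i<n. \<bar>x i\<bar> \<le> B)"

abbreviation subspace_topology :: "nat \<Rightarrow> (nat \<Rightarrow> real) set \<Rightarrow> (nat \<Rightarrow> real) topology" where
  "subspace_topology n E \<equiv> subtopology (Euclidean_space n) E"

text \<open>
  The expansion of the ordered real line by an n-ary relation symbol for each \<open>\<RR>\<close>-definable
  subset of E, where E is a subset of n-space; the sets themselves serve as symbols.
\<close>

definition expansion_by_subsets ::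
    "('f, 'r) expansion \<Rightarrow> nat \<Rightarrow> (nat \<Rightarrow> real) set \<Rightarrow> (unit, (nat \<Rightarrow> real) set) expansion" where
  "expansion_by_subsets \<RR> n E =
     \<lparr> fun_syms = {}, fun_arity = (\<lambda>_. 0), fun_interp = (\<lambda>_ _. 0),
       rel_syms = {D. D \<subseteq> E \<and> definable \<RR> n D}, rel_arity = (\<lambda>_. n),
       rel_interp = (\<lambda>D xs. (\<lambda>i. if i < n then xs ! i else 0) \<in> D) \<rparr>"


section \<open>O-minimality and local o-minimality\<close>

text \<open>Open intervals may be bounded or unbounded.\<close>

definition finite_union_points_intervals :: "real set \<Rightarrow> bool" where
  "finite_union_points_intervals A \<longleftrightarrow>
     (\<exists>P \<I>. finite P \<and> finite \<I> \<and> (\<forall>I\<in>\<I>. open I \<and> is_interval I) \<and> A = P \<union> \<Union>\<I>)"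

definition o_minimal :: "('f, 'r) expansion \<Rightarrow> bool" where
  "o_minimal \<RR> \<longleftrightarrow> (\<forall>A. definable_real \<RR> A \<longrightarrow> finite_union_points_intervals A)"

definition locally_o_minimal :: "('f, 'r) expansion \<Rightarrow> bool" where
  "locally_o_minimal \<RR> \<longleftrightarrow>
     (\<forall>E. definable_real \<RR> E \<longrightarrow>
        (\<forall>x. \<exists>U. open U \<and> x \<in> U \<and> finite_union_points_intervals (E \<inter> U)))"

end

theory Submission
  imports Defs
begin

text \<open>
  The substantial implication is that local o-minimality makes definable sets locally path connected.
  By the Baire category theorem, applied coordinate by coordinate, every definable set contains or
  misses some subbox of any given box. Hence, over all points of a base space outside a definable set
  without interior, the fibres of a bounded definable set in one more dimension look locally like a
  finite stack of graphs of continuous functions and of bands between them; no uniform bound on the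
  number of graphs is needed in advance. Induction on the dimension shows that every bounded definable
  set is a finite union of path connected sets: the exceptional part of the base is cut down further,
  and graphs are projected to a space of smaller dimension. Local path connectedness follows by
  joining infinitely many paths inside shrinking boxes, without curve selection.

  Conversely, a definable set of reals with empty interior and an accumulation point yields a comb in
  the plane. The expansion by the definable subsets of a bounded set is handled by order automorphisms
  of the line that move a small interval and fix that bounded region and the parameters.
\<close>

section \<open>Calculus of definable predicates\<close>

text \<open>Only an order is guaranteed in the language: in general there is no definable group,
  hence no definable choice and no metric inside formulas. Topological notions are therefore written
  with order intervals, and boxes are quantified through their two corners. Local o-minimality makes
  frontiers of fibres finite on each compact interval, but nothing is uniform in the base point.
  Countability of the rationals and completeness of the line compensate for this: each fibre is
  decided on some rational interval, so countably many definable sets cover a box and one of them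
  contains a subbox. The number of frontier points becomes constant only later, on connected pieces
  of the base. These pieces need not be definable, which is why finite unions of path connected
  sets, and not cells, are carried through the induction. A projection may remove a coordinate in
  the middle of the tuple, because an exceptional set depending on few coordinates drags arbitrary
  further coordinates along. All seven conditions meet in one statement about the line,
  \<open>tame\<close>.\<close>

fun vars_tm :: "'f tm \<Rightarrow> nat set" where
  "vars_tm (Var i) = {i}"
| "vars_tm (App f ts) = (\<Union>t\<in>set ts. vars_tm t)"

fun vars_fm :: "('f, 'r) fm \<Rightarrow> nat set" where
  "vars_fm (Eq s t) = vars_tm s \<union> vars_tm t"
| "vars_fm (Less s t) = vars_tm s \<union> vars_tm t"
| "vars_fm (Rel r ts) = (\<Union>t\<in>set ts. vars_tm t)"
| "vars_fm (Neg \<phi>) = vars_fm \<phi>"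
| "vars_fm (Conj \<phi> \<psi>) = vars_fm \<phi> \<union> vars_fm \<psi>"
| "vars_fm (Exi i \<phi>) = insert i (vars_fm \<phi>)"

fun rename_tm :: "(nat \<Rightarrow> nat) \<Rightarrow> 'f tm \<Rightarrow> 'f tm" where
  "rename_tm w (Var i) = Var (w i)"
| "rename_tm w (App f ts) = App f (map (rename_tm w) ts)"

lemma finite_vars_tm: "finite (vars_tm t)"
  by (induction t) auto

lemma finite_vars_fm: "finite (vars_fm \<phi>)"
  by (induction \<phi>) (auto simp: finite_vars_tm)

lemma eval_tm_cong:
  "(\<And>i. i \<in> vars_tm t \<Longrightarrow> e i = e' i) \<Longrightarrow> eval_tm \<RR> e t = eval_tm \<RR> e' t"
proof (induction t)
  case (App f ts)
  have "map (eval_tm \<RR> e) ts = map (eval_tm \<RR> e') ts"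
    by (rule map_cong[OF refl], rule App.IH) (use App.prems in auto)
  then show ?case by (simp del: map_eq_conv)
qed simp

lemma sat_cong:
  "(\<And>i. i \<in> vars_fm \<phi> \<Longrightarrow> e i = e' i) \<Longrightarrow> sat \<RR> e \<phi> \<longleftrightarrow> sat \<RR> e' \<phi>"
proof (induction \<phi> arbitrary: e e')
  case (Eq s t)
  then have "eval_tm \<RR> e s = eval_tm \<RR> e' s" "eval_tm \<RR> e t = eval_tm \<RR> e' t"
    by (auto intro: eval_tm_cong)
  then show ?case by simp
next
  case (Less s t)
  then have "eval_tm \<RR> e s = eval_tm \<RR> e' s" "eval_tm \<RR> e t = eval_tm \<RR> e' t"
    by (auto intro: eval_tm_cong)
  then show ?case by simp
next
  case (Rel r ts)
  have "map (eval_tm \<RR> e) ts = map (eval_tm \<RR> e') ts"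
    by (rule map_cong[OF refl], rule eval_tm_cong) (use Rel.prems in auto)
  then show ?case by (simp del: map_eq_conv)
next
  case (Neg \<phi>)
  have "sat \<RR> e \<phi> \<longleftrightarrow> sat \<RR> e' \<phi>"
    by (rule Neg.IH) (use Neg.prems in auto)
  then show ?case by simp
next
  case (Conj \<phi> \<psi>)
  have "sat \<RR> e \<phi> \<longleftrightarrow> sat \<RR> e' \<phi>"
    by (rule Conj.IH(1)) (use Conj.prems in auto)
  moreover have "sat \<RR> e \<psi> \<longleftrightarrow> sat \<RR> e' \<psi>"
    by (rule Conj.IH(2)) (use Conj.prems in auto)
  ultimately show ?case by simp
next
  case (Exi i \<phi>)
  have "sat \<RR> (e(i := a)) \<phi> \<longleftrightarrow> sat \<RR> (e'(i := a)) \<phi>" for a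
    by (rule Exi.IH) (use Exi.prems in auto)
  then show ?case by simp
qed

lemma wf_rename_tm: "wf_tm \<RR> t \<Longrightarrow> wf_tm \<RR> (rename_tm w t)"
  by (induction t) auto

lemma eval_rename_tm: "eval_tm \<RR> e (rename_tm w t) = eval_tm \<RR> (\<lambda>i. e (w i)) t"
proof (induction t)
  case (App f ts)
  have "map (eval_tm \<RR> e \<circ> rename_tm w) ts = map (eval_tm \<RR> (\<lambda>i. e (w i))) ts"
    using App.IH by auto
  then show ?case by (simp del: map_eq_conv)
qed simp

text \<open>The map \<open>w\<close> need not be injective, so a bound variable could be captured.
  In the case of \<open>Exi\<close> the bound variable is therefore sent to a fresh \<open>j\<close>
  outside the image of the variables of the body; as \<open>w\<close> is general in the induction,
  \<open>w(i := j)\<close> is again admissible.\<close>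

lemma ex_rename_fm:
  "wf_fm \<RR> \<phi> \<Longrightarrow> \<exists>\<psi>. wf_fm \<RR> \<psi> \<and> (\<forall>e. sat \<RR> e \<psi> \<longleftrightarrow> sat \<RR> (\<lambda>i. e (w i)) \<phi>)"
proof (induction \<phi> arbitrary: w)
  case (Eq s t)
  then show ?case
    by (intro exI[of _ "Eq (rename_tm w s) (rename_tm w t)"]) (auto simp: wf_rename_tm eval_rename_tm)
next
  case (Less s t)
  then show ?case
    by (intro exI[of _ "Less (rename_tm w s) (rename_tm w t)"]) (auto simp: wf_rename_tm eval_rename_tm)
next
  case (Rel r ts)
  have "map (eval_tm \<RR> e \<circ> rename_tm w) ts = map (eval_tm \<RR> (\<lambda>i. e (w i))) ts" for e
    by (auto simp: eval_rename_tm)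
  with Rel show ?case
    by (intro exI[of _ "Rel r (map (rename_tm w) ts)"]) (auto simp: wf_rename_tm simp del: map_eq_conv)
next
  case (Neg \<phi>)
  obtain \<psi> where "wf_fm \<RR> \<psi>" "\<And>e. sat \<RR> e \<psi> \<longleftrightarrow> sat \<RR> (\<lambda>i. e (w i)) \<phi>"
    using Neg.IH[of w] Neg.prems by auto
  then show ?case
    by (intro exI[of _ "Neg \<psi>"]) auto
next
  case (Conj \<phi>1 \<phi>2)
  obtain \<psi>1 where "wf_fm \<RR> \<psi>1" "\<And>e. sat \<RR> e \<psi>1 \<longleftrightarrow> sat \<RR> (\<lambda>i. e (w i)) \<phi>1"
    using Conj.IH(1)[of w] Conj.prems by auto
  moreover obtain \<psi>2 where "wf_fm \<RR> \<psi>2" "\<And>e. sat \<RR> e \<psi>2 \<longleftrightarrow> sat \<RR> (\<lambda>i. e (w i)) \<phi>2"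
    using Conj.IH(2)[of w] Conj.prems by auto
  ultimately show ?case
    by (intro exI[of _ "Conj \<psi>1 \<psi>2"]) auto
next
  case (Exi i \<phi>)
  obtain j where j: "j \<notin> w ` vars_fm \<phi>"
    using ex_new_if_finite[OF infinite_UNIV_nat finite_imageI[OF finite_vars_fm]] by blast
  obtain \<psi> where \<psi>: "wf_fm \<RR> \<psi>" "\<And>e. sat \<RR> e \<psi> \<longleftrightarrow> sat \<RR> (\<lambda>k. e ((w(i := j)) k)) \<phi>"
    using Exi.IH[of "w(i := j)"] Exi.prems by auto
  have "sat \<RR> (\<lambda>k. (e(j := a)) ((w(i := j)) k)) \<phi> \<longleftrightarrow> sat \<RR> ((\<lambda>i. e (w i))(i := a)) \<phi>" for e a
    by (rule sat_cong) (use j in auto)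
  then have "sat \<RR> e (Exi j \<psi>) \<longleftrightarrow> sat \<RR> (\<lambda>i. e (w i)) (Exi i \<phi>)" for e
    unfolding sat.simps \<psi>(2) by (simp only:)
  with \<psi>(1) show ?case
    by (intro exI[of _ "Exi j \<psi>"]) simp
qed

text \<open>
  Predicates are evaluated on sequences e of points, \<open>e k i\<close> being the i-th coordinate of the k-th
  point; a quantified point is pushed to the front of the sequence, as in de Bruijn's notation.
  In this way the introduction rules below apply syntactically to lambda terms.
\<close>

definition simple_term :: "((nat \<Rightarrow> nat \<Rightarrow> real) \<Rightarrow> real) \<Rightarrow> bool" where
  "simple_term t \<longleftrightarrow> (\<exists>k i. t = (\<lambda>e. e k i)) \<or> (\<exists>c. t = (\<lambda>_. c))"

text \<open>The substitution \<open>T\<close> assigns terms to all variables at once; a formula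
  mentions finitely many of them, so only finitely many constants act as parameters.\<close>

definition definable_pred :: "('f, 'r) expansion \<Rightarrow> ((nat \<Rightarrow> nat \<Rightarrow> real) \<Rightarrow> bool) \<Rightarrow> bool" where
  "definable_pred \<RR> Q \<longleftrightarrow>
     (\<exists>\<phi> T. wf_fm \<RR> \<phi> \<and> (\<forall>m. simple_term (T m)) \<and> (\<forall>e. Q e \<longleftrightarrow> sat \<RR> (\<lambda>m. T m e) \<phi>))"

text \<open>No dimension is attached: \<open>A\<close> is a set of infinite sequences, and the range
  of coordinates on which it depends is recorded separately by \<open>cylinder\<close>.\<close>

definition definable_set :: "('f, 'r) expansion \<Rightarrow> (nat \<Rightarrow> real) set \<Rightarrow> bool" where
  "definable_set \<RR> A \<longleftrightarrow> definable_pred \<RR> (\<lambda>e. e 0 \<in> A)"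

lemma simple_term_var: "simple_term (\<lambda>e. e k i)"
  and simple_term_const: "simple_term (\<lambda>_. c)"
  by (auto simp: simple_term_def)

lemma simple_term_if:
  "simple_term s \<Longrightarrow> simple_term t \<Longrightarrow> simple_term (\<lambda>e. if b then s e else t e)"
  by (cases b) simp_all

lemma simple_term_upd:
  "simple_term t \<Longrightarrow> simple_term (\<lambda>e. f e i) \<Longrightarrow> simple_term (\<lambda>e. ((f e)(n := t e)) i)"
  by (cases "i = n") simp_all

lemma simple_term_subst:
  assumes "simple_term s" and "\<And>k i. simple_term (\<lambda>e. t e k i)"
  shows "simple_term (\<lambda>e. s (t e))"
  using assms by (auto simp: simple_term_def[of s] simple_term_const)

lemma definable_pred_subst:
  assumes "definable_pred \<RR> Q" and "\<And>k i. simple_term (\<lambda>e. t e k i)"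
  shows "definable_pred \<RR> (\<lambda>e. Q (t e))"
proof -
  obtain \<phi> T where "wf_fm \<RR> \<phi>" "\<And>m. simple_term (T m)" "\<And>e. Q e \<longleftrightarrow> sat \<RR> (\<lambda>m. T m e) \<phi>"
    using assms(1) by (auto simp: definable_pred_def)
  then show ?thesis
    unfolding definable_pred_def
    by (intro exI[of _ \<phi>] exI[of _ "\<lambda>m e. T m (t e)"])
      (auto intro: simple_term_subst assms(2))
qed

lemma definable_pred_mem:
  assumes "definable_set \<RR> A" and "\<And>i. simple_term (\<lambda>e. t e i)"
  shows "definable_pred \<RR> (\<lambda>e. t e \<in> A)"
  using definable_pred_subst[OF assms(1)[unfolded definable_set_def], of "\<lambda>e k. t e"] assms(2)
  by simp

lemma definable_pred_not:
  assumes "definable_pred \<RR> P"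
  shows "definable_pred \<RR> (\<lambda>e. \<not> P e)"
proof -
  obtain \<phi> T where "wf_fm \<RR> \<phi>" "\<And>m. simple_term (T m)" "\<And>e. P e \<longleftrightarrow> sat \<RR> (\<lambda>m. T m e) \<phi>"
    using assms by (auto simp: definable_pred_def)
  then show ?thesis
    unfolding definable_pred_def by (intro exI[of _ "Neg \<phi>"] exI[of _ T]) auto
qed

lemma definable_pred_conj:
  assumes "definable_pred \<RR> P" "definable_pred \<RR> Q"
  shows "definable_pred \<RR> (\<lambda>e. P e \<and> Q e)"
proof -
  obtain \<phi> T where \<phi>: "wf_fm \<RR> \<phi>" "\<And>m. simple_term (T m)" "\<And>e. P e \<longleftrightarrow> sat \<RR> (\<lambda>m. T m e) \<phi>"
    using assms(1) by (auto simp: definable_pred_def)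
  obtain \<psi> S where \<psi>: "wf_fm \<RR> \<psi>" "\<And>m. simple_term (S m)" "\<And>e. Q e \<longleftrightarrow> sat \<RR> (\<lambda>m. S m e) \<psi>"
    using assms(2) by (auto simp: definable_pred_def)
  \<comment> \<open>Even variables are reserved for \<open>\<phi>\<close> and odd ones for
    \<open>\<psi>\<close>, so that the two substitutions merge into one.\<close>
  obtain \<phi>' where \<phi>': "wf_fm \<RR> \<phi>'" "\<And>e. sat \<RR> e \<phi>' \<longleftrightarrow> sat \<RR> (\<lambda>m. e (2 * m)) \<phi>"
    using ex_rename_fm[OF \<phi>(1), of "\<lambda>m. 2 * m"] by auto
  obtain \<psi>' where \<psi>': "wf_fm \<RR> \<psi>'" "\<And>e. sat \<RR> e \<psi>' \<longleftrightarrow> sat \<RR> (\<lambda>m. e (2 * m + 1)) \<psi>"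
    using ex_rename_fm[OF \<psi>(1), of "\<lambda>m. 2 * m + 1"] by auto
  define U where "U = (\<lambda>m. if even m then T (m div 2) else S (m div 2))"
  have U: "U (2 * m) = T m" "U (2 * m + 1) = S m" for m
    by (auto simp: U_def)
  have "P e \<and> Q e \<longleftrightarrow> sat \<RR> (\<lambda>m. U m e) (Conj \<phi>' \<psi>')" for e
    by (simp only: sat.simps \<phi>'(2) \<psi>'(2) \<phi>(3) \<psi>(3) U)
  moreover have "simple_term (U m)" for m
    by (auto simp: U_def \<phi>(2) \<psi>(2))
  ultimately show ?thesis
    unfolding definable_pred_def using \<phi>'(1) \<psi>'(1)
    by (intro exI[of _ "Conj \<phi>' \<psi>'"] exI[of _ U]) auto
qed

lemma definable_pred_less:
  assumes "simple_term s" "simple_term t"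
  shows "definable_pred \<RR> (\<lambda>e. s e < t e)"
  unfolding definable_pred_def using assms
  by (intro exI[of _ "Less (Var 0) (Var 1)"] exI[of _ "\<lambda>m. if m = 0 then s else t"]) auto

lemma definable_pred_eq:
  assumes "simple_term s" "simple_term t"
  shows "definable_pred \<RR> (\<lambda>e. s e = t e)"
  unfolding definable_pred_def using assms
  by (intro exI[of _ "Eq (Var 0) (Var 1)"] exI[of _ "\<lambda>m. if m = 0 then s else t"]) auto

lemma definable_pred_le:
  assumes "simple_term s" "simple_term t"
  shows "definable_pred \<RR> (\<lambda>e. s e \<le> t e)"
  using definable_pred_not[OF definable_pred_less[OF assms(2,1)], of \<RR>] by (simp add: not_less)

lemma definable_pred_disj:
  assumes "definable_pred \<RR> P" "definable_pred \<RR> Q"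
  shows "definable_pred \<RR> (\<lambda>e. P e \<or> Q e)"
  using definable_pred_not[OF definable_pred_conj[OF assms[THEN definable_pred_not]]] by simp

lemma definable_pred_imp:
  assumes "definable_pred \<RR> P" "definable_pred \<RR> Q"
  shows "definable_pred \<RR> (\<lambda>e. P e \<longrightarrow> Q e)"
  using definable_pred_disj[OF definable_pred_not[OF assms(1)] assms(2)] by simp

lemma definable_pred_const: "definable_pred \<RR> (\<lambda>e. b)"
  using definable_pred_eq[OF simple_term_const simple_term_const, of \<RR> 0 "if b then 0 else 1"]
  by (cases b) simp_all

lemma definable_pred_all_less_nat:
  fixes n :: nat
  assumes "\<And>i. definable_pred \<RR> (Q i)"
  shows "definable_pred \<RR> (\<lambda>e. \<forall>i<n. Q i e)"
proof (induction n)
  case 0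
  show ?case using definable_pred_const[of \<RR> True] by simp
next
  case (Suc n)
  have "(\<lambda>e. \<forall>i<Suc n. Q i e) = (\<lambda>e. (\<forall>i<n. Q i e) \<and> Q n e)"
    by (auto simp: less_Suc_eq)
  then show ?case
    by (simp only: definable_pred_conj[OF Suc assms])
qed

fun Exs :: "nat list \<Rightarrow> ('f, 'r) fm \<Rightarrow> ('f, 'r) fm" where
  "Exs [] \<phi> = \<phi>"
| "Exs (i # is) \<phi> = Exi i (Exs is \<phi>)"

lemma wf_Exs: "wf_fm \<RR> \<phi> \<Longrightarrow> wf_fm \<RR> (Exs is \<phi>)"
  by (induction "is") auto

lemma sat_Exs: "sat \<RR> g (Exs is \<phi>) \<longleftrightarrow> (\<exists>h. (\<forall>j. j \<notin> set is \<longrightarrow> h j = g j) \<and> sat \<RR> h \<phi>)"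
proof (induction "is" arbitrary: g)
  case Nil
  have "(\<forall>j. h j = g j) \<longleftrightarrow> h = g" for h by auto
  then show ?case by simp
next
  case (Cons i "is")
  have "sat \<RR> g (Exs (i # is) \<phi>) \<longleftrightarrow>
      (\<exists>a h. (\<forall>j. j \<notin> set is \<longrightarrow> h j = (g(i := a)) j) \<and> sat \<RR> h \<phi>)"
    by (simp add: Cons.IH)
  also have "\<dots> \<longleftrightarrow> (\<exists>h. (\<forall>j. j \<notin> set (i # is) \<longrightarrow> h j = g j) \<and> sat \<RR> h \<phi>)"
  proof safe
    fix a h assume "\<forall>j. j \<notin> set is \<longrightarrow> h j = (g(i := a)) j" "sat \<RR> h \<phi>"
    then show "\<exists>h. (\<forall>j. j \<notin> set (i # is) \<longrightarrow> h j = g j) \<and> sat \<RR> h \<phi>"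
      by (intro exI[of _ h]) auto
  next
    fix h assume "\<forall>j. j \<notin> set (i # is) \<longrightarrow> h j = g j" "sat \<RR> h \<phi>"
    then show "\<exists>a h. (\<forall>j. j \<notin> set is \<longrightarrow> h j = (g(i := a)) j) \<and> sat \<RR> h \<phi>"
      by (intro exI[of _ "h i"] exI[of _ h]) auto
  qed
  finally show ?case .
qed

text \<open>The quantifier binds a whole sequence, but the formula reads finitely many of its
  coordinates, so a finite block of first-order quantifiers over the corresponding variables
  expresses it.\<close>

lemma definable_pred_ex:
  fixes Q :: "(nat \<Rightarrow> nat \<Rightarrow> real) \<Rightarrow> (nat \<Rightarrow> real) \<Rightarrow> bool"
  assumes "definable_pred \<RR> (\<lambda>e. Q (\<lambda>k. e (Suc k)) (e 0))"
  shows "definable_pred \<RR> (\<lambda>e. \<exists>x. Q e x)"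
proof -
  obtain \<phi> T where \<phi>: "wf_fm \<RR> \<phi>" and T: "\<And>m. simple_term (T m)"
    and Q: "\<And>e. Q (\<lambda>k. e (Suc k)) (e 0) \<longleftrightarrow> sat \<RR> (\<lambda>m. T m e) \<phi>"
    using assms unfolding definable_pred_def by blast
  define push :: "(nat \<Rightarrow> nat \<Rightarrow> real) \<Rightarrow> (nat \<Rightarrow> real) \<Rightarrow> nat \<Rightarrow> nat \<Rightarrow> real"
    where "push = (\<lambda>e x k. case k of 0 \<Rightarrow> x | Suc k \<Rightarrow> e k)"
  have push: "(\<lambda>k. push e x (Suc k)) = e" "push e x 0 = x" for e x
    by (auto simp: push_def)
  have QT: "Q e x \<longleftrightarrow> sat \<RR> (\<lambda>m. T m (push e x)) \<phi>" for e x
    using Q[of "push e x"] by (simp add: push)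
  have "\<exists>W. T m = (\<lambda>e. e (fst W) (snd W)) \<or> (\<exists>c. T m = (\<lambda>_. c))" for m
    using T[of m] by (auto simp: simple_term_def)
  then obtain W where W: "\<And>m. T m = (\<lambda>e. e (fst (W m)) (snd (W m))) \<or> (\<exists>c. T m = (\<lambda>_. c))"
    by metis
  define isv where "isv = (\<lambda>m. T m = (\<lambda>e. e (fst (W m)) (snd (W m))))"
  \<comment> \<open>Terms that read the same coordinate must share a variable, since a quantifier
    changes all of them together: such a term goes to the even number coding its pair of indices, a
    constant to an odd number.\<close>
  define w where "w = (\<lambda>m. if isv m then 2 * prod_encode (W m) else 2 * m + 1)"
  define V :: "nat \<Rightarrow> (nat \<Rightarrow> nat \<Rightarrow> real) \<Rightarrow> real"
    where "V = (\<lambda>j. if even j then (\<lambda>e. e (fst (prod_decode (j div 2))) (snd (prod_decode (j div 2))))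
                else if isv (j div 2) then (\<lambda>_. 0) else T (j div 2))"
  have Vw: "V (w m) e = T m e" for m e
    by (auto simp: V_def w_def isv_def)
  obtain \<psi> where \<psi>: "wf_fm \<RR> \<psi>" "\<And>e. sat \<RR> e \<psi> \<longleftrightarrow> sat \<RR> (\<lambda>i. e (w i)) \<phi>"
    using ex_rename_fm[OF \<phi>, of w] by auto
  have QV: "Q e x \<longleftrightarrow> sat \<RR> (\<lambda>j. V j (push e x)) \<psi>" for e x
    by (simp add: QT \<psi>(2) comp_def Vw)
  \<comment> \<open>Changing the pushed point changes exactly the entries with point index 0, so
    these are the variables to quantify; by \<open>Vconst\<close> the value of every other occurring
    variable does not depend on the point.\<close>
  define J where "J = {j \<in> vars_fm \<psi>. even j \<and> fst (prod_decode (j div 2)) = 0}"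
  have "finite J" unfolding J_def by (rule finite_subset[OF _ finite_vars_fm[of \<psi>]]) auto
  then obtain js where js: "set js = J" using finite_list by blast
  have Vconst: "V j (push e x) = V j (push e y)" if "j \<notin> J" "j \<in> vars_fm \<psi>" for j e x y
  proof (cases "even j")
    case True
    with that have "fst (prod_decode (j div 2)) \<noteq> 0" by (auto simp: J_def)
    then show ?thesis using True by (auto simp: V_def push_def split: nat.split)
  next
    case False
    then show ?thesis using W[of "j div 2"] by (auto simp: V_def isv_def)
  qed
  have "(\<exists>x. Q e x) \<longleftrightarrow> sat \<RR> (\<lambda>j. V j (push e (\<lambda>_. 0))) (Exs js \<psi>)" for e
  proof
    assume "\<exists>x. Q e x"
    then obtain x where x: "sat \<RR> (\<lambda>j. V j (push e x)) \<psi>" by (auto simp: QV)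
    define h where "h = (\<lambda>j. if j \<in> J then V j (push e x) else V j (push e (\<lambda>_. 0)))"
    have "sat \<RR> h \<psi> \<longleftrightarrow> sat \<RR> (\<lambda>j. V j (push e x)) \<psi>"
      by (rule sat_cong) (auto simp: h_def intro: Vconst)
    with x show "sat \<RR> (\<lambda>j. V j (push e (\<lambda>_. 0))) (Exs js \<psi>)"
      by (auto simp: sat_Exs js h_def intro!: exI[of _ h])
  next
    assume "sat \<RR> (\<lambda>j. V j (push e (\<lambda>_. 0))) (Exs js \<psi>)"
    then obtain h where h: "\<And>j. j \<notin> J \<Longrightarrow> h j = V j (push e (\<lambda>_. 0))" "sat \<RR> h \<psi>"
      by (auto simp: sat_Exs js)
    define x where "x = (\<lambda>i. h (2 * prod_encode (0, i)))"
    have "sat \<RR> h \<psi> \<longleftrightarrow> sat \<RR> (\<lambda>j. V j (push e x)) \<psi>"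
    proof (rule sat_cong)
      fix j assume j: "j \<in> vars_fm \<psi>"
      show "h j = V j (push e x)"
      proof (cases "j \<in> J")
        case True
        then obtain k where k: "j = 2 * k" "fst (prod_decode k) = 0"
          by (auto simp: J_def elim!: evenE)
        have "prod_encode (0, snd (prod_decode k)) = k"
          using k(2) by (metis prod.collapse prod_decode_inverse)
        then show ?thesis using k by (simp add: V_def x_def push_def)
      next
        case False
        then show ?thesis using h(1) Vconst[OF _ j] by metis
      qed
    qed
    with h(2) show "\<exists>x. Q e x" by (auto simp: QV)
  qed
  moreover have "simple_term (\<lambda>e. V j (push e (\<lambda>_. 0)))" for j
  proof (rule simple_term_subst[where t = "\<lambda>e. push e (\<lambda>_. 0)"])
    show "simple_term (V j)"
      by (auto simp: V_def T intro: simple_term_var simple_term_const)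
    show "simple_term (\<lambda>e. push e (\<lambda>_. 0) k i)" for k i
      by (cases k) (auto simp: push_def intro: simple_term_var simple_term_const)
  qed
  ultimately show ?thesis
    unfolding definable_pred_def using wf_Exs[OF \<psi>(1)]
    by (intro exI[of _ "Exs js \<psi>"] exI[of _ "\<lambda>j e. V j (push e (\<lambda>_. 0))"]) auto
qed

lemma definable_pred_all:
  fixes Q :: "(nat \<Rightarrow> nat \<Rightarrow> real) \<Rightarrow> (nat \<Rightarrow> real) \<Rightarrow> bool"
  assumes "definable_pred \<RR> (\<lambda>e. Q (\<lambda>k. e (Suc k)) (e 0))"
  shows "definable_pred \<RR> (\<lambda>e. \<forall>x. Q e x)"
  using definable_pred_not[OF definable_pred_ex[of \<RR> "\<lambda>e x. \<not> Q e x"]] definable_pred_not[OF assms]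
  by simp

lemma definable_pred_ex_real:
  fixes Q :: "(nat \<Rightarrow> nat \<Rightarrow> real) \<Rightarrow> real \<Rightarrow> bool"
  assumes "definable_pred \<RR> (\<lambda>e. Q (\<lambda>k. e (Suc k)) (e 0 0))"
  shows "definable_pred \<RR> (\<lambda>e. \<exists>x. Q e x)"
proof -
  have "definable_pred \<RR> (\<lambda>e. \<exists>x::nat \<Rightarrow> real. Q e (x 0))"
    using definable_pred_ex[of \<RR> "\<lambda>e x. Q e (x 0)"] assms by simp
  moreover have "(\<exists>x::nat \<Rightarrow> real. Q e (x 0)) \<longleftrightarrow> (\<exists>x. Q e x)" for e
  proof
    show "\<exists>x::nat \<Rightarrow> real. Q e (x 0)" if "\<exists>x. Q e x"
    proof -
      from that obtain x where "Q e x" ..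
      then show ?thesis by (intro exI[of _ "\<lambda>_. x"])
    qed
  qed auto
  then have "(\<lambda>e. \<exists>x::nat \<Rightarrow> real. Q e (x 0)) = (\<lambda>e. \<exists>x. Q e x)"
    by (rule ext)
  ultimately show ?thesis by (simp only:)
qed

lemma definable_pred_all_real:
  fixes Q :: "(nat \<Rightarrow> nat \<Rightarrow> real) \<Rightarrow> real \<Rightarrow> bool"
  assumes "definable_pred \<RR> (\<lambda>e. Q (\<lambda>k. e (Suc k)) (e 0 0))"
  shows "definable_pred \<RR> (\<lambda>e. \<forall>x. Q e x)"
  using definable_pred_not[OF definable_pred_ex_real[of \<RR> "\<lambda>e x. \<not> Q e x"]] definable_pred_not[OF assms]
  by simp

lemmas definable_pred_intros =
  definable_pred_const definable_pred_mem definable_pred_less definable_pred_le definable_pred_eq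
  definable_pred_all_less_nat
  definable_pred_not definable_pred_conj definable_pred_disj definable_pred_imp
  definable_pred_ex definable_pred_all definable_pred_ex_real definable_pred_all_real
  simple_term_const simple_term_var simple_term_upd simple_term_if

section \<open>Definable subsets of n-space and of the line as predicates\<close>

abbreviation restr :: "nat \<Rightarrow> (nat \<Rightarrow> real) \<Rightarrow> nat \<Rightarrow> real" where
  "restr n x \<equiv> (\<lambda>i. if i < n then x i else 0)"

text \<open>From right to left the substitution is sorted: a term that reads one of the first
  \<open>n\<close> coordinates of the point becomes that variable; every other term is constant once
  it is evaluated at \<open>restr n x\<close>, and becomes a parameter. The shift
  \<open>m + n\<close> keeps these parameters clear of the coordinates.\<close>

lemma definable_iff_definable_set:
  "definable \<RR> n E \<longleftrightarrow> E \<subseteq> topspace (Euclidean_space n) \<and> definable_set \<RR> {x. restr n x \<in> E}"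
proof
  assume "definable \<RR> n E"
  then obtain \<phi> p where \<phi>: "wf_fm \<RR> \<phi>"
    and E: "E = {x \<in> topspace (Euclidean_space n). sat \<RR> (\<lambda>i. if i < n then x i else p i) \<phi>}"
    by (auto simp: definable_def)
  have "restr n x \<in> E \<longleftrightarrow> sat \<RR> (\<lambda>i. if i < n then x i else p i) \<phi>" for x
    by (auto simp: E topspace_Euclidean_space cong: if_cong intro!: sat_cong)
  then have "definable_set \<RR> {x. restr n x \<in> E}"
    unfolding definable_set_def definable_pred_def using \<phi>
    by (intro exI[of _ \<phi>] exI[of _ "\<lambda>i e. if i < n then e 0 i else p i"])
      (auto intro: simple_term_if simple_term_var simple_term_const)
  then show "E \<subseteq> topspace (Euclidean_space n) \<and> definable_set \<RR> {x. restr n x \<in> E}"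
    using E by auto
next
  assume R: "E \<subseteq> topspace (Euclidean_space n) \<and> definable_set \<RR> {x. restr n x \<in> E}"
  then obtain \<phi> T where \<phi>: "wf_fm \<RR> \<phi>" and T: "\<And>m. simple_term (T m)"
    and E: "\<And>e. restr n (e 0) \<in> E \<longleftrightarrow> sat \<RR> (\<lambda>m. T m e) \<phi>"
    unfolding definable_set_def definable_pred_def by auto
  define T' where "T' = (\<lambda>m x. T m (\<lambda>k. if k = 0 then restr n x else (\<lambda>_. 0)))"
  have T': "(\<exists>i<n. T' m = (\<lambda>x. x i)) \<or> (\<exists>c. T' m = (\<lambda>_. c))" for m
  proof -
    consider k i where "T m = (\<lambda>e. e k i)" | c where "T m = (\<lambda>_. c)"
      using T[of m] by (auto simp: simple_term_def)
    then show ?thesis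
    proof cases
      case (1 k i)
      then show ?thesis by (cases "k = 0"; cases "i < n") (auto simp: T'_def)
    next
      case (2 c)
      then show ?thesis by (auto simp: T'_def)
    qed
  qed
  define isv where "isv = (\<lambda>m. \<exists>i<n. T' m = (\<lambda>x. x i))"
  define w where "w = (\<lambda>m. if isv m then SOME i. i < n \<and> T' m = (\<lambda>x. x i) else m + n)"
  obtain \<psi> where \<psi>: "wf_fm \<RR> \<psi>" "\<And>e. sat \<RR> e \<psi> \<longleftrightarrow> sat \<RR> (\<lambda>i. e (w i)) \<phi>"
    using ex_rename_fm[OF \<phi>, of w] by auto
  define p where "p = (\<lambda>j. T' (j - n) (\<lambda>_. 0))"
  have w: "(if w m < n then x (w m) else p (w m)) = T' m x" for m x
  proof (cases "isv m")
    case True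
    then have "w m < n \<and> T' m = (\<lambda>x. x (w m))"
      unfolding w_def isv_def using someI_ex[of "\<lambda>i. i < n \<and> T' m = (\<lambda>x. x i)"] by auto
    then show ?thesis by auto
  next
    case False
    then show ?thesis using T'[of m] by (auto simp: w_def isv_def p_def)
  qed
  have "x \<in> E \<longleftrightarrow> sat \<RR> (\<lambda>i. if i < n then x i else p i) \<psi>"
    if "x \<in> topspace (Euclidean_space n)" for x
  proof -
    have x: "restr n x = x"
      using that by (auto simp: topspace_Euclidean_space)
    have "x \<in> E \<longleftrightarrow> sat \<RR> (\<lambda>m. T' m x) \<phi>"
      using E[of "\<lambda>k. if k = 0 then restr n x else (\<lambda>_. 0)"] by (simp add: T'_def x cong: if_cong)
    then show ?thesis by (simp add: \<psi>(2) comp_def w)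
  qed
  then show "definable \<RR> n E"
    unfolding definable_def using R \<psi>(1) by (intro exI[of _ \<psi>] exI[of _ p]) auto
qed

lemma definable_real_iff: "definable_real \<RR> A \<longleftrightarrow> definable_pred \<RR> (\<lambda>e. e 0 0 \<in> A)"
proof -
  have "restr 1 x \<in> {x \<in> topspace (Euclidean_space 1). x 0 \<in> A} \<longleftrightarrow> x 0 \<in> A" for x
    by (auto simp: topspace_Euclidean_space)
  then show ?thesis
    unfolding definable_real_def definable_iff_definable_set definable_set_def by auto
qed

lemma definable_real_Collect:
  "definable_pred \<RR> (\<lambda>e. P (e 0 0)) \<Longrightarrow> definable_real \<RR> {t. P t}"
  by (simp add: definable_real_iff)

lemma definable_set_Collect:
  "definable_pred \<RR> (\<lambda>e. P (e 0)) \<Longrightarrow> definable_set \<RR> {x. P x}"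
  by (simp add: definable_set_def)

lemma definable_pred_mem_real:
  assumes "definable_real \<RR> A" and "simple_term t"
  shows "definable_pred \<RR> (\<lambda>e. t e \<in> A)"
  using definable_pred_subst[OF assms(1)[unfolded definable_real_iff], of "\<lambda>e k i. t e"] assms(2)
  by simp

section \<open>Definable sets decide boxes\<close>

text \<open>The working form of local o-minimality, shown equivalent in
  \<open>locally_o_minimal_iff_tame\<close>. Compactness is already built in, and frontiers can be
  expressed with the order alone.\<close>

definition tame :: "('f, 'r) expansion \<Rightarrow> bool" where
  "tame \<RR> \<longleftrightarrow> (\<forall>S. definable_real \<RR> S \<longrightarrow> (\<forall>a b. finite (frontier S \<inter> {a..b})))"

text \<open>Sets in n-space are handled as their preimages under the restriction to the first
  \<open>n\<close> coordinates. All dimensions then live in one type, and passing to more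
  coordinates needs no map.\<close>

definition cylinder :: "nat \<Rightarrow> (nat \<Rightarrow> real) set \<Rightarrow> bool" where
  "cylinder n A \<longleftrightarrow> (\<forall>x y. (\<forall>i<n. x i = y i) \<longrightarrow> (x \<in> A \<longleftrightarrow> y \<in> A))"

definition obox :: "nat \<Rightarrow> (nat \<Rightarrow> real) \<Rightarrow> (nat \<Rightarrow> real) \<Rightarrow> (nat \<Rightarrow> real) set" where
  "obox n a b = {x. \<forall>i<n. a i < x i \<and> x i < b i}"

text \<open>Strictness at both ends puts the closed inner box into the open outer one, which makes
  nested sequences of boxes meet; it also records that the inner box is nondegenerate.\<close>

definition subbox :: "nat \<Rightarrow> (nat \<Rightarrow> real) \<Rightarrow> (nat \<Rightarrow> real) \<Rightarrow> (nat \<Rightarrow> real) \<Rightarrow> (nat \<Rightarrow> real) \<Rightarrow> bool" where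
  "subbox n c d a b \<longleftrightarrow> (\<forall>i<n. a i < c i \<and> c i < d i \<and> d i < b i)"

definition fibre :: "nat \<Rightarrow> (nat \<Rightarrow> real) set \<Rightarrow> (nat \<Rightarrow> real) \<Rightarrow> real set" where
  "fibre n A x = {t. x(n := t) \<in> A}"

lemma mem_fibre [simp]: "t \<in> fibre n A x \<longleftrightarrow> x(n := t) \<in> A"
  by (simp add: fibre_def)

lemma cylinderD: "cylinder n A \<Longrightarrow> (\<And>i. i < n \<Longrightarrow> x i = y i) \<Longrightarrow> x \<in> A \<longleftrightarrow> y \<in> A"
  by (auto simp: cylinder_def)

lemma fibre_cong: "cylinder (Suc n) A \<Longrightarrow> (\<And>i. i < n \<Longrightarrow> x i = y i) \<Longrightarrow> fibre n A x = fibre n A y"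
  unfolding fibre_def by (intro Collect_cong cylinderD) (auto simp: less_Suc_eq)

lemma cylinder_Suc: "cylinder n A \<Longrightarrow> cylinder (Suc n) A"
  by (auto simp: cylinder_def)

lemma cylinder_mono: "cylinder m A \<Longrightarrow> m \<le> n \<Longrightarrow> cylinder n A"
  by (auto simp: cylinder_def)

lemma cylinder_Int: "cylinder n A \<Longrightarrow> cylinder n B \<Longrightarrow> cylinder n (A \<inter> B)"
  and cylinder_Diff: "cylinder n A \<Longrightarrow> cylinder n B \<Longrightarrow> cylinder n (A - B)"
  and cylinder_Compl: "cylinder n A \<Longrightarrow> cylinder n (- A)"
  unfolding cylinder_def by blast+

lemma definable_set_Int: "definable_set \<RR> A \<Longrightarrow> definable_set \<RR> B \<Longrightarrow> definable_set \<RR> (A \<inter> B)"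
  and definable_set_Diff: "definable_set \<RR> A \<Longrightarrow> definable_set \<RR> B \<Longrightarrow> definable_set \<RR> (A - B)"
  and definable_set_Compl: "definable_set \<RR> A \<Longrightarrow> definable_set \<RR> (- A)"
  by (simp_all add: definable_set_def definable_pred_conj definable_pred_not)

lemma subbox_trans: "subbox n c d a b \<Longrightarrow> subbox n a b a' b' \<Longrightarrow> subbox n c d a' b'"
  unfolding subbox_def by (meson less_trans)

lemma subbox_imp_subset: "subbox n c d a b \<Longrightarrow> obox n c d \<subseteq> obox n a b"
  unfolding subbox_def obox_def by (auto intro: less_trans)

lemma ex_subbox:
  assumes "\<forall>i<n. a i < b i"
  obtains c d where "subbox n c d a b"
proof
  show "subbox n (\<lambda>i. (2 * a i + b i) / 3) (\<lambda>i. (a i + 2 * b i) / 3) a b"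
    using assms by (auto simp: subbox_def)
qed

lemma subbox_nonempty: "subbox n c d a b \<Longrightarrow> \<forall>i<n. c i < d i"
  by (auto simp: subbox_def)

lemma ex_mem_obox:
  assumes "\<forall>i<n. a i < b i"
  obtains x where "x \<in> obox n a b"
proof
  show "(\<lambda>i. (a i + b i) / 2) \<in> obox n a b"
    using assms by (auto simp: obox_def)
qed

lemma tame_fibre:
  assumes "tame \<RR>" "definable_set \<RR> A"
  shows "finite (frontier (fibre n A x) \<inter> {c..d})"
proof -
  have "definable_real \<RR> (fibre n A x)"
    unfolding fibre_def
    by (intro definable_real_Collect definable_pred_intros assms(2))
  with assms(1) show ?thesis by (auto simp: tame_def)
qed

lemma interval_decided:
  fixes S :: "real set"
  assumes "{c<..<d} \<inter> frontier S = {}"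
  shows "{c<..<d} \<subseteq> S \<or> {c<..<d} \<inter> S = {}"
  using connected_Int_frontier[of "{c<..<d}" S] assms by auto

lemma rational_interval_decided:
  fixes c d :: real
  assumes "finite (frontier S \<inter> {c..d})" "c < d"
  obtains q r :: rat where "c < of_rat q" "of_rat q < (of_rat r :: real)" "of_rat r < d"
    "{of_rat q<..<of_rat r} \<subseteq> S \<or> {of_rat q<..<of_rat r} \<inter> S = {}"
proof -
  define F where "F = frontier S \<inter> {c..d}"
  have "infinite ({c<..<d} - F)"
    using assms by (simp add: F_def Diff_infinite_finite)
  then obtain p where p: "p \<in> {c<..<d} - F"
    using infinite_imp_nonempty by blast
  have "open ({c<..<d} - F)"
    using assms(1) by (simp add: F_def finite_imp_closed open_Diff)
  then obtain e where e: "e > 0" "ball p e \<subseteq> {c<..<d} - F"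
    using p openE by blast
  obtain q :: rat where q: "p - e < of_rat q" "of_rat q < p"
    using of_rat_dense[of "p - e" p] e(1) by auto
  obtain r :: rat where r: "p < of_rat r" "of_rat r < p + e"
    using of_rat_dense[of p "p + e"] e(1) by auto
  have "{of_rat q<..<of_rat r} \<subseteq> ball p e"
    using q r by (auto simp: ball_def dist_real_def)
  with e(2) have "{of_rat q<..<of_rat r} \<inter> frontier S = {}"
    by (auto simp: F_def)
  moreover have "of_rat q \<in> ball p e" "of_rat r \<in> ball p e"
    using q r by (auto simp: ball_def dist_real_def)
  with e(2) have "c < of_rat q" "of_rat r < d" by auto
  ultimately show thesis
    using that[of q r] interval_decided[of "of_rat q" "of_rat r" S] q r by force
qed

section \<open>A category argument for definable sets\<close>

definition decides_boxes :: "('f, 'r) expansion \<Rightarrow> nat \<Rightarrow> bool" where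
  "decides_boxes \<RR> n \<longleftrightarrow>
     (\<forall>A a b. definable_set \<RR> A \<and> cylinder n A \<and> (\<forall>i<n. a i < b i) \<longrightarrow>
        (\<exists>c d. subbox n c d a b \<and> (obox n c d \<subseteq> A \<or> obox n c d \<inter> A = {})))"

text \<open>In each coordinate below \<open>n\<close> the supremum of the left ends lies between all
  left and all right ends; comparison with the next box makes the inequalities strict.\<close>

lemma nested_boxes:
  assumes "\<And>k. subbox n (c (Suc k)) (d (Suc k)) (c k) (d k)"
  obtains x where "\<And>k. x \<in> obox n (c k) (d k)"
proof
  fix k
  define x where "x = (\<lambda>i. SUP k. c k i)"
  have "c k i < x i \<and> x i < d k i" if i: "i < n" for i
  proof -
    have step: "c k i < c (Suc k) i" "c (Suc k) i < d (Suc k) i" "d (Suc k) i < d k i" for k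
      using assms[of k] i by (auto simp: subbox_def)
    have mono: "c j i \<le> c k i" "d k i \<le> d j i" if "j \<le> k" for j k
      using lift_Suc_mono_le[of "\<lambda>k. c k i" j k] lift_Suc_antimono_le[of "\<lambda>k. d k i" j k] step that
      by (simp_all add: less_imp_le)
    have le: "c j i \<le> d k i" for j k
    proof -
      have "c j i \<le> c (Suc (max j k)) i" by (rule mono) auto
      also have "\<dots> \<le> d (Suc (max j k)) i" using step(2) by (rule less_imp_le)
      also have "\<dots> \<le> d k i" by (rule mono) auto
      finally show ?thesis .
    qed
    have "bdd_above (range (\<lambda>k. c k i))"
      by (rule bdd_aboveI2[where M = "d 0 i"]) (rule le)
    then have "c (Suc k) i \<le> x i"
      by (auto simp: x_def intro: cSUP_upper)
    moreover have "x i \<le> d (Suc k) i"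
      unfolding x_def by (rule cSUP_least) (auto intro: le)
    ultimately show ?thesis
      using step[of k] by linarith
  qed
  then show "(\<lambda>i. SUP k. c k i) \<in> obox n (c k) (d k)"
    by (simp add: obox_def x_def)
qed

text \<open>Baire category with definable sets in place of closed ones. If no \<open>A k\<close>
  contained a subbox, then, boxes being decided, each box would have a subbox disjoint from a given
  \<open>A k\<close>; shrinking successively for all \<open>k\<close> leaves a common point that no
  \<open>A k\<close> covers.\<close>

lemma box_category:
  fixes A :: "'k::countable \<Rightarrow> (nat \<Rightarrow> real) set"
  assumes dec: "decides_boxes \<RR> n"
    and A: "\<And>k. definable_set \<RR> (A k)" "\<And>k. cylinder n (A k)"
    and ab: "\<forall>i<n. a i < b i"
    and cover: "obox n a b \<subseteq> (\<Union>k. A k)"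
  obtains k c d where "subbox n c d a b" "obox n c d \<subseteq> A k"
proof (rule ccontr)
  assume "\<not> thesis"
  with that have no: "\<not> obox n c d \<subseteq> A k" if "subbox n c d a b" for k c d
    using that by blast
  define P where "P = (\<lambda>(k::nat) s. subbox n (fst s) (snd s) a b)"
  define Q where "Q = (\<lambda>(k::nat) s s'. subbox n (fst s') (snd s') (fst s) (snd s) \<and>
     obox n (fst s') (snd s') \<inter> A (from_nat k) = {})"
  obtain c0 d0 where "subbox n c0 d0 a b" using ex_subbox[OF ab] .
  then have 1: "\<exists>s. P 0 s" by (auto simp: P_def)
  have 2: "\<exists>s'. P (Suc k) s' \<and> Q k s s'" if Pk: "P k s" for k s
  proof -
    obtain c d where cd: "subbox n c d (fst s) (snd s)"
      "obox n c d \<subseteq> A (from_nat k) \<or> obox n c d \<inter> A (from_nat k) = {}"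
      using dec[unfolded decides_boxes_def, rule_format, of "A (from_nat k)" "fst s" "snd s"] A
        subbox_nonempty[OF Pk[unfolded P_def]] by auto
    moreover have "subbox n c d a b"
      using subbox_trans cd(1) Pk by (auto simp: P_def)
    ultimately show ?thesis
      using no[of c d] by (intro exI[of _ "(c, d)"]) (auto simp: P_def Q_def)
  qed
  obtain s where s: "\<And>k. P k (s k)" "\<And>k. Q k (s k) (s (Suc k))"
    using dependent_nat_choice[of P Q, OF 1 2] by auto
  obtain x where x: "\<And>k. x \<in> obox n (fst (s k)) (snd (s k))"
    using nested_boxes[of n "\<lambda>k. fst (s k)" "\<lambda>k. snd (s k)"] s(2) by (auto simp: Q_def)
  have "x \<notin> A (from_nat k)" for k
    using s(2)[of k] x[of "Suc k"] by (auto simp: Q_def)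
  then have "x \<notin> A k" for k
    by (metis from_nat_to_nat)
  moreover have "x \<in> obox n a b"
    using s(1)[of 0] x[of 0] subbox_imp_subset unfolding P_def by blast
  ultimately show False using cover by auto
qed

text \<open>Over each base point the last coordinate is decided on some rational interval. The base
  points with a given interval and outcome form a definable set, and there are countably many of
  these sets; the category argument in dimension \<open>n\<close> gives a box of base points with
  the same interval and outcome, and the product of that box with the interval is decided.\<close>

lemma decides_boxes:
  assumes "tame \<RR>"
  shows "decides_boxes \<RR> n"
proof (induction n)
  case 0
  have "obox 0 c d \<subseteq> A \<or> obox 0 c d \<inter> A = {}" if "cylinder 0 A" for A c d
    using that by (auto simp: cylinder_def)
  then show ?case by (simp add: decides_boxes_def subbox_def)
next
  case (Suc n)
  show ?case
    unfolding decides_boxes_def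
  proof (intro allI impI, elim conjE)
    fix A a b assume A: "definable_set \<RR> A" "cylinder (Suc n) A" and ab: "\<forall>i<Suc n. a i < (b i :: real)"
    define C where "C = (\<lambda>(q::rat, r::rat, \<beta>).
      {x. a n < of_rat q \<and> of_rat q < (of_rat r :: real) \<and> of_rat r < b n \<and>
          (\<forall>t. of_rat q < t \<and> t < of_rat r \<longrightarrow> (if \<beta> then x(n := t) \<in> A else x(n := t) \<notin> A))})"
    have C: "x \<in> C (q, r, \<beta>) \<longleftrightarrow> a n < of_rat q \<and> of_rat q < (of_rat r :: real) \<and> of_rat r < b n \<and>
          (\<forall>t. of_rat q < t \<and> t < of_rat r \<longrightarrow> (x(n := t) \<in> A \<longleftrightarrow> \<beta>))" for x q r \<beta>
      by (auto simp: C_def)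
    obtain k c d where cd: "subbox n c d a b" "obox n c d \<subseteq> C k"
    proof (rule box_category[OF Suc.IH])
      fix k :: "rat \<times> rat \<times> bool"
      obtain q r \<beta> where k: "k = (q, r, \<beta>)" by (cases k)
      show "definable_set \<RR> (C k)"
        unfolding k C_def split
        by (cases \<beta>; simp only: if_True if_False; intro definable_set_Collect definable_pred_intros A)
      show "cylinder n (C k)"
        unfolding k cylinder_def
      proof (intro allI impI)
        fix x y :: "nat \<Rightarrow> real" assume "\<forall>i<n. x i = y i"
        then have "fibre n A x = fibre n A y" by (intro fibre_cong[OF A(2)]) simp
        then have "x(n := t) \<in> A \<longleftrightarrow> y(n := t) \<in> A" for t using mem_fibre by metis
        then show "x \<in> C (q, r, \<beta>) \<longleftrightarrow> y \<in> C (q, r, \<beta>)" by (simp add: C)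
      qed
    next
      show "\<forall>i<n. a i < b i" using ab by auto
    next
      show "obox n a b \<subseteq> (\<Union>k. C k)"
      proof
        fix x
        have "finite (frontier (fibre n A x) \<inter> {a n..b n})"
          by (rule tame_fibre[OF assms A(1)])
        then obtain q r :: rat where qr: "a n < of_rat q" "of_rat q < (of_rat r :: real)" "of_rat r < b n"
          "{of_rat q<..<of_rat r} \<subseteq> fibre n A x \<or> {of_rat q<..<of_rat r} \<inter> fibre n A x = {}"
          using rational_interval_decided[of "fibre n A x" "a n" "b n"] ab by auto
        then have "x \<in> C (q, r, True) \<or> x \<in> C (q, r, False)"
          unfolding C subset_iff disjoint_iff greaterThanLessThan_iff mem_fibre by simp
        then show "x \<in> (\<Union>k. C k)" by blast
      qed
    qed
    obtain q r \<beta> where k: "k = (q, r, \<beta>)" by (cases k)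
    define c' where "c' = c(n := of_rat q)"
    define d' where "d' = d(n := of_rat r)"
    obtain x0 where "x0 \<in> obox n c d"
      using ex_mem_obox subbox_nonempty[OF cd(1)] by blast
    with cd(2) have "x0 \<in> C (q, r, \<beta>)" by (auto simp: k)
    then have sub: "subbox (Suc n) c' d' a b"
      using cd(1) by (auto simp: subbox_def c'_def d'_def less_Suc_eq C)
    have "x \<in> A \<longleftrightarrow> \<beta>" if "x \<in> obox (Suc n) c' d'" for x
    proof -
      have "x \<in> obox n c d" "of_rat q < x n" "x n < of_rat r"
        using that by (auto simp: obox_def c'_def d'_def split: if_splits)
      moreover from this(1) have "x \<in> C (q, r, \<beta>)" using cd(2) k by auto
      ultimately have "x(n := x n) \<in> A \<longleftrightarrow> \<beta>" unfolding C by blast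
      then show ?thesis by simp
    qed
    then have "obox (Suc n) c' d' \<subseteq> A \<or> obox (Suc n) c' d' \<inter> A = {}"
      by (cases \<beta>) auto
    with sub show "\<exists>c d. subbox (Suc n) c d a b \<and> (obox (Suc n) c d \<subseteq> A \<or> obox (Suc n) c d \<inter> A = {})"
      by (intro exI[of _ c'] exI[of _ d'] conjI)
  qed
qed

text \<open>Smallness of exceptional sets. In dimension 0 every box is the whole space, so a thin
  cylinder is empty there; this is the base case of \<open>fpc_thin\<close>.\<close>

definition thin :: "nat \<Rightarrow> (nat \<Rightarrow> real) set \<Rightarrow> bool" where
  "thin n Z \<longleftrightarrow> (\<forall>a b. (\<forall>i<n. a i < b i) \<longrightarrow> \<not> obox n a b \<subseteq> Z)"

section \<open>Generic local triviality\<close>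

text \<open>Balls are replaced by order intervals, because only these can be written in a formula;
  definability of conditions on frontiers of fibres rests on this form.\<close>

lemma frontier_real_iff:
  fixes S :: "real set"
  shows "t \<in> frontier S \<longleftrightarrow>
    (\<forall>u v. u < t \<and> t < v \<longrightarrow> (\<exists>s. u < s \<and> s < v \<and> s \<in> S) \<and> (\<exists>s. u < s \<and> s < v \<and> s \<notin> S))"
proof
  assume "t \<in> frontier S"
  then have "\<exists>x\<in>S. dist t x < e" "\<exists>x. x \<notin> S \<and> dist t x < e" if "e > 0" for e
    using that by (auto simp: frontier_straddle)
  then show "\<forall>u v. u < t \<and> t < v \<longrightarrow> (\<exists>s. u < s \<and> s < v \<and> s \<in> S) \<and> (\<exists>s. u < s \<and> s < v \<and> s \<notin> S)"
  proof (intro allI impI)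
    fix u v assume uv: "u < t \<and> t < v"
    define e where "e = min (t - u) (v - t)"
    have "e > 0" using uv by (auto simp: e_def)
    moreover have "u < s \<and> s < v" if "dist t s < e" for s
      using that by (auto simp: e_def dist_real_def)
    ultimately show "(\<exists>s. u < s \<and> s < v \<and> s \<in> S) \<and> (\<exists>s. u < s \<and> s < v \<and> s \<notin> S)"
      using \<open>\<And>e. e > 0 \<Longrightarrow> \<exists>x\<in>S. dist t x < e\<close> \<open>\<And>e. e > 0 \<Longrightarrow> \<exists>x. x \<notin> S \<and> dist t x < e\<close> by metis
  qed
next
  assume R: "\<forall>u v. u < t \<and> t < v \<longrightarrow> (\<exists>s. u < s \<and> s < v \<and> s \<in> S) \<and> (\<exists>s. u < s \<and> s < v \<and> s \<notin> S)"
  show "t \<in> frontier S"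
    unfolding frontier_straddle
  proof (intro allI impI)
    fix e :: real assume "0 < e"
    then have "(\<exists>s. t - e < s \<and> s < t + e \<and> s \<in> S) \<and> (\<exists>s. t - e < s \<and> s < t + e \<and> s \<notin> S)"
      by (intro R[rule_format]) auto
    then show "(\<exists>x\<in>S. dist t x < e) \<and> (\<exists>x. x \<notin> S \<and> dist t x < e)"
      by (force simp: dist_real_def)
  qed
qed

text \<open>The third alternative fixes only that the frontier has one point in the window. Which
  side belongs to the set, and whether the point itself does, may vary over the box; this is settled
  later by connectedness.\<close>

definition trivial_over :: "nat \<Rightarrow> (nat \<Rightarrow> real) set \<Rightarrow> real \<Rightarrow> real \<Rightarrow> (nat \<Rightarrow> real) \<Rightarrow> (nat \<Rightarrow> real) \<Rightarrow> bool" where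
  "trivial_over n E c d a b \<longleftrightarrow>
     (\<forall>y s. y \<in> obox n a b \<and> c < s \<and> s < d \<longrightarrow> s \<in> fibre n E y) \<or>
     (\<forall>y s. y \<in> obox n a b \<and> c < s \<and> s < d \<longrightarrow> s \<notin> fibre n E y) \<or>
     (\<forall>y. y \<in> obox n a b \<longrightarrow> (\<exists>!s. c < s \<and> s < d \<and> s \<in> frontier (fibre n E y)))"

definition good_at :: "nat \<Rightarrow> (nat \<Rightarrow> real) set \<Rightarrow> (nat \<Rightarrow> real) \<Rightarrow> real \<Rightarrow> real \<Rightarrow> real \<Rightarrow> bool" where
  "good_at n E x t q r \<longleftrightarrow> (\<exists>c d a b. q \<le> c \<and> c < t \<and> t < d \<and> d \<le> r \<and> x \<in> obox n a b \<and> trivial_over n E c d a b)"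

text \<open>The window from \<open>q\<close> to \<open>r\<close> can be arbitrarily small around
  \<open>t\<close>; this later gives continuity of the sections. The box is quantified through its
  corners, which keeps the condition first-order.\<close>

definition good :: "nat \<Rightarrow> (nat \<Rightarrow> real) set \<Rightarrow> (nat \<Rightarrow> real) set" where
  "good n E = {x. \<forall>t q r. q < t \<and> t < r \<longrightarrow> good_at n E x t q r}"

lemmas good_unfold = good_def good_at_def trivial_over_def mem_fibre frontier_real_iff Ex1_def
  obox_def mem_Collect_eq

lemma definable_good: "definable_set \<RR> E \<Longrightarrow> definable_set \<RR> (good n E)"
  unfolding good_unfold
  by (intro definable_set_Collect definable_pred_intros)

lemma obox_cong: "(\<And>i. i < n \<Longrightarrow> x i = y i) \<Longrightarrow> x \<in> obox n a b \<longleftrightarrow> y \<in> obox n a b"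
  by (auto simp: obox_def)

lemma good_at_cong: "(\<And>i. i < n \<Longrightarrow> x i = y i) \<Longrightarrow> good_at n E x t q r = good_at n E y t q r"
  unfolding good_at_def using obox_cong[of n x y] by simp

lemma cylinder_good: "cylinder n (good n E)"
  unfolding cylinder_def
proof (intro allI impI)
  fix x y :: "nat \<Rightarrow> real" assume "\<forall>i<n. x i = y i"
  then have "good_at n E x = good_at n E y" by (intro ext good_at_cong) simp
  then show "x \<in> good n E \<longleftrightarrow> y \<in> good n E" by (simp add: good_def)
qed

lemma good_at_mono: "good_at n E x t q r \<Longrightarrow> q' \<le> q \<Longrightarrow> r \<le> r' \<Longrightarrow> good_at n E x t q' r'"
  unfolding good_at_def by (meson order.trans)

lemma finite_avoid_interval:
  fixes t :: real
  assumes "finite F" "q0 < t" "t < r0"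
  obtains q r where "q0 \<le> q" "q < t" "t < r" "r \<le> r0" "F \<inter> {q..r} \<subseteq> {t}"
proof -
  have "open (- (F - {t}))" by (intro open_Compl finite_imp_closed finite_Diff assms(1))
  moreover have "t \<in> - (F - {t})" by simp
  ultimately obtain e where e: "e > 0" "ball t e \<subseteq> - (F - {t})" using openE by blast
  show thesis
  proof
    show "F \<inter> {max q0 (t - e / 2)..min r0 (t + e / 2)} \<subseteq> {t}"
    proof
      fix s assume s: "s \<in> F \<inter> {max q0 (t - e / 2)..min r0 (t + e / 2)}"
      then have "s \<in> ball t e" using e(1) by (auto simp: ball_def dist_real_def)
      with e(2) s show "s \<in> {t}" by auto
    qed
  qed (use assms e(1) in auto)
qed

text \<open>If goodness fails at height \<open>t\<close> over a base point, finiteness of the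
  frontier allows a rational window around \<open>t\<close> with no frontier point except possibly
  \<open>t\<close>, and one of three patterns holds on it. If bad points filled a box, the category
  argument would give a subbox on which window and pattern are constant; there the pattern is a
  local trivialisation, against the failure.\<close>

lemma thin_Compl_good:
  assumes "tame \<RR>" and E: "definable_set \<RR> E" "cylinder (Suc n) E"
  shows "thin n (- good n E)"
  unfolding thin_def
proof (intro allI impI notI)
  fix a b assume ab: "\<forall>i<n. a i < (b i :: real)" and bad: "obox n a b \<subseteq> - good n E"
  \<comment> \<open>The number \<open>m\<close> codes the alternatives of
    \<open>trivial_over\<close>: inside, outside, one frontier point. Every value from 2 on stands
    for the last one, so that a plain number can index the countable family.\<close>
  define pat where "pat = (\<lambda>(q, r, m::nat) x.
      if m = 0 then \<forall>s. q < s \<and> s < r \<longrightarrow> x(n := s) \<in> E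
      else if m = 1 then \<forall>s. q < s \<and> s < r \<longrightarrow> x(n := s) \<notin> E
      else \<exists>!s. q < s \<and> s < r \<and> s \<in> frontier (fibre n E x))"
  define A where "A = (\<lambda>(q::rat, r::rat, m).
      {x. (\<exists>t. of_rat q < t \<and> t < of_rat r \<and> \<not> good_at n E x t (of_rat q) (of_rat r)) \<and>
          pat (of_rat q, of_rat r, m) x})"
  obtain k c d where cd: "subbox n c d a b" "obox n c d \<subseteq> A k"
  proof (rule box_category[OF decides_boxes[OF assms(1)]])
    fix k :: "rat \<times> rat \<times> nat"
    obtain q r m where k: "k = (q, r, m)" by (cases k)
    consider "m = 0" | "m = 1" | "m \<noteq> 0" "m \<noteq> 1" by blast
    then show "definable_set \<RR> (A k)"
      by cases (simp only: k A_def pat_def split if_True if_False good_unfold refl one_neq_zero;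
          intro definable_set_Collect definable_pred_intros E)+
    show "cylinder n (A k)"
      unfolding k cylinder_def
    proof (intro allI impI)
      fix x y :: "nat \<Rightarrow> real" assume xy: "\<forall>i<n. x i = y i"
      then have f: "fibre n E x = fibre n E y" by (intro fibre_cong[OF E(2)]) simp
      then have "x(n := t) \<in> E \<longleftrightarrow> y(n := t) \<in> E" for t using mem_fibre by metis
      moreover have "good_at n E x = good_at n E y" using xy by (intro ext good_at_cong) simp
      ultimately show "x \<in> A (q, r, m) \<longleftrightarrow> y \<in> A (q, r, m)"
        using f by (simp add: A_def pat_def)
    qed
  next
    show "obox n a b \<subseteq> (\<Union>k. A k)"
    proof
      fix x assume "x \<in> obox n a b"
      with bad have "x \<notin> good n E" by blast
      then obtain t q0 r0 where t: "q0 < t" "t < r0" and nb: "\<not> good_at n E x t q0 r0"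
        unfolding good_def by blast
      let ?F = "frontier (fibre n E x)"
      have "finite (?F \<inter> {q0..r0})"
        by (rule tame_fibre[OF assms(1) E(1)])
      then obtain q1 r1 where 1: "q0 \<le> q1" "q1 < t" "t < r1" "r1 \<le> r0" "(?F \<inter> {q0..r0}) \<inter> {q1..r1} \<subseteq> {t}"
        using finite_avoid_interval t by metis
      obtain q :: rat where q: "q1 < of_rat q" "of_rat q < t" using of_rat_dense 1 by blast
      obtain r :: rat where r: "t < of_rat r" "of_rat r < r1" using of_rat_dense 1 by blast
      have F: "?F \<inter> {of_rat q<..<of_rat r} \<subseteq> {t}"
        using 1 q r by force
      \<comment> \<open>Goodness for a smaller window implies goodness for a larger one, so failure
        passes down to the rational window.\<close>
      have nb': "\<not> good_at n E x t (of_rat q) (of_rat r)"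
        using nb good_at_mono 1 q r by (meson less_le_trans less_imp_le)
      have "\<exists>m. pat (of_rat q, of_rat r, m) x"
      proof (cases "t \<in> ?F")
        case True
        then have "\<exists>!s. of_rat q < s \<and> s < of_rat r \<and> s \<in> ?F"
          using F q r by (intro ex1I[of _ t]) auto
        then have "pat (of_rat q, of_rat r, 2) x"
          by (simp add: pat_def)
        then show ?thesis ..
      next
        case False
        with F have "{of_rat q<..<of_rat r} \<inter> ?F = {}" by auto
        from interval_decided[OF this]
        have "pat (of_rat q, of_rat r, 0) x \<or> pat (of_rat q, of_rat r, 1) x"
          by (auto simp: pat_def subset_iff disjoint_iff)
        then show ?thesis by blast
      qed
      then obtain m where "pat (of_rat q, of_rat r, m) x" ..
      then have "x \<in> A (q, r, m)" using nb' q r by (auto simp: A_def)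
      then show "x \<in> (\<Union>k. A k)" by blast
    qed
  next
    show "\<forall>i<n. a i < b i" by (fact ab)
  qed
  obtain q r m where k: "k = (q, r, m)" by (cases k)
  have pat: "pat (of_rat q, of_rat r, m) y" if "y \<in> obox n c d" for y
    using cd(2) that by (auto simp: k A_def)
  have "trivial_over n E (of_rat q) (of_rat r) c d"
  proof -
    consider "m = 0" | "m = 1" | "m \<noteq> 0" "m \<noteq> 1" by blast
    then show ?thesis
      by cases (use pat in \<open>simp_all add: trivial_over_def pat_def\<close>)
  qed
  moreover obtain x where x: "x \<in> obox n c d"
    using ex_mem_obox subbox_nonempty[OF cd(1)] by blast
  moreover obtain t where "of_rat q < t" "t < of_rat r" "\<not> good_at n E x t (of_rat q) (of_rat r)"
    using cd(2) x by (auto simp: k A_def)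
  ultimately show False
    unfolding good_at_def by blast
qed

section \<open>Fibres over good base points\<close>

lemma obtain_frontier_interval:
  fixes S :: "real set"
  assumes "t \<notin> frontier S"
  obtains q r where "q < t" "t < r" "{q<..<r} \<inter> frontier S = {}"
proof -
  obtain e where e: "e > 0" "ball t e \<subseteq> - frontier S"
    using openE[of "- frontier S" t] assms by (auto simp: frontier_closed open_Compl)
  have "{t - e<..<t + e} \<subseteq> ball t e"
    by (auto simp: ball_def dist_real_def)
  with e that[of "t - e" "t + e"] show thesis by auto
qed

text \<open>A window without frontier points of the fibre at \<open>x\<close> excludes the third
  alternative of \<open>trivial_over\<close>, since that alternative would have to hold at
  \<open>x\<close> as well.\<close>

lemma good_off_frontier:
  assumes "x \<in> good n E" and "t \<notin> frontier (fibre n E x)"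
  obtains c d a b where "c < t" "t < d" "x \<in> obox n a b"
    "(\<forall>y\<in>obox n a b. {c<..<d} \<subseteq> fibre n E y) \<or> (\<forall>y\<in>obox n a b. {c<..<d} \<inter> fibre n E y = {})"
proof -
  obtain q r where qr: "q < t" "t < r" "{q<..<r} \<inter> frontier (fibre n E x) = {}"
    using obtain_frontier_interval[OF assms(2)] .
  then have "good_at n E x t q r" using assms(1) by (simp add: good_def)
  then obtain c d a b where cd: "q \<le> c" "c < t" "t < d" "d \<le> r" "x \<in> obox n a b"
    and triv: "trivial_over n E c d a b"
    unfolding good_at_def by blast
  have "\<not> (\<exists>s. c < s \<and> s < d \<and> s \<in> frontier (fibre n E x))"
    using qr(3) cd by force
  then have "(\<forall>y s. y \<in> obox n a b \<and> c < s \<and> s < d \<longrightarrow> s \<in> fibre n E y) \<or>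
     (\<forall>y s. y \<in> obox n a b \<and> c < s \<and> s < d \<longrightarrow> s \<notin> fibre n E y)"
    using triv cd(5) unfolding trivial_over_def by (meson ex1_implies_ex)
  then show thesis
    by (intro that[OF cd(2,3,5)]) (auto simp: subset_iff disjoint_iff)
qed

text \<open>Each neighbourhood of a frontier point meets the fibre and its complement, which
  excludes the two constant alternatives.\<close>

lemma good_on_frontier:
  assumes "x \<in> good n E" and t: "t \<in> frontier (fibre n E x)" and "q < t" "t < r"
  obtains c d a b where "q \<le> c" "c < t" "t < d" "d \<le> r" "x \<in> obox n a b"
    "\<And>y. y \<in> obox n a b \<Longrightarrow> \<exists>!s. c < s \<and> s < d \<and> s \<in> frontier (fibre n E y)"
proof -
  have "good_at n E x t q r" using assms by (simp add: good_def)
  then obtain c d a b where cd: "q \<le> c" "c < t" "t < d" "d \<le> r" "x \<in> obox n a b"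
    and triv: "trivial_over n E c d a b"
    unfolding good_at_def by blast
  have "(\<exists>s. c < s \<and> s < d \<and> s \<in> fibre n E x) \<and> (\<exists>s. c < s \<and> s < d \<and> s \<notin> fibre n E x)"
    using t cd unfolding frontier_real_iff by blast
  with triv cd(5) have "\<forall>y. y \<in> obox n a b \<longrightarrow> (\<exists>!s. c < s \<and> s < d \<and> s \<in> frontier (fibre n E y))"
    unfolding trivial_over_def by blast
  then show thesis by (intro that[OF cd]) blast
qed

text \<open>The factor 2 keeps the open \<delta>-neighbourhoods of different points disjoint and in
  the order of the points.\<close>

lemma finite_gap:
  fixes F :: "real set"
  assumes "finite F"
  obtains \<delta> where "\<delta> > 0" "\<And>s t. s \<in> F \<Longrightarrow> t \<in> F \<Longrightarrow> s < t \<Longrightarrow> 2 * \<delta> \<le> t - s"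
proof -
  \<comment> \<open>The number 1 makes the set of distances nonempty when \<open>F\<close> has fewer
    than two points.\<close>
  define D where "D = insert 1 ((\<lambda>(s, t). t - s) ` {p \<in> F \<times> F. fst p < snd p})"
  have fin: "finite D" using assms by (simp add: D_def)
  have "d > 0" if "d \<in> D" for d using that by (auto simp: D_def)
  moreover have "D \<noteq> {}" by (simp add: D_def)
  ultimately have "Min D > 0" using fin by simp
  moreover have "Min D \<le> t - s" if "s \<in> F" "t \<in> F" "s < t" for s t
    by (rule Min_le[OF fin]) (use that in \<open>force simp: D_def\<close>)
  ultimately show thesis using that[of "Min D / 2"] by simp
qed

lemma obox_Int: "obox n a b \<inter> obox n a' b' = obox n (\<lambda>i. max (a i) (a' i)) (\<lambda>i. min (b i) (b' i))"
  by (auto simp: obox_def)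

lemma finite_obox_Inter:
  assumes "finite T" "\<And>t. t \<in> T \<Longrightarrow> x \<in> obox n (a t) (b t)"
  obtains a' b' where "x \<in> obox n a' b'" "\<And>t. t \<in> T \<Longrightarrow> obox n a' b' \<subseteq> obox n (a t) (b t)"
proof -
  have "\<exists>a' b'. x \<in> obox n a' b' \<and> (\<forall>t\<in>T. obox n a' b' \<subseteq> obox n (a t) (b t))"
    using assms
  proof (induction T)
    case empty
    have "x \<in> obox n (\<lambda>i. x i - 1) (\<lambda>i. x i + 1)" by (simp add: obox_def)
    then show ?case by blast
  next
    case (insert t T)
    then obtain a' b' where ab: "x \<in> obox n a' b'" "\<forall>t\<in>T. obox n a' b' \<subseteq> obox n (a t) (b t)"
      by auto
    define B where "B = obox n a' b' \<inter> obox n (a t) (b t)"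
    have "x \<in> B" "\<forall>s\<in>insert t T. B \<subseteq> obox n (a s) (b s)"
      using ab insert.prems by (auto simp: B_def)
    then show ?case unfolding B_def obox_Int by blast
  qed
  with that show thesis by blast
qed

text \<open>Around each frontier point at \<open>x\<close> there is a small window with exactly one
  frontier point of every nearby fibre; around every other height there is a window without any.
  Finitely many windows cover \<open>{-M..M}\<close>, where all frontiers lie, so one box serves for
  all of them and no frontier point of a nearby fibre escapes.\<close>

lemma good_local_bijection:
  assumes x: "x \<in> good n E" and fin: "finite (frontier (fibre n E x))"
    and bd: "\<And>y. frontier (fibre n E y) \<subseteq> {-M..M}" and "\<epsilon> > 0"
  obtains a b where "x \<in> obox n a b"
    "\<And>y. y \<in> obox n a b \<Longrightarrow> \<exists>\<sigma>. strict_mono_on (frontier (fibre n E x)) \<sigma> \<and>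
       \<sigma> ` frontier (fibre n E x) = frontier (fibre n E y) \<and>
       (\<forall>t\<in>frontier (fibre n E x). \<bar>\<sigma> t - t\<bar> < \<epsilon>)"
proof -
  define F where "F = (\<lambda>y. frontier (fibre n E y))"
  obtain \<delta>0 where \<delta>0: "\<delta>0 > 0" "\<And>s t. s \<in> F x \<Longrightarrow> t \<in> F x \<Longrightarrow> s < t \<Longrightarrow> 2 * \<delta>0 \<le> t - s"
    using finite_gap fin unfolding F_def by blast
  \<comment> \<open>\<open>\<delta>0\<close> keeps the windows apart, which makes the bijection
    monotone; \<open>\<epsilon>\<close> bounds how far it moves points.\<close>
  define \<delta> where "\<delta> = min \<delta>0 \<epsilon>"
  have \<delta>: "\<delta> > 0" "\<delta> \<le> \<epsilon>" "\<And>s t. s \<in> F x \<Longrightarrow> t \<in> F x \<Longrightarrow> s < t \<Longrightarrow> 2 * \<delta> \<le> t - s"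
  proof -
    show "\<delta> > 0" "\<delta> \<le> \<epsilon>" using \<delta>0(1) \<open>\<epsilon> > 0\<close> by (auto simp: \<delta>_def)
    have "\<delta> \<le> \<delta>0" by (simp add: \<delta>_def)
    then show "2 * \<delta> \<le> t - s" if "s \<in> F x" "t \<in> F x" "s < t" for s t
      using \<delta>0(2)[OF that] by linarith
  qed
  define ok where "ok = (\<lambda>t c d a b. c < t \<and> t < d \<and> x \<in> obox n a b \<and>
     (if t \<in> F x then t - \<delta> \<le> c \<and> d \<le> t + \<delta> \<and> (\<forall>y\<in>obox n a b. \<exists>!s. c < s \<and> s < d \<and> s \<in> F y)
      else \<forall>y\<in>obox n a b. {c<..<d} \<inter> F y = {}))"
  have "\<exists>c d a b. ok t c d a b" for t
  proof (cases "t \<in> F x")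
    case True
    obtain c d a b where "t - \<delta> \<le> c" "c < t" "t < d" "d \<le> t + \<delta>" "x \<in> obox n a b"
      "\<And>y. y \<in> obox n a b \<Longrightarrow> \<exists>!s. c < s \<and> s < d \<and> s \<in> frontier (fibre n E y)"
      by (rule good_on_frontier[OF x, of t "t - \<delta>" "t + \<delta>"]) (use True \<delta> in \<open>auto simp: F_def\<close>)
    then have "ok t c d a b" using True by (simp add: ok_def F_def)
    then show ?thesis by blast
  next
    case False
    obtain c d a b where cd: "c < t" "t < d" "x \<in> obox n a b"
      "(\<forall>y\<in>obox n a b. {c<..<d} \<subseteq> fibre n E y) \<or> (\<forall>y\<in>obox n a b. {c<..<d} \<inter> fibre n E y = {})"
      using good_off_frontier[OF x False[unfolded F_def]] .
    have "{c<..<d} \<inter> F y = {}" if y: "y \<in> obox n a b" for y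
    proof -
      consider "{c<..<d} \<subseteq> fibre n E y" | "{c<..<d} \<inter> fibre n E y = {}"
        using cd(4) y by blast
      then show ?thesis
      proof cases
        case 1
        then have "{c<..<d} \<subseteq> interior (fibre n E y)" by (intro interior_maximal) auto
        then show ?thesis by (auto simp: F_def frontier_def)
      next
        case 2
        then have "{c<..<d} \<inter> closure (fibre n E y) = {}"
          by (simp add: open_Int_closure_eq_empty)
        then show ?thesis by (auto simp: F_def frontier_def)
      qed
    qed
    then have "ok t c d a b" using False cd by (simp add: ok_def)
    then show ?thesis by blast
  qed
  then obtain c d a b where ok: "\<And>t. ok t (c t) (d t) (a t) (b t)" by metis
  have cd: "c t < t" "t < d t" "x \<in> obox n (a t) (b t)" for t
    using ok[of t] by (simp_all add: ok_def)
  have on: "t - \<delta> \<le> c t" "d t \<le> t + \<delta>"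
    "y \<in> obox n (a t) (b t) \<Longrightarrow> \<exists>!s. c t < s \<and> s < d t \<and> s \<in> F y" if "t \<in> F x" for t y
    using ok[of t] that by (simp_all add: ok_def)
  have off: "{c t<..<d t} \<inter> F y = {}" if "t \<notin> F x" "y \<in> obox n (a t) (b t)" for t y
    using ok[of t] that by (simp add: ok_def)
  obtain T where T: "T \<subseteq> {-M..M}" "finite T" "{-M..M} \<subseteq> (\<Union>t\<in>T. {c t<..<d t})"
  proof (rule compactE_image[where f = "\<lambda>t. {c t<..<d t}" and C = "{-M..M}" and S = "{-M..M}"])
    show "{-M..M} \<subseteq> (\<Union>t\<in>{-M..M}. {c t<..<d t})" using cd by fastforce
  qed auto
  \<comment> \<open>All frontier points are added to the finite cover: their boxes are needed to
    define \<open>\<sigma>\<close>, whether or not compactness selected them.\<close>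
  obtain a' b' where ab: "x \<in> obox n a' b'"
    "\<And>t. t \<in> T \<union> F x \<Longrightarrow> obox n a' b' \<subseteq> obox n (a t) (b t)"
    using finite_obox_Inter[of "T \<union> F x" x n a b] cd(3) T(2) fin unfolding F_def by blast
  have "\<exists>\<sigma>. strict_mono_on (F x) \<sigma> \<and> \<sigma> ` F x = F y \<and> (\<forall>t\<in>F x. \<bar>\<sigma> t - t\<bar> < \<epsilon>)"
    if y: "y \<in> obox n a' b'" for y
  proof -
    define \<sigma> where "\<sigma> = (\<lambda>t. THE s. c t < s \<and> s < d t \<and> s \<in> F y)"
    have ex: "\<exists>!s. c t < s \<and> s < d t \<and> s \<in> F y" if "t \<in> F x" for t
      using on(3)[OF that] ab(2)[of t] y that by blast
    have \<sigma>: "c t < \<sigma> t \<and> \<sigma> t < d t \<and> \<sigma> t \<in> F y" if "t \<in> F x" for t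
      unfolding \<sigma>_def by (rule theI'[OF ex[OF that]])
    have "strict_mono_on (F x) \<sigma>"
    proof (rule strict_mono_onI)
      fix s t assume st: "s \<in> F x" "t \<in> F x" "s < t"
      show "\<sigma> s < \<sigma> t"
        using \<sigma>[OF st(1)] \<sigma>[OF st(2)] on(2)[OF st(1)] on(1)[OF st(2)] \<delta>(3)[OF st] by linarith
    qed
    moreover have "\<sigma> ` F x = F y"
    proof (intro equalityI subsetI)
      fix u assume u: "u \<in> F y"
      then have "u \<in> {-M..M}" using bd[of y] by (auto simp: F_def)
      then obtain t where t: "t \<in> T" "u \<in> {c t<..<d t}" using T(3) by blast
      have "y \<in> obox n (a t) (b t)" using ab(2)[of t] t(1) y by blast
      then have tF: "t \<in> F x" using off[of t y] u t(2) by blast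
      then have "u = \<sigma> t" using ex[OF tF] \<sigma>[OF tF] u t(2) by auto
      with tF show "u \<in> \<sigma> ` F x" by blast
    qed (use \<sigma> in auto)
    moreover have "\<bar>\<sigma> t - t\<bar> < \<epsilon>" if "t \<in> F x" for t
      using \<sigma>[OF that] on(1,2)[OF that] \<delta>(2) by linarith
    ultimately show ?thesis
      by blast
  qed
  then show thesis
    unfolding F_def by (rule that[OF ab(1)])
qed

text \<open>Meaningful only if the frontier is finite and has more than i points.\<close>

definition section_of :: "nat \<Rightarrow> (nat \<Rightarrow> real) set \<Rightarrow> nat \<Rightarrow> (nat \<Rightarrow> real) \<Rightarrow> real" where
  "section_of n E i x = sorted_list_of_set (frontier (fibre n E x)) ! i"

lemma section_of_cong:
  "cylinder (Suc n) E \<Longrightarrow> (\<And>j. j < n \<Longrightarrow> x j = y j) \<Longrightarrow> section_of n E i x = section_of n E i y"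
  using fibre_cong[of n E x y] by (simp add: section_of_def)

lemma sorted_list_of_set_image:
  fixes f :: "'a::linorder \<Rightarrow> 'b::linorder"
  assumes "finite A" "strict_mono_on A f"
  shows "sorted_list_of_set (f ` A) = map f (sorted_list_of_set A)"
proof -
  have "sorted_wrt (\<lambda>x y. f x < f y) (sorted_list_of_set A)"
    by (rule sorted_wrt_mono_rel[OF _ strict_sorted_list_of_set])
      (use assms in \<open>auto dest: strict_mono_onD\<close>)
  then have "sorted_wrt (<) (map f (sorted_list_of_set A)) \<and> set (map f (sorted_list_of_set A)) = f ` A
      \<and> length (map f (sorted_list_of_set A)) = card (f ` A)"
    using assms by (auto simp: sorted_wrt_map card_image strict_mono_on_imp_inj_on)
  then show ?thesis
    using sorted_list_of_set_unique[of "f ` A" "map f (sorted_list_of_set A)"] assms(1) by simp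
qed

lemma continuous_on_coordinate: "continuous_on S (\<lambda>x::nat \<Rightarrow> real. x i)"
  by (rule continuous_on_product_coordinates[THEN continuous_on_subset]) simp

lemma open_obox: "open (obox n a b)"
proof -
  have "obox n a b = (\<Inter>i\<in>{..<n}. {x. a i < x i} \<inter> {x. x i < b i})"
    by (auto simp: obox_def)
  moreover have "open ({x::nat \<Rightarrow> real. a i < x i} \<inter> {x. x i < b i})" for i
    by (intro open_Int open_Collect_less continuous_on_const continuous_on_coordinate)
  ultimately show ?thesis by auto
qed

text \<open>The bijection between frontiers is increasing, so it preserves ranks: the
  \<open>i\<close>-th frontier point at \<open>y\<close> is the image of the \<open>i\<close>-th one
  at \<open>x\<close>.\<close>

lemma good_local_sections:
  assumes x: "x \<in> good n E" and fin: "finite (frontier (fibre n E x))"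
    and bd: "\<And>y. frontier (fibre n E y) \<subseteq> {-M..M}" and "\<epsilon> > 0"
  shows "\<exists>U. open U \<and> x \<in> U \<and>
    (\<forall>y\<in>U. card (frontier (fibre n E y)) = card (frontier (fibre n E x)) \<and>
      (\<forall>i<card (frontier (fibre n E x)). \<bar>section_of n E i y - section_of n E i x\<bar> < \<epsilon>))"
proof -
  let ?F = "\<lambda>y. frontier (fibre n E y)"
  obtain a b where ab: "x \<in> obox n a b"
    and \<sigma>: "\<And>y. y \<in> obox n a b \<Longrightarrow> \<exists>\<sigma>. strict_mono_on (?F x) \<sigma> \<and> \<sigma> ` ?F x = ?F y \<and>
       (\<forall>t\<in>?F x. \<bar>\<sigma> t - t\<bar> < \<epsilon>)"
    using good_local_bijection[OF assms] by blast
  have "card (?F y) = card (?F x) \<and> (\<forall>i<card (?F x). \<bar>section_of n E i y - section_of n E i x\<bar> < \<epsilon>)"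
    if y: "y \<in> obox n a b" for y
  proof -
    obtain \<sigma> where s: "strict_mono_on (?F x) \<sigma>" "\<sigma> ` ?F x = ?F y" "\<forall>t\<in>?F x. \<bar>\<sigma> t - t\<bar> < \<epsilon>"
      using \<sigma>[OF y] by blast
    have "card (?F y) = card (?F x)"
      using card_image[OF strict_mono_on_imp_inj_on[OF s(1)]] s(2) by simp
    moreover have "sorted_list_of_set (?F y) = map \<sigma> (sorted_list_of_set (?F x))"
      using sorted_list_of_set_image[OF fin s(1)] s(2) by simp
    moreover have "sorted_list_of_set (?F x) ! i \<in> ?F x" if "i < card (?F x)" for i
      using nth_mem[of i "sorted_list_of_set (?F x)"] that fin by simp
    ultimately show ?thesis using s(3) fin by (simp add: section_of_def)
  qed
  then show ?thesis
    by (intro exI[of _ "obox n a b"] conjI open_obox ab) blast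
qed

lemma continuous_on_section:
  assumes "P \<subseteq> good n E" and "\<And>x. x \<in> P \<Longrightarrow> finite (frontier (fibre n E x))"
    and "\<And>y. frontier (fibre n E y) \<subseteq> {-M..M}"
    and "\<And>x. x \<in> P \<Longrightarrow> i < card (frontier (fibre n E x))"
  shows "continuous_on P (section_of n E i)"
  unfolding continuous_on_def tendsto_iff
proof (intro ballI allI impI)
  fix x and \<epsilon> :: real assume x: "x \<in> P" and "\<epsilon> > 0"
  obtain U where "open U" "x \<in> U"
    "\<forall>y\<in>U. \<forall>i<card (frontier (fibre n E x)). \<bar>section_of n E i y - section_of n E i x\<bar> < \<epsilon>"
    using good_local_sections[OF subsetD[OF assms(1) x] assms(2)[OF x] assms(3) \<open>\<epsilon> > 0\<close>] by auto
  then show "\<forall>\<^sub>F y in at x within P. dist (section_of n E i y) (section_of n E i x) < \<epsilon>"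
    using assms(4)[OF x] unfolding eventually_at_topological dist_real_def by (intro exI[of _ U]) auto
qed

lemma card_frontier_constant:
  assumes "connected P" "P \<subseteq> good n E" and "\<And>x. x \<in> P \<Longrightarrow> finite (frontier (fibre n E x))"
    and "\<And>y. frontier (fibre n E y) \<subseteq> {-M..M}"
    and "x \<in> P" "y \<in> P"
  shows "card (frontier (fibre n E x)) = card (frontier (fibre n E y))"
proof (rule connected_local_const[OF assms(1,5,6)], intro ballI)
  fix z assume z: "z \<in> P"
  obtain U where "open U" "z \<in> U"
    "\<forall>y\<in>U. card (frontier (fibre n E y)) = card (frontier (fibre n E z))"
    using good_local_sections[OF subsetD[OF assms(2) z] assms(3)[OF z] assms(4) zero_less_one] by blast
  then show "\<forall>\<^sub>F w in at z within P. card (frontier (fibre n E z)) = card (frontier (fibre n E w))"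
    unfolding eventually_at_topological by metis
qed

section \<open>Finite unions of path connected sets\<close>

text \<open>The pieces may overlap and need be neither definable nor relatively open. The notion is
  stable under finite unions and continuous images, which is all that the induction asks of
  it.\<close>

definition finitely_path_connected :: "'a::topological_space set \<Rightarrow> bool" where
  "finitely_path_connected S \<longleftrightarrow> (\<exists>\<C>. finite \<C> \<and> (\<forall>C\<in>\<C>. path_connected C) \<and> S = \<Union>\<C>)"

lemma fpc_UN:
  assumes "finite I" "\<And>i. i \<in> I \<Longrightarrow> finitely_path_connected (S i)"
  shows "finitely_path_connected (\<Union>i\<in>I. S i)"
proof -
  obtain \<C> where C: "\<And>i. i \<in> I \<Longrightarrow> finite (\<C> i) \<and> (\<forall>C\<in>\<C> i. path_connected C) \<and> S i = \<Union>(\<C> i)"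
    using assms(2) unfolding finitely_path_connected_def by metis
  then show ?thesis
    unfolding finitely_path_connected_def using assms(1)
    by (intro exI[of _ "\<Union>i\<in>I. \<C> i"]) auto
qed

lemma fpc_path_connected: "path_connected S \<Longrightarrow> finitely_path_connected S"
  unfolding finitely_path_connected_def by (intro exI[of _ "{S}"]) auto

lemma fpc_Un:
  assumes "finitely_path_connected S" "finitely_path_connected T"
  shows "finitely_path_connected (S \<union> T)"
proof -
  obtain \<C> \<D> where "finite \<C>" "\<forall>C\<in>\<C>. path_connected C" "S = \<Union>\<C>"
    "finite \<D>" "\<forall>C\<in>\<D>. path_connected C" "T = \<Union>\<D>"
    using assms unfolding finitely_path_connected_def by blast
  then show ?thesis
    unfolding finitely_path_connected_def by (intro exI[of _ "\<C> \<union> \<D>"]) auto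
qed

lemma fpc_image:
  assumes "finitely_path_connected S" "continuous_on S f"
  shows "finitely_path_connected (f ` S)"
proof -
  obtain \<C> where "finite \<C>" "\<forall>C\<in>\<C>. path_connected C" "S = \<Union>\<C>"
    using assms(1) unfolding finitely_path_connected_def by blast
  then show ?thesis
    unfolding finitely_path_connected_def
    by (intro exI[of _ "(`) f ` \<C>"])
      (auto intro!: path_connected_continuous_image intro: continuous_on_subset[OF assms(2)])
qed

section \<open>Graphs and bands over a path connected base\<close>

lemma frontier_finite_real:
  fixes S :: "real set"
  assumes "finite S"
  shows "frontier S = S"
  using assms by (simp add: frontier_def finite_imp_closed empty_interior_finite closure_closed)

lemma continuous_on_upd:
  assumes "continuous_on S f" and "continuous_on S g"
  shows "continuous_on S (\<lambda>x. (f x)(n::nat := g x :: real))"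
proof (rule continuous_on_coordinatewise_then_product)
  fix i :: nat
  show "continuous_on S (\<lambda>x. ((f x)(n := g x)) i)"
    using assms(2) continuous_on_compose2[OF continuous_on_coordinate[of UNIV i] assms(1)]
    by (cases "i = n") auto
qed

lemma frontier_bounded:
  fixes S :: "real set"
  assumes "S \<subseteq> {-M..M}"
  shows "frontier S \<subseteq> {-M..M}"
  using closure_minimal[OF assms] by (auto simp: frontier_def)

definition total_over :: "nat \<Rightarrow> (nat \<Rightarrow> real) set \<Rightarrow> (nat \<Rightarrow> real) set \<Rightarrow> (nat \<Rightarrow> real) set" where
  "total_over n E P = {x(n := t) | x t. x \<in> P \<and> x(n := t) \<in> E}"

text \<open>Finite fibres equal their frontiers. Their size is constant over the connected set
  \<open>P\<close>, so the total set consists of that many graphs of continuous sections, each an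
  image of \<open>P\<close>.\<close>

lemma fpc_total_over_finite:
  assumes P: "path_connected P" "P \<subseteq> good n E"
    and fin: "\<And>x. finite (fibre n E x)" and bd: "\<And>x. fibre n E x \<subseteq> {-M..M}"
  shows "finitely_path_connected (total_over n E P)"
proof (cases "P = {}")
  case True
  then show ?thesis by (auto simp: total_over_def intro: fpc_path_connected)
next
  case False
  then obtain x0 where x0: "x0 \<in> P" by blast
  have F: "frontier (fibre n E x) = fibre n E x" for x
    by (rule frontier_finite_real[OF fin])
  define N where "N = card (fibre n E x0)"
  have N: "card (fibre n E x) = N" if "x \<in> P" for x
    using card_frontier_constant[OF path_connected_imp_connected[OF P(1)] P(2), of M x x0] x0 that fin bd
    by (simp add: F N_def)
  have "total_over n E P = (\<Union>i\<in>{..<N}. (\<lambda>x. x(n := section_of n E i x)) ` P)" (is "_ = ?R")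
  proof (intro equalityI subsetI)
    fix z assume "z \<in> total_over n E P"
    then obtain x t where z: "z = x(n := t)" "x \<in> P" "t \<in> fibre n E x"
      by (auto simp: total_over_def)
    then obtain i where "i < N" "t = section_of n E i x"
      using N[OF z(2)] fin[of x] by (metis F in_set_conv_nth section_of_def set_sorted_list_of_set
          length_sorted_list_of_set)
    with z show "z \<in> ?R" by auto
  next
    fix z assume "z \<in> ?R"
    then obtain i x where z: "i < N" "x \<in> P" "z = x(n := section_of n E i x)" by auto
    then have "section_of n E i x \<in> fibre n E x"
      using N[OF z(2)] fin[of x] by (metis F nth_mem section_of_def set_sorted_list_of_set
          length_sorted_list_of_set)
    with z show "z \<in> total_over n E P" by (auto simp: total_over_def)
  qed
  moreover have "finitely_path_connected ((\<lambda>x. x(n := section_of n E i x)) ` P)" if "i < N" for i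
  proof -
    have "continuous_on P (section_of n E i)"
      by (rule continuous_on_section[OF P(2)]) (use fin bd N that in \<open>auto simp: F\<close>)
    then show ?thesis
      by (intro fpc_path_connected path_connected_continuous_image[OF _ P(1)] continuous_on_upd continuous_on_id)
  qed
  ultimately show ?thesis
    by (simp only:) (rule fpc_UN, auto)
qed

lemma between_sorted:
  fixes t :: real
  assumes "finite F" "t \<notin> F" "u \<in> F" "u < t" "v \<in> F" "t < v"
  obtains i where "Suc i < card F" "sorted_list_of_set F ! i < t" "t < sorted_list_of_set F ! Suc i"
proof -
  define l where "l = sorted_list_of_set F"
  have l: "set l = F" "length l = card F" "sorted l"
    using assms(1) by (auto simp: l_def)
  have "\<exists>j. j < length l \<and> t < l ! j"
    using assms(5,6) l(1) by (metis in_set_conv_nth)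
  define j where "j = (LEAST j. j < length l \<and> t < l ! j)"
  have j: "j < length l" "t < l ! j"
    using LeastI_ex[OF \<open>\<exists>j. j < length l \<and> t < l ! j\<close>] by (auto simp: j_def)
  have "j \<noteq> 0"
  proof
    assume "j = 0"
    obtain k where "k < length l" "l ! k = u" using assms(3) l(1) by (metis in_set_conv_nth)
    then have "l ! 0 \<le> u" using l(3) by (metis sorted_nth_mono zero_le)
    with j \<open>j = 0\<close> assms(4) show False by simp
  qed
  then obtain i where i: "j = Suc i" by (cases j) auto
  have "\<not> t < l ! i"
    using not_less_Least[of i "\<lambda>j. j < length l \<and> t < l ! j"] i j(1) by (auto simp: j_def)
  moreover have "l ! i \<noteq> t" using assms(2) l(1) i j(1) by (metis Suc_lessD nth_mem)
  ultimately show thesis using that[of i] i j l(2) by (simp add: l_def)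
qed

text \<open>An open fibre misses its frontier and, being bounded, has frontier points below and
  above each of its points; so every point lies in a band between consecutive sections. A band is an
  image of \<open>P\<close> times an interval, hence path connected, and membership in
  \<open>E\<close> is locally constant along it, so each band lies in \<open>E\<close> or avoids
  it.\<close>

lemma fpc_total_over_open:
  assumes P: "path_connected P" "P \<subseteq> good n E" and E: "cylinder (Suc n) E"
    and fin: "\<And>x. finite (frontier (fibre n E x))" and bd: "\<And>x. fibre n E x \<subseteq> {-M..M}"
    and op: "\<And>x. open (fibre n E x)"
  shows "finitely_path_connected (total_over n E P)"
proof (cases "P = {}")
  case True
  then show ?thesis by (auto simp: total_over_def intro: fpc_path_connected)
next
  case False
  then obtain x0 where x0: "x0 \<in> P" by blast
  let ?F = "\<lambda>x. frontier (fibre n E x)"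
  let ?s = "section_of n E"
  have bF: "?F x \<subseteq> {-M..M}" for x by (rule frontier_bounded[OF bd])
  define N where "N = card (?F x0)"
  have N: "card (?F x) = N" if "x \<in> P" for x
    using card_frontier_constant[OF path_connected_imp_connected[OF P(1)] P(2), of M x x0] x0 that fin bF
    by (simp add: N_def)
  define band where "band = (\<lambda>i. {x(n := t) | x t. x \<in> P \<and> ?s i x < t \<and> t < ?s (Suc i) x})"
  have not_F: "t \<notin> ?F x" if "x \<in> P" "Suc i < N" "?s i x < t" "t < ?s (Suc i) x" for x t i
  proof
    assume "t \<in> ?F x"
    define l where "l = sorted_list_of_set (?F x)"
    have l: "set l = ?F x" "length l = N" "sorted l"
      using fin N[OF that(1)] by (auto simp: l_def)
    obtain k where k: "k < N" "l ! k = t" using \<open>t \<in> ?F x\<close> l by (metis in_set_conv_nth)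
    have "l ! i < t" "t < l ! Suc i" using that by (simp_all add: section_of_def l_def)
    show False
    proof (cases "k \<le> i")
      case True
      then have "l ! k \<le> l ! i" using l k that(2) by (intro sorted_nth_mono) auto
      with \<open>l ! i < t\<close> k show False by simp
    next
      case False
      then have "l ! Suc i \<le> l ! k" using l k by (intro sorted_nth_mono) auto
      with \<open>t < l ! Suc i\<close> k show False by simp
    qed
  qed
  have band_pc: "path_connected (band i)" if i: "Suc i < N" for i
  proof -
    have cont: "continuous_on P (?s i)" "continuous_on P (?s (Suc i))"
      by (rule continuous_on_section[OF P(2) _ bF]; use fin N i in simp)+
    \<comment> \<open>Affine interpolation between the two sections parametrises the band. The
      arithmetic takes place outside the structure: \<open>?g\<close> need not be definable.\<close>
    let ?g = "\<lambda>p. (fst p)(n := (1 - snd p) * ?s i (fst p) + snd p * ?s (Suc i) (fst p))"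
    have "continuous_on (P \<times> {0<..<1}) ?g"
      by (intro continuous_on_upd continuous_intros continuous_on_compose2[OF cont(1)]
          continuous_on_compose2[OF cont(2)]) auto
    moreover have "path_connected (P \<times> {0<..<1::real})"
      by (intro path_connected_Times P(1) convex_imp_path_connected convex_real_interval)
    ultimately have "path_connected (?g ` (P \<times> {0<..<1}))"
      by (rule path_connected_continuous_image)
    moreover have "?g ` (P \<times> {0<..<1}) = band i"
    proof (intro equalityI subsetI)
      fix z assume "z \<in> ?g ` (P \<times> {0<..<1})"
      then obtain x u where x: "x \<in> P" "0 < u" "u < 1"
        and z: "z = x(n := (1 - u) * ?s i x + u * ?s (Suc i) x)" by auto
      define l where "l = sorted_list_of_set (?F x)"
      have "l ! i < l ! Suc i"
        by (rule sorted_wrt_nth_less[of "(<)"]) (use fin N[OF x(1)] i in \<open>auto simp: l_def\<close>)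
      then have "?s i x < ?s (Suc i) x" by (simp add: section_of_def l_def)
      then have "0 < u * (?s (Suc i) x - ?s i x)" "0 < (1 - u) * (?s (Suc i) x - ?s i x)"
        using x by auto
      then show "z \<in> band i"
        unfolding band_def z using x(1)
        by (intro CollectI exI[of _ x] exI[of _ "(1 - u) * ?s i x + u * ?s (Suc i) x"])
          (auto simp: algebra_simps)
    next
      fix z assume "z \<in> band i"
      then obtain x t where x: "x \<in> P" and t: "?s i x < t" "t < ?s (Suc i) x" and z: "z = x(n := t)"
        by (auto simp: band_def)
      define u where "u = (t - ?s i x) / (?s (Suc i) x - ?s i x)"
      have "0 < u" "u < 1" using t by (auto simp: u_def field_simps)
      moreover have "u * (?s (Suc i) x - ?s i x) = t - ?s i x" using t by (simp add: u_def)
      then have "t = (1 - u) * ?s i x + u * ?s (Suc i) x" by (simp add: algebra_simps)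
      ultimately show "z \<in> ?g ` (P \<times> {0<..<1})"
        using x z by (intro image_eqI[of _ _ "(x, u)"]) auto
    qed
    ultimately show ?thesis by simp
  qed
  have const: "z \<in> E \<longleftrightarrow> w \<in> E" if i: "Suc i < N" and zw: "z \<in> band i" "w \<in> band i" for i z w
  proof (rule connected_local_const[OF path_connected_imp_connected[OF band_pc[OF i]] zw], intro ballI)
    fix y assume "y \<in> band i"
    then obtain x t where x: "x \<in> P" and t: "?s i x < t" "t < ?s (Suc i) x" and y: "y = x(n := t)"
      by (auto simp: band_def)
    obtain c d a b where cd: "c < t" "t < d" "x \<in> obox n a b"
      "(\<forall>y\<in>obox n a b. {c<..<d} \<subseteq> fibre n E y) \<or> (\<forall>y\<in>obox n a b. {c<..<d} \<inter> fibre n E y = {})"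
      by (rule good_off_frontier[OF subsetD[OF P(2) x] not_F[OF x i t]])
    define U where "U = obox n a b \<inter> {z. c < z n} \<inter> {z. z n < d}"
    have "open U"
      unfolding U_def
      by (intro open_Int open_obox open_Collect_less continuous_on_const continuous_on_coordinate)
    moreover have "y \<in> U"
      using cd(1-3) by (auto simp: U_def y obox_def)
    moreover have "y \<in> E \<longleftrightarrow> z \<in> E" if "z \<in> U" for z
    proof -
      have "z \<in> E \<longleftrightarrow> z n \<in> fibre n E z" "y \<in> E \<longleftrightarrow> y n \<in> fibre n E y" for z by simp_all
      moreover have "z \<in> obox n a b" "y \<in> obox n a b" "z n \<in> {c<..<d}" "y n \<in> {c<..<d}"
        using that \<open>y \<in> U\<close> by (auto simp: U_def)
      ultimately show ?thesis using cd(4) by blast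
    qed
    ultimately show "\<forall>\<^sub>F z in at y within band i. (y \<in> E) = (z \<in> E)"
      unfolding eventually_at_topological by blast
  qed
  have "total_over n E P = (\<Union>i\<in>{i. Suc i < N \<and> band i \<subseteq> E}. band i)" (is "_ = ?R")
  proof (intro equalityI subsetI)
    fix z assume "z \<in> total_over n E P"
    then obtain x t where z: "z = x(n := t)" "x \<in> P" "t \<in> fibre n E x" "z \<in> E"
      by (auto simp: total_over_def)
    have tF: "t \<notin> ?F x" using op[of x] z(3) by (simp add: frontier_def interior_open)
    have tM: "t \<in> {-M..M}" using bd z(3) by blast
    \<comment> \<open>The point \<open>-M-1\<close> lies outside the fibre and \<open>t\<close>
      inside it, so the interval between them meets the frontier.\<close>
    have "\<exists>u\<in>?F x. u \<in> {-M-1..t}"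
    proof -
      have "-M-1 \<notin> fibre n E x" using bd[of x] by force
      then have "-M-1 \<in> {-M-1..t} - fibre n E x" using tM by auto
      moreover have "t \<in> {-M-1..t} \<inter> fibre n E x" using z(3) tM by auto
      ultimately show ?thesis
        using connected_Int_frontier[of "{-M-1..t}" "fibre n E x"] connected_Icc by blast
    qed
    then obtain u where u: "u \<in> ?F x" "u < t" using tF by (metis atLeastAtMost_iff order_le_less)
    have "\<exists>v\<in>?F x. v \<in> {t..M+1}"
    proof -
      have "M+1 \<notin> fibre n E x" using bd[of x] by force
      then have "M+1 \<in> {t..M+1} - fibre n E x" using tM by auto
      moreover have "t \<in> {t..M+1} \<inter> fibre n E x" using z(3) tM by auto
      ultimately show ?thesis
        using connected_Int_frontier[of "{t..M+1}" "fibre n E x"] connected_Icc by blast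
    qed
    then obtain v where v: "v \<in> ?F x" "t < v" using tF by (metis atLeastAtMost_iff order_le_less)
    obtain i where i: "Suc i < N" "?s i x < t" "t < ?s (Suc i) x"
      using between_sorted[OF fin tF u v] N[OF z(2)] by (auto simp: section_of_def)
    then have "z \<in> band i" using z by (auto simp: band_def)
    moreover from this have "band i \<subseteq> E" using const[OF i(1)] z(4) by blast
    ultimately show "z \<in> ?R" using i(1) by blast
  next
    fix z assume "z \<in> ?R"
    then obtain i where "z \<in> band i" "z \<in> E" by blast
    moreover from this(1) obtain x t where "x \<in> P" "z = x(n := t)" by (auto simp: band_def)
    ultimately show "z \<in> total_over n E P" unfolding total_over_def by blast
  qed
  moreover have "finite {i. Suc i < N \<and> band i \<subseteq> E}"
    by (rule finite_subset[of _ "{..<N}"]) auto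
  ultimately show ?thesis
    by (simp only:) (rule fpc_UN, auto intro: fpc_path_connected band_pc)
qed

section \<open>Induction on the dimension\<close>

definition cube :: "nat \<Rightarrow> real \<Rightarrow> (nat \<Rightarrow> real) set" where
  "cube n M = {x. \<forall>i<n. - M \<le> x i \<and> x i \<le> M}"

lemma definable_cube: "definable_set \<RR> (cube n M)"
  unfolding cube_def by (intro definable_set_Collect definable_pred_intros)

lemma cylinder_cube: "cylinder n (cube n M)"
  by (auto simp: cylinder_def cube_def)

lemma fibre_cube:
  assumes "E \<subseteq> cube (Suc n) M"
  shows "fibre n E x \<subseteq> {-M..M}"
proof
  fix t assume "t \<in> fibre n E x"
  then have "x(n := t) \<in> cube (Suc n) M" using assms by auto
  then show "t \<in> {-M..M}" by (auto simp: cube_def dest: spec[of _ n])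
qed

lemma finite_frontier_fibre:
  assumes "tame \<RR>" "definable_set \<RR> E" "fibre n E x \<subseteq> {-M..M}"
  shows "finite (frontier (fibre n E x))"
proof -
  have "frontier (fibre n E x) \<inter> {-M..M} = frontier (fibre n E x)"
    using frontier_bounded[OF assms(3)] by auto
  then show ?thesis using tame_fibre[OF assms(1,2), of n x "-M" M] by simp
qed

text \<open>Only the first \<open>n\<close> coordinates are bounded; those beyond are free because
  \<open>E\<close> is a cylinder. The induction step uses the statement not for \<open>E\<close>
  itself but for auxiliary base sets and projections.\<close>

definition fpc_dim :: "('f, 'r) expansion \<Rightarrow> nat \<Rightarrow> bool" where
  "fpc_dim \<RR> n \<longleftrightarrow> (\<forall>E M. definable_set \<RR> E \<and> cylinder n E \<and> E \<subseteq> cube n M \<longrightarrow> finitely_path_connected E)"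

text \<open>The bounded part of \<open>good n E\<close> is itself a definable set of dimension
  \<open>n\<close>, so it splits into finitely many path connected pieces; over each of them the
  finite or the open case applies.\<close>

lemma fpc_over_good:
  assumes "tame \<RR>" "fpc_dim \<RR> n"
    and E: "definable_set \<RR> E" "cylinder (Suc n) E" "E \<subseteq> cube (Suc n) M"
    and "(\<forall>x. finite (fibre n E x)) \<or> (\<forall>x. open (fibre n E x))"
  shows "finitely_path_connected (E \<inter> good n E)"
proof -
  define G where "G = good n E \<inter> cube n M"
  have "definable_set \<RR> G" "cylinder n G" "G \<subseteq> cube n M"
    by (auto simp: G_def intro: definable_set_Int definable_good E definable_cube cylinder_Int
        cylinder_good cylinder_cube)
  then have "finitely_path_connected G" using assms(2) by (auto simp: fpc_dim_def)
  then obtain \<C> where C: "finite \<C>" "\<And>P. P \<in> \<C> \<Longrightarrow> path_connected P" "G = \<Union>\<C>"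
    by (auto simp: finitely_path_connected_def)
  have bd: "fibre n E x \<subseteq> {-M..M}" for x by (rule fibre_cube[OF E(3)])
  have "finitely_path_connected (total_over n E P)" if "P \<in> \<C>" for P
  proof -
    have P: "path_connected P" "P \<subseteq> good n E" using C that by (auto simp: G_def)
    from assms(6) show ?thesis
    proof
      assume "\<forall>x. finite (fibre n E x)"
      then show ?thesis using fpc_total_over_finite[OF P _ bd] by blast
    next
      assume "\<forall>x. open (fibre n E x)"
      then show ?thesis
        using fpc_total_over_open[OF P E(2) finite_frontier_fibre[OF assms(1) E(1) bd] bd] by blast
    qed
  qed
  then have "finitely_path_connected (\<Union>P\<in>\<C>. total_over n E P)" by (rule fpc_UN[OF C(1)])
  moreover have "(\<Union>P\<in>\<C>. total_over n E P) = E \<inter> good n E"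
  proof (intro equalityI subsetI)
    fix z assume "z \<in> (\<Union>P\<in>\<C>. total_over n E P)"
    then obtain P x t where z: "P \<in> \<C>" "x \<in> P" "z = x(n := t)" "z \<in> E"
      by (auto simp: total_over_def)
    then have "x \<in> good n E" using C(3) by (auto simp: G_def)
    then have "z \<in> good n E" using cylinderD[OF cylinder_good, of n x z] z(3) by simp
    with z show "z \<in> E \<inter> good n E" by blast
  next
    fix z assume z: "z \<in> E \<inter> good n E"
    then have "z \<in> G" using E(3) by (auto simp: G_def cube_def)
    then obtain P where "P \<in> \<C>" "z \<in> P" using C(3) by blast
    moreover from this z have "z \<in> total_over n E P"
      unfolding total_over_def by (intro CollectI exI[of _ z] exI[of _ "z n"]) auto
    ultimately show "z \<in> (\<Union>P\<in>\<C>. total_over n E P)" by blast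
  qed
  ultimately show ?thesis by simp
qed

text \<open>A right inverse to the projection that forgets coordinate \<open>m\<close> and moves the
  later ones down by one.\<close>

definition insert_coord :: "nat \<Rightarrow> real \<Rightarrow> (nat \<Rightarrow> real) \<Rightarrow> nat \<Rightarrow> real" where
  "insert_coord m s w = (\<lambda>j. if j < m then w j else if j = m then s else w (j - 1))"

lemma nth_sorted_list_of_set_card:
  fixes S :: "real set"
  assumes "finite S" "s \<in> S"
  shows "sorted_list_of_set S ! card {t \<in> S. t < s} = s" and "card {t \<in> S. t < s} < card S"
proof -
  define l where "l = sorted_list_of_set S"
  have l: "set l = S" "length l = card S" "sorted_wrt (<) l"
    using assms(1) by (auto simp: l_def)
  obtain k where k: "k < length l" "l ! k = s" using assms(2) l(1) by (metis in_set_conv_nth)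
  have less: "l ! i < l ! j \<longleftrightarrow> i < j" if "i < length l" "j < length l" for i j
    using sorted_wrt_nth_less[OF l(3)] that by (metis less_asym linorder_neqE_nat order_less_irrefl)
  have "{t \<in> S. t < s} = (!) l ` {..<k}"
  proof (intro equalityI subsetI)
    fix t assume t: "t \<in> {t \<in> S. t < s}"
    then obtain i where "i < length l" "l ! i = t" using l(1) by (metis (lifting) in_set_conv_nth mem_Collect_eq)
    with t k less show "t \<in> (!) l ` {..<k}" by (metis (lifting) image_eqI lessThan_iff mem_Collect_eq)
  next
    fix t assume "t \<in> (!) l ` {..<k}"
    then obtain i where "i < k" "t = l ! i" by auto
    with k less[of i k] l(1) show "t \<in> {t \<in> S. t < s}" by (auto intro: nth_mem)
  qed
  moreover have "inj_on ((!) l) {..<k}"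
    by (rule inj_on_nth) (use l(3) k in \<open>auto simp: strict_sorted_iff\<close>)
  ultimately have "card {t \<in> S. t < s} = k" by (simp add: card_image)
  with k l(2) show "sorted_list_of_set S ! card {t \<in> S. t < s} = s" "card {t \<in> S. t < s} < card S"
    by (simp_all add: l_def)
qed

text \<open>Counting is turned into the existence of an increasing chain; the chain can be
  quantified as one sequence, which makes the rank of a point in a finite fibre first-order.\<close>

lemma le_card_iff:
  fixes S :: "real set"
  assumes "finite S"
  shows "(\<exists>f. \<forall>i<k. f i \<in> S \<and> (\<forall>j<i. f j < (f i :: real))) \<longleftrightarrow> k \<le> card S"
proof
  assume "\<exists>f. \<forall>i<k. f i \<in> S \<and> (\<forall>j<i. f j < (f i :: real))"
  then obtain f where f: "\<And>i. i < k \<Longrightarrow> f i \<in> S" "\<And>i j. i < k \<Longrightarrow> j < i \<Longrightarrow> f j < (f i :: real)" by auto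
  have "inj_on f {..<k}"
    by (rule inj_onI) (metis f(2) lessThan_iff linorder_neqE_nat order_less_irrefl)
  then have "card {..<k} \<le> card S"
    by (rule card_inj_on_le) (use f(1) assms in auto)
  then show "k \<le> card S" by simp
next
  assume k: "k \<le> card S"
  define l where "l = sorted_list_of_set S"
  have "set l = S" "length l = card S" "sorted_wrt (<) l"
    using assms by (auto simp: l_def)
  then have "\<forall>i<k. l ! i \<in> S \<and> (\<forall>j<i. l ! j < l ! i)"
    using k by (auto intro: nth_mem sorted_wrt_nth_less)
  then show "\<exists>f. \<forall>i<k. f i \<in> S \<and> (\<forall>j<i. f j < (f i :: real))" by blast
qed

text \<open>An argument in the style of Kuratowski and Ulam: if the fibres over a whole box had
  interior, each would contain one of countably many rational intervals, a single one of these would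
  serve over a subbox, and the product would be a box inside \<open>Z\<close>.\<close>

lemma thin_fibre_interior:
  assumes "tame \<RR>" and Z: "definable_set \<RR> Z" "cylinder (Suc m) Z" "thin (Suc m) Z"
  shows "thin m {x. \<exists>q r. q < r \<and> (\<forall>t. q < t \<and> t < r \<longrightarrow> x(m := t) \<in> Z)}"
  unfolding thin_def
proof (intro allI impI notI)
  fix a b assume ab: "\<forall>i<m. a i < (b i :: real)"
    and sub: "obox m a b \<subseteq> {x. \<exists>q r. q < r \<and> (\<forall>t. q < t \<and> t < r \<longrightarrow> x(m := t) \<in> Z)}"
  define A where "A = (\<lambda>(q::rat, r::rat). {x. (of_rat q :: real) < of_rat r \<and>
    (\<forall>t. of_rat q < t \<and> t < of_rat r \<longrightarrow> x(m := t) \<in> Z)})"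
  obtain k c d where cd: "subbox m c d a b" "obox m c d \<subseteq> A k"
  proof (rule box_category[OF decides_boxes[OF assms(1)]])
    fix k :: "rat \<times> rat"
    obtain q r where k: "k = (q, r)" by (cases k)
    show "definable_set \<RR> (A k)"
      unfolding k A_def split by (intro definable_set_Collect definable_pred_intros Z)
    show "cylinder m (A k)"
      unfolding k cylinder_def
    proof (intro allI impI)
      fix x y :: "nat \<Rightarrow> real" assume "\<forall>i<m. x i = y i"
      then have "fibre m Z x = fibre m Z y" by (intro fibre_cong[OF Z(2)]) simp
      then have "x(m := t) \<in> Z \<longleftrightarrow> y(m := t) \<in> Z" for t using mem_fibre by metis
      then show "x \<in> A (q, r) \<longleftrightarrow> y \<in> A (q, r)" by (simp add: A_def)
    qed
  next
    show "obox m a b \<subseteq> (\<Union>k. A k)"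
    proof
      fix x assume "x \<in> obox m a b"
      then obtain q0 r0 where 0: "q0 < r0" "\<And>t. q0 < t \<and> t < r0 \<Longrightarrow> x(m := t) \<in> Z" using sub by auto
      obtain q :: rat where q: "q0 < of_rat q" "of_rat q < r0" using of_rat_dense 0(1) by blast
      obtain r :: rat where r: "of_rat q < (of_rat r :: real)" "of_rat r < r0" using of_rat_dense q(2) by blast
      have "x \<in> A (q, r)" unfolding A_def split using q r by (auto intro!: 0(2))
      then show "x \<in> (\<Union>k. A k)" by blast
    qed
  next
    show "\<forall>i<m. a i < b i" by (fact ab)
  qed
  obtain q r where k: "k = (q, r)" by (cases k)
  obtain x0 where "x0 \<in> obox m c d"
    using ex_mem_obox subbox_nonempty[OF cd(1)] by blast
  with cd(2) have qr: "(of_rat q :: real) < of_rat r" by (auto simp: k A_def)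
  have "obox (Suc m) (c(m := of_rat q)) (d(m := of_rat r)) \<subseteq> Z"
  proof
    fix x assume "x \<in> obox (Suc m) (c(m := of_rat q)) (d(m := of_rat r))"
    then have "x \<in> obox m c d" "of_rat q < x m" "x m < of_rat r"
      by (auto simp: obox_def split: if_splits)
    moreover from this(1) have "x \<in> A (q, r)" using cd(2) k by auto
    ultimately have "x(m := x m) \<in> Z" unfolding A_def by blast
    then show "x \<in> Z" by simp
  qed
  moreover have "\<forall>i<Suc m. (c(m := of_rat q)) i < (d(m := of_rat r)) i"
    using qr subbox_nonempty[OF cd(1)] by (auto simp: less_Suc_eq)
  ultimately show False using Z(3) by (auto simp: thin_def)
qed

text \<open>Coordinate \<open>m\<close> of a point of \<open>E\<close> takes one of finitely many
  values given by the earlier coordinates. Sorting \<open>E\<close> by the rank of this value makes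
  coordinate \<open>m\<close> a continuous function \<open>section_of m Z i\<close> on each stratum,
  so forgetting it is a homeomorphism onto a set of dimension \<open>n\<close>, where
  \<open>fpc_dim\<close> applies. The coordinates after \<open>m\<close> are carried along.\<close>

lemma fpc_finite_fibres_part:
  assumes "tame \<RR>" and dim: "fpc_dim \<RR> n" and "m \<le> n"
    and Z: "definable_set \<RR> Z" "cylinder (Suc m) Z" "Z \<subseteq> cube (Suc m) M" "\<And>x. finite (fibre m Z x)"
    and E: "definable_set \<RR> E" "cylinder (Suc n) E" "E \<subseteq> cube (Suc n) M" "E \<subseteq> Z" "E \<subseteq> good m Z"
  shows "finitely_path_connected E"
proof -
  let ?s = "section_of m Z"
  have F: "frontier (fibre m Z x) = fibre m Z x" for x by (rule frontier_finite_real[OF Z(4)])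
  have bd: "frontier (fibre m Z x) \<subseteq> {-M..M}" for x by (rule frontier_bounded[OF fibre_cube[OF Z(3)]])
  define G where "G = good m Z \<inter> cube n M"
  have "definable_set \<RR> G" "cylinder n G" "G \<subseteq> cube n M"
    by (auto simp: G_def intro: definable_set_Int definable_good Z definable_cube cylinder_Int
        cylinder_mono[OF cylinder_good \<open>m \<le> n\<close>] cylinder_cube)
  then have "finitely_path_connected G" using dim by (auto simp: fpc_dim_def)
  then obtain \<C> where C: "finite \<C>" "\<And>P. P \<in> \<C> \<Longrightarrow> path_connected P" "G = \<Union>\<C>"
    by (auto simp: finitely_path_connected_def)
  let ?c = "\<lambda>x. card (fibre m Z x)"
  \<comment> \<open>The size of the fibre is constant on each of the finitely many connected pieces
    of the base. The uniform bound on the ranks thus comes out of the induction hypothesis for the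
    base.\<close>
  have "finite (?c ` P)" if P: "P \<in> \<C>" for P
  proof (cases "P = {}")
    case False
    then obtain x0 where x0: "x0 \<in> P" by blast
    have "?c x = ?c x0" if x: "x \<in> P" for x
    proof -
      have "P \<subseteq> good m Z" using C(3) P by (auto simp: G_def)
      then show ?thesis
        using card_frontier_constant[OF path_connected_imp_connected[OF C(2)[OF P]] _ _ bd x x0] Z(4)
        by (simp add: F)
    qed
    then have "?c ` P \<subseteq> {?c x0}" by auto
    then show ?thesis by (rule finite_subset) simp
  qed simp
  then have "finite (?c ` G)" unfolding C(3) image_Union using C(1) by blast
  then obtain K where K: "\<And>x. x \<in> G \<Longrightarrow> ?c x < K"
    by (auto simp: finite_nat_set_iff_bounded)
  \<comment> \<open>First-order form of the statement that at least \<open>k\<close> points of the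
    fibre of \<open>Z\<close> lie below coordinate \<open>m\<close> of \<open>z\<close>; two such
    conditions fix the rank.\<close>
  define atl where "atl = (\<lambda>k z. \<exists>f::nat \<Rightarrow> real. \<forall>i<k. (f i < z m \<and> z(m := f i) \<in> Z) \<and> (\<forall>j<i. f j < f i))"
  have atl: "atl k z \<longleftrightarrow> k \<le> card {t \<in> fibre m Z z. t < z m}" for k z
  proof -
    have "finite {t \<in> fibre m Z z. t < z m}" by (rule finite_subset[OF _ Z(4)[of z]]) auto
    from le_card_iff[OF this, of k] show ?thesis by (simp add: atl_def conj_commute)
  qed
  define Ei where "Ei = (\<lambda>i. {z \<in> E. atl i z \<and> \<not> atl (Suc i) z})"
  have Ei_section: "?s i z = z m" "i < ?c z" if z: "z \<in> Ei i" for z i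
  proof -
    have "card {t \<in> fibre m Z z. t < z m} = i" using z by (auto simp: Ei_def atl)
    moreover have "z m \<in> fibre m Z z" using z E(4) by (auto simp: Ei_def)
    ultimately show "?s i z = z m" "i < ?c z"
      using nth_sorted_list_of_set_card[OF Z(4)[of z], of "z m"] by (auto simp: section_of_def F)
  qed
  have "finitely_path_connected (Ei i)" for i
  proof -
    \<comment> \<open>The stratum with coordinate \<open>m\<close> forgotten. The value
      \<open>s\<close> is determined by \<open>w\<close> as \<open>?s i w\<close>, so no choice is
      involved in lifting back.\<close>
    define W where "W = {w. \<exists>s. insert_coord m s w \<in> Ei i}"
    have def_Ei: "definable_set \<RR> (Ei i)"
      unfolding Ei_def atl_def by (intro definable_set_Collect definable_pred_intros E Z)
    have "definable_set \<RR> W"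
      unfolding W_def
      by (intro definable_set_Collect definable_pred_intros def_Ei)
        (auto simp: insert_coord_def intro!: simple_term_if simple_term_var)
    moreover have "cylinder n W"
      unfolding cylinder_def
    proof (intro allI impI)
      fix x y :: "nat \<Rightarrow> real" assume xy: "\<forall>i<n. x i = y i"
      have "cylinder (Suc n) (Ei i)"
        unfolding cylinder_def
      proof (intro allI impI)
        fix u v :: "nat \<Rightarrow> real" assume uv: "\<forall>i<Suc n. u i = v i"
        have "fibre m Z u = fibre m Z v" using uv \<open>m \<le> n\<close> by (intro fibre_cong[OF Z(2)]) auto
        moreover have "u m = v m" using uv \<open>m \<le> n\<close> by auto
        moreover have "u \<in> E \<longleftrightarrow> v \<in> E" using uv by (intro cylinderD[OF E(2)]) auto
        ultimately show "u \<in> Ei i \<longleftrightarrow> v \<in> Ei i" unfolding Ei_def atl by (simp only: mem_Collect_eq)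
      qed
      then have "insert_coord m s x \<in> Ei i \<longleftrightarrow> insert_coord m s y \<in> Ei i" for s
        using xy \<open>m \<le> n\<close> by (intro cylinderD[of "Suc n"]) (auto simp: insert_coord_def)
      then show "x \<in> W \<longleftrightarrow> y \<in> W" by (simp add: W_def)
    qed
    moreover have "W \<subseteq> cube n M"
    proof
      fix w assume "w \<in> W"
      then obtain s where "insert_coord m s w \<in> cube (Suc n) M"
        using E(3) by (auto simp: W_def Ei_def)
      then have c: "-M \<le> insert_coord m s w j \<and> insert_coord m s w j \<le> M" if "j < Suc n" for j
        using that by (auto simp: cube_def)
      have "-M \<le> w j \<and> w j \<le> M" if "j < n" for j
        using c[of j] c[of "Suc j"] that by (cases "j < m") (auto simp: insert_coord_def)
      then show "w \<in> cube n M" by (auto simp: cube_def)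
    qed
    ultimately have "finitely_path_connected W" using dim by (auto simp: fpc_dim_def)
    have W: "insert_coord m (?s i w) w \<in> Ei i \<and> i < ?c w \<and> w \<in> good m Z" if w: "w \<in> W" for w
    proof -
      obtain s where s: "insert_coord m s w \<in> Ei i" using w by (auto simp: W_def)
      let ?z = "insert_coord m s w"
      have eq: "?z j = w j" if "j < m" for j using that by (simp add: insert_coord_def)
      have "?s i w = ?s i ?z" by (rule section_of_cong[OF Z(2)]) (simp add: eq)
      also have "\<dots> = s" using Ei_section(1)[OF s] by (simp add: insert_coord_def)
      finally have "insert_coord m (?s i w) w \<in> Ei i" using s by simp
      moreover have "fibre m Z ?z = fibre m Z w" by (rule fibre_cong[OF Z(2)]) (simp add: eq)
      then have "i < ?c w" using Ei_section(2)[OF s] by simp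
      moreover have "?z \<in> good m Z" using s E(5) by (auto simp: Ei_def)
      then have "w \<in> good m Z" using cylinderD[OF cylinder_good, of m ?z w] eq by blast
      ultimately show ?thesis by blast
    qed
    have cont: "continuous_on W (?s i)"
      by (rule continuous_on_section[OF _ _ bd]) (use W Z(4) in \<open>auto simp: F\<close>)
    have "continuous_on W (\<lambda>w. insert_coord m (?s i w) w)"
    proof (rule continuous_on_coordinatewise_then_product)
      show "continuous_on W (\<lambda>w. insert_coord m (?s i w) w j)" for j
        using cont continuous_on_coordinate[of W]
        by (cases "j < m"; cases "j = m") (auto simp: insert_coord_def)
    qed
    then have "finitely_path_connected ((\<lambda>w. insert_coord m (?s i w) w) ` W)"
      by (rule fpc_image[OF \<open>finitely_path_connected W\<close>])
    moreover have "(\<lambda>w. insert_coord m (?s i w) w) ` W = Ei i"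
    proof (intro equalityI subsetI)
      fix z assume z: "z \<in> Ei i"
      define w where "w = (\<lambda>j. if j < m then z j else z (Suc j))"
      have zw: "insert_coord m (z m) w = z"
      proof
        show "insert_coord m (z m) w j = z j" for j
          by (cases j) (auto simp: insert_coord_def w_def)
      qed
      then have "w \<in> W" using z by (auto simp: W_def intro: exI[of _ "z m"])
      moreover have "?s i w = ?s i z" by (rule section_of_cong[OF Z(2)]) (simp add: w_def)
      then have "?s i w = z m" using Ei_section(1)[OF z] by simp
      then have "z = insert_coord m (?s i w) w" using zw by simp
      ultimately show "z \<in> (\<lambda>w. insert_coord m (?s i w) w) ` W" by blast
    qed (use W in auto)
    ultimately show ?thesis by simp
  qed
  then have "finitely_path_connected (\<Union>i\<in>{..<K}. Ei i)" by (intro fpc_UN) auto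
  moreover have "(\<Union>i\<in>{..<K}. Ei i) = E"
  proof (intro equalityI subsetI)
    fix z assume z: "z \<in> E"
    define i where "i = card {t \<in> fibre m Z z. t < z m}"
    have "z \<in> G" using z E by (auto simp: G_def cube_def)
    then have "?c z < K" by (rule K)
    moreover have "i \<le> ?c z" unfolding i_def by (rule card_mono) (use Z(4) in auto)
    moreover have "z \<in> Ei i" using z by (simp add: Ei_def atl i_def)
    ultimately show "z \<in> (\<Union>i\<in>{..<K}. Ei i)" by (intro UN_I[of i]) auto
  qed (auto simp: Ei_def)
  ultimately show ?thesis by simp
qed

text \<open>The induction is on the number \<open>m\<close> of coordinates on which the thin set
  depends, with \<open>n\<close> fixed. \<open>E\<close> splits into a part over base points where
  the fibre of the thin set has interior, a part over base points that are not good, and a part with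
  finite fibres over good points. The first two lie in sets that are thin in \<open>m\<close>
  coordinates.\<close>

lemma fpc_thin:
  assumes "tame \<RR>" and dim: "fpc_dim \<RR> n" and "m \<le> n"
    and "definable_set \<RR> Z" "cylinder m Z" "thin m Z"
    and "definable_set \<RR> E" "cylinder (Suc n) E" "E \<subseteq> cube (Suc n) M" "E \<subseteq> Z"
  shows "finitely_path_connected E"
  using assms(3-)
proof (induction m arbitrary: Z E)
  case 0
  have "\<not> obox 0 (\<lambda>_. 0) (\<lambda>_. 0) \<subseteq> Z" using "0.prems"(4) unfolding thin_def by blast
  then obtain x where "x \<notin> Z" by blast
  then have "Z = {}" using "0.prems"(3) by (auto simp: cylinder_def)
  with "0.prems"(8) show ?case by (auto intro: fpc_path_connected)
next
  case (Suc m)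
  note Z = Suc.prems(2-4) and E = Suc.prems(5-8)
  have mn: "m \<le> n" using Suc.prems(1) by simp
  \<comment> \<open>Cutting by the cube keeps thinness and makes the frontiers of all fibres
    finite.\<close>
  define Zb where "Zb = Z \<inter> cube (Suc m) M"
  define Z' where "Z' = {x. \<exists>q r. q < r \<and> (\<forall>t. q < t \<and> t < r \<longrightarrow> x(m := t) \<in> Zb)}"
  define Z1 where "Z1 = Zb - Z'"
  have Zb: "definable_set \<RR> Zb" "cylinder (Suc m) Zb" "thin (Suc m) Zb"
    using Z by (auto simp: Zb_def thin_def definable_set_Int definable_cube cylinder_Int cylinder_cube)
  have Z': "definable_set \<RR> Z'" "cylinder m Z'" "thin m Z'"
  proof -
    show "definable_set \<RR> Z'"
      unfolding Z'_def by (intro definable_set_Collect definable_pred_intros Zb)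
    show "thin m Z'" unfolding Z'_def by (rule thin_fibre_interior[OF assms(1) Zb])
    show "cylinder m Z'"
      unfolding cylinder_def
    proof (intro allI impI)
      fix x y :: "nat \<Rightarrow> real" assume "\<forall>i<m. x i = y i"
      then have "fibre m Zb x = fibre m Zb y" by (intro fibre_cong[OF Zb(2)]) simp
      then have "x(m := t) \<in> Zb \<longleftrightarrow> y(m := t) \<in> Zb" for t using mem_fibre by metis
      then show "x \<in> Z' \<longleftrightarrow> y \<in> Z'" by (simp add: Z'_def)
    qed
  qed
  have Z1: "definable_set \<RR> Z1" "cylinder (Suc m) Z1" "Z1 \<subseteq> cube (Suc m) M"
    unfolding Z1_def
    by (rule definable_set_Diff[OF Zb(1) Z'(1)], rule cylinder_Diff[OF Zb(2) cylinder_Suc[OF Z'(2)]])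
      (auto simp: Zb_def)
  have fin: "finite (fibre m Z1 x)" for x
  proof (cases "x \<in> Z'")
    case True
    then have "x(m := t) \<in> Z'" for t using cylinderD[OF Z'(2), of x "x(m := t)"] by simp
    then show ?thesis by (simp add: fibre_def Z1_def)
  next
    case False
    have "interior (fibre m Zb x) = {}"
    proof (rule ccontr)
      assume "interior (fibre m Zb x) \<noteq> {}"
      then obtain t where "t \<in> interior (fibre m Zb x)" by blast
      then obtain e where e: "e > 0" "ball t e \<subseteq> fibre m Zb x" by (auto simp: mem_interior)
      have "x(m := u) \<in> Zb" if "t - e < u \<and> u < t + e" for u
      proof -
        have "u \<in> ball t e" using that by (auto simp: dist_real_def)
        with e(2) show ?thesis by auto
      qed
      then have "x \<in> Z'" unfolding Z'_def using e(1) by (intro CollectI exI[of _ "t - e"] exI[of _ "t + e"]) auto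
      with False show False by blast
    qed
    \<comment> \<open>A set without interior lies in its own frontier, which is finite here.\<close>
    then have "fibre m Z1 x \<subseteq> frontier (fibre m Zb x)"
      using closure_subset[of "fibre m Zb x"] by (auto simp: frontier_def Z1_def)
    moreover have "finite (frontier (fibre m Zb x))"
      by (rule finite_frontier_fibre[OF assms(1) Zb(1)]) (rule fibre_cube, auto simp: Zb_def)
    ultimately show ?thesis by (rule finite_subset)
  qed
  have "finitely_path_connected (E \<inter> Z')"
    by (rule Suc.IH[OF mn Z'])
      (use E Z' mn in \<open>auto intro!: definable_set_Int cylinder_Int cylinder_mono[OF Z'(2)]\<close>)
  moreover have "finitely_path_connected (E \<inter> - good m Z1)"
    by (rule Suc.IH[OF mn _ _ thin_Compl_good[OF assms(1) Z1(1,2)]])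
      (use E Z1 mn in \<open>auto intro!: definable_set_Int definable_set_Compl definable_good cylinder_Int
        cylinder_Compl cylinder_good cylinder_mono[OF cylinder_good]\<close>)
  moreover have "finitely_path_connected (E \<inter> (Z1 \<inter> good m Z1))"
    by (rule fpc_finite_fibres_part[OF assms(1) dim mn Z1 fin])
      (use E Z1 mn in \<open>auto intro!: definable_set_Int definable_good cylinder_Int
        cylinder_mono[OF cylinder_good] cylinder_mono[OF Z1(2)]\<close>)
  moreover have "E = E \<inter> Z' \<union> E \<inter> - good m Z1 \<union> E \<inter> (Z1 \<inter> good m Z1)"
  proof -
    have "E \<subseteq> Zb" using E(3,4) mn by (force simp: Zb_def cube_def)
    then show ?thesis by (auto simp: Z1_def)
  qed
  ultimately show ?case using fpc_Un by metis
qed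

lemma path_connected_UNIV_fun: "path_connected (UNIV :: (nat \<Rightarrow> real) set)"
  unfolding path_connected_def
proof (intro ballI)
  fix x y :: "nat \<Rightarrow> real"
  define g where "g = (\<lambda>t i. (1 - t) * x i + t * y i)"
  have "continuous_on {0..1} g"
    unfolding g_def by (intro continuous_on_coordinatewise_then_product continuous_intros)
  then show "\<exists>g. path g \<and> path_image g \<subseteq> UNIV \<and> pathstart g = x \<and> pathfinish g = y"
    by (intro exI[of _ g]) (auto simp: path_def pathstart_def pathfinish_def g_def)
qed

text \<open>Each fibre is separated into its frontier points, collected in \<open>B\<close>, and its
  interior: \<open>E \<inter> B\<close> has finite fibres and \<open>E - B\<close> has open ones.
  Goodness is taken anew for each of the two sets, and what lies over the bad base points is covered
  by \<open>fpc_thin\<close>.\<close>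

lemma fpc_dim:
  assumes "tame \<RR>"
  shows "fpc_dim \<RR> n"
proof (induction n)
  case 0
  have "E = {} \<or> E = UNIV" if "cylinder 0 E" for E
    using that by (auto simp: cylinder_def)
  then show ?case
    unfolding fpc_dim_def using fpc_path_connected[OF path_connected_UNIV_fun]
      fpc_path_connected[OF path_connected_empty] by blast
next
  case (Suc n)
  have piece: "finitely_path_connected E"
    if E: "definable_set \<RR> E" "cylinder (Suc n) E" "E \<subseteq> cube (Suc n) M"
      and fib: "(\<forall>x. finite (fibre n E x)) \<or> (\<forall>x. open (fibre n E x))" for E M
  proof -
    have "finitely_path_connected (E \<inter> good n E)"
      by (rule fpc_over_good[OF assms Suc.IH E fib])
    moreover have "finitely_path_connected (E \<inter> - good n E)"
      by (rule fpc_thin[OF assms Suc.IH order_refl _ _ thin_Compl_good[OF assms E(1,2)]])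
        (use E in \<open>auto intro!: definable_set_Int definable_set_Compl definable_good cylinder_Int
          cylinder_Compl cylinder_good cylinder_Suc[OF cylinder_good]\<close>)
    moreover have "E = (E \<inter> good n E) \<union> (E \<inter> - good n E)" by blast
    ultimately show ?thesis using fpc_Un by metis
  qed
  show ?case
    unfolding fpc_dim_def
  proof (intro allI impI, elim conjE)
    fix E M assume E: "definable_set \<RR> E" "cylinder (Suc n) E" "E \<subseteq> cube (Suc n) M"
    define B where "B = {z. z n \<in> frontier (fibre n E z)}"
    have B: "definable_set \<RR> B"
      unfolding B_def frontier_real_iff mem_fibre by (intro definable_set_Collect definable_pred_intros E)
    have cB: "cylinder (Suc n) B"
      unfolding cylinder_def
    proof (intro allI impI)
      fix x y :: "nat \<Rightarrow> real" assume xy: "\<forall>i<Suc n. x i = y i"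
      then have "fibre n E x = fibre n E y" by (intro fibre_cong[OF E(2)]) simp
      with xy show "x \<in> B \<longleftrightarrow> y \<in> B" by (simp add: B_def)
    qed
    have fB: "fibre n B x = frontier (fibre n E x)" for x
      by (simp add: fibre_def B_def)
    have "fibre n (E \<inter> B) x = fibre n E x \<inter> frontier (fibre n E x)" for x
      using fB[of x] by (auto simp: fibre_def)
    then have "finite (fibre n (E \<inter> B) x)" for x
      using finite_frontier_fibre[OF assms E(1) fibre_cube[OF E(3)]] by simp
    then have 1: "finitely_path_connected (E \<inter> B)"
      by (intro piece[of _ M]) (use E B cB in \<open>auto intro!: definable_set_Int cylinder_Int\<close>)
    have "fibre n (E - B) x = interior (fibre n E x)" for x
    proof -
      have "fibre n (E - B) x = fibre n E x - frontier (fibre n E x)"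
        using fB[of x] by (auto simp: fibre_def)
      also have "\<dots> = interior (fibre n E x)"
        using closure_subset[of "fibre n E x"] interior_subset[of "fibre n E x"]
        unfolding frontier_def by blast
      finally show ?thesis .
    qed
    then have 2: "finitely_path_connected (E - B)"
      by (intro piece[of _ M]) (use E B cB in \<open>auto intro!: definable_set_Diff cylinder_Diff\<close>)
    have "E = (E \<inter> B) \<union> (E - B)" by blast
    with fpc_Un[OF 1 2] show "finitely_path_connected E" by simp
  qed
qed

section \<open>Local path connectedness\<close>

lemma subspace_topology_eq:
  assumes "E \<subseteq> topspace (Euclidean_space n)"
  shows "subspace_topology n E = top_of_set E"
proof -
  have "subspace_topology n E = subtopology euclidean (topspace (Euclidean_space n) \<inter> E)"
    by (simp add: Euclidean_space_def subtopology_subtopology euclidean_product_topology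
        topspace_Euclidean_space Collect_conj_eq)
  with assms show ?thesis by (simp add: Int_absorb1)
qed

lemma continuous_on_restr: "continuous_on S (restr n)"
proof (rule continuous_on_coordinatewise_then_product)
  show "continuous_on S (\<lambda>x. restr n x i)" for i
    by (cases "i < n") (auto intro: continuous_on_coordinate)
qed

lemma fpc_definable:
  assumes "tame \<RR>" "definable \<RR> n E" "bounded_in_space n E"
  shows "finitely_path_connected E"
proof -
  define A where "A = {x. restr n x \<in> E}"
  have E: "E \<subseteq> topspace (Euclidean_space n)" "definable_set \<RR> A"
    using assms(2) by (auto simp: definable_iff_definable_set A_def)
  obtain M where M: "\<And>x i. x \<in> E \<Longrightarrow> i < n \<Longrightarrow> \<bar>x i\<bar> \<le> M"
    using assms(3) by (auto simp: bounded_in_space_def)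
  have "A \<subseteq> cube n M"
  proof
    fix x assume "x \<in> A"
    then have "- M \<le> x i \<and> x i \<le> M" if "i < n" for i using M[of "restr n x" i] that by (auto simp: A_def)
    then show "x \<in> cube n M" by (simp add: cube_def)
  qed
  moreover have "cylinder n A"
    unfolding cylinder_def
  proof (intro allI impI)
    fix x y :: "nat \<Rightarrow> real" assume "\<forall>i<n. x i = y i"
    then have "restr n x = restr n y" by auto
    then show "x \<in> A \<longleftrightarrow> y \<in> A" by (simp add: A_def)
  qed
  ultimately have "finitely_path_connected A"
    using fpc_dim[OF assms(1), of n] E(2) by (auto simp: fpc_dim_def)
  then have "finitely_path_connected (restr n ` A)"
    by (rule fpc_image[OF _ continuous_on_restr])
  moreover have "restr n ` A = E"
  proof (intro equalityI subsetI)
    fix x assume "x \<in> E"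
    moreover from this have "restr n x = x" using E(1) by (auto simp: topspace_Euclidean_space subset_iff)
    ultimately show "x \<in> restr n ` A" by (intro image_eqI[of _ _ x]) (simp_all add: A_def)
  qed (auto simp: A_def)
  ultimately show ?thesis by simp
qed

text \<open>The paths are traversed on consecutive unit intervals of the half-line, and
  \<open>t / (1 - t)\<close> compresses the half-line into \<open>{0..<1}\<close>. Continuity at the
  end comes from the sets \<open>V k\<close> shrinking to \<open>x\<close>.\<close>

lemma path_infinite_join:
  fixes x :: "'a::topological_space"
  assumes p: "\<And>k. path (p k)" "\<And>k. path_image (p k) \<subseteq> V k"
    and ends: "\<And>k. pathstart (p k) = y k" "\<And>k. pathfinish (p k) = y (Suc k)"
    and V: "\<And>k. V (Suc k) \<subseteq> V k" "\<And>U. open U \<Longrightarrow> x \<in> U \<Longrightarrow> \<exists>k. V k \<subseteq> U"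
  obtains g where "path g" "pathstart g = y 0" "pathfinish g = x" "path_image g \<subseteq> insert x (V 0)"
proof -
  define h where "h = (\<lambda>s::real. p (nat \<lfloor>s\<rfloor>) (s - real (nat \<lfloor>s\<rfloor>)))"
  have h_eq: "h s = p k (s - real k)" if "s \<in> {real k..real k + 1}" for s k
  proof (cases "s = real k + 1")
    case True
    then have "nat \<lfloor>s\<rfloor> = Suc k" by linarith
    then show ?thesis using True ends[of k] ends[of "Suc k"] by (simp add: h_def pathstart_def pathfinish_def)
  next
    case False
    with that have "nat \<lfloor>s\<rfloor> = k" by (simp add: nat_eq_iff floor_eq_iff)
    then show ?thesis by (simp add: h_def)
  qed
  have cont: "continuous_on {0..real m} h" for m
  proof (induction m)
    case (Suc m)
    have "continuous_on {real m..real m + 1} (\<lambda>s. p m (s - real m))"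
      using p(1)[of m] unfolding path_def
      by (rule continuous_on_compose2) (auto intro!: continuous_intros)
    then have "continuous_on {real m..real m + 1} h"
      by (rule continuous_on_eq) (simp add: h_eq)
    with Suc have "continuous_on ({0..real m} \<union> {real m..real m + 1}) h"
      by (intro continuous_on_closed_Un) auto
    moreover have "{0..real m} \<union> {real m..real m + 1} = {0..real (Suc m)}" by auto
    ultimately show ?case by simp
  qed simp
  have anti: "V k \<subseteq> V j" if "j \<le> k" for j k
    using lift_Suc_antimono_le[of V, OF V(1) that] .
  have hV: "h s \<in> V k" if "s \<ge> real k" for s k
  proof -
    define j where "j = nat \<lfloor>s\<rfloor>"
    have s0: "0 \<le> s" using that by linarith
    have "k \<le> j" using that by (simp add: j_def le_nat_floor)
    have "real j \<le> s" "s \<le> real j + 1" using s0 by (auto simp: j_def)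
    then have "h s = p j (s - real j)" by (intro h_eq) auto
    moreover have "p j (s - real j) \<in> path_image (p j)"
      unfolding path_image_def using \<open>real j \<le> s\<close> \<open>s \<le> real j + 1\<close> by (intro imageI) auto
    ultimately show ?thesis using p(2)[of j] anti[OF \<open>k \<le> j\<close>] by auto
  qed
  define g where "g = (\<lambda>t::real. if t < 1 then h (t / (1 - t)) else x)"
  have "continuous_on {0..1} g"
    unfolding continuous_on_eq_continuous_within
  proof
    fix t :: real assume t: "t \<in> {0..1}"
    show "continuous (at t within {0..1}) g"
    proof (cases "t < 1")
      case True
      define t' where "t' = (t + 1) / 2"
      have t': "t < t'" "t' < 1" using True by (auto simp: t'_def)
      obtain m :: nat where m: "t' / (1 - t') \<le> real m" using real_arch_simple by blast
      have "continuous_on {0..t'} (\<lambda>t. h (t / (1 - t)))"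
      proof (rule continuous_on_compose2[OF cont[of m]])
        show "continuous_on {0..t'} (\<lambda>t. t / (1 - t))"
          using t' by (intro continuous_intros) auto
        show "(\<lambda>t. t / (1 - t)) ` {0..t'} \<subseteq> {0..real m}"
        proof (intro image_subsetI)
          fix u assume u: "u \<in> {0..t'}"
          then have "u / (1 - u) \<le> t' / (1 - t')" using t' by (intro frac_le) auto
          with u t' m show "u / (1 - u) \<in> {0..real m}" by auto
        qed
      qed
      then have "continuous_on {0..t'} g"
        by (rule continuous_on_eq) (use t' in \<open>auto simp: g_def\<close>)
      then have "continuous (at t within {0..t'}) g"
        using t t' by (auto simp: continuous_on_eq_continuous_within)
      moreover have "at t within {0..t'} = at t within {0..1}"
        by (rule at_within_nhd[of t "{..<t'}"]) (use t t' in auto)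
      ultimately show ?thesis by simp
    next
      case False
      with t have t1: "t = 1" by simp
      show ?thesis
        unfolding continuous_within tendsto_def
      proof (intro allI impI)
        fix U assume U: "open U" "g t \<in> U"
        then obtain k where k: "V k \<subseteq> U" using V(2) by (auto simp: t1 g_def)
        \<comment> \<open>For \<open>u < 1\<close> the bound \<open>1 - u < 1 / (k + 1)\<close>
          gives \<open>u / (1 - u) > k\<close>, so from this time on only paths with index at least
          \<open>k\<close> occur.\<close>
        define d where "d = 1 / (real k + 1)"
        have "g u \<in> U" if "u \<in> {0..1}" "dist u t < d" for u
        proof (cases "u < 1")
          case True
          then have "1 - u < 1 / (real k + 1)" using that by (simp add: t1 d_def dist_real_def)
          then have "real k * (1 - u) \<le> u" using True by (simp add: field_simps)
          then have "real k \<le> u / (1 - u)" using True by (simp add: field_simps)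
          with hV k True show ?thesis by (auto simp: g_def)
        next
          case False
          with U show ?thesis by (simp add: g_def t1)
        qed
        moreover have "d > 0" by (simp add: d_def)
        ultimately show "\<forall>\<^sub>F u in at t within {0..1}. g u \<in> U"
          unfolding eventually_at by blast
      qed
    qed
  qed
  then have "path g" by (simp add: path_def)
  moreover have "pathstart g = y 0"
    using ends(1)[of 0] by (simp add: pathstart_def g_def h_def)
  moreover have "pathfinish g = x" by (simp add: pathfinish_def g_def)
  moreover have "path_image g \<subseteq> insert x (V 0)"
    unfolding path_image_def g_def using hV[of 0] by auto
  ultimately show thesis by (rule that)
qed

text \<open>
  If points of other path components of \<open>S \<inter> V 0\<close> accumulated at x, then, by finiteness, one could
  choose path connected parts of \<open>S \<inter> V k\<close> accumulating at x, each meeting the previous one;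
  concatenating paths inside them gives a path to x.
\<close>

lemma path_component_neighbourhood:
  fixes x :: "'a::topological_space"
  assumes x: "x \<in> S" "\<And>k. x \<in> V k"
    and V: "\<And>k. V (Suc k) \<subseteq> V k" "\<And>U. open U \<Longrightarrow> x \<in> U \<Longrightarrow> \<exists>k. S \<inter> V k \<subseteq> U"
    and fpc: "\<And>k. finitely_path_connected (S \<inter> V k)"
  obtains j where "\<And>y. y \<in> S \<inter> V j \<Longrightarrow> path_component (S \<inter> V 0) x y"
proof (rule ccontr)
  assume "\<not> thesis"
  then have ex: "\<exists>y. y \<in> S \<inter> V j \<and> \<not> path_component (S \<inter> V 0) x y" for j
    using that by blast
  define acc where "acc = (\<lambda>W. \<forall>j. W \<inter> V j \<noteq> {})"
  define B where "B = {y \<in> S \<inter> V 0. \<not> path_component (S \<inter> V 0) x y}"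
  have anti: "V k \<subseteq> V j" if "j \<le> k" for j k
    using lift_Suc_antimono_le[of V, OF V(1) that] .
  have "acc B"
    unfolding acc_def
  proof
    fix j
    obtain y where "y \<in> S \<inter> V j" "\<not> path_component (S \<inter> V 0) x y"
      using ex by blast
    then show "B \<inter> V j \<noteq> {}" using anti[of 0 j] by (auto simp: B_def)
  qed
  \<comment> \<open>If the trace of \<open>A\<close> on each of the finitely many pieces missed some
    \<open>V j\<close>, then all traces would miss \<open>V J\<close> for a common bound
    \<open>J\<close>, against accumulation of \<open>A\<close>.\<close>
  have pigeon: "\<exists>W. path_connected W \<and> W \<subseteq> S \<inter> V k \<and> acc (A \<inter> W)" if A: "acc A" "A \<subseteq> S \<inter> V k" for A k
  proof (rule ccontr)
    assume no: "\<not> (\<exists>W. path_connected W \<and> W \<subseteq> S \<inter> V k \<and> acc (A \<inter> W))"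
    from fpc[of k, unfolded finitely_path_connected_def]
    obtain \<C> where C: "finite \<C>" "\<forall>C\<in>\<C>. path_connected C" "S \<inter> V k = \<Union>\<C>"
      by (elim exE conjE)
    have "\<exists>j. A \<inter> W \<inter> V j = {}" if "W \<in> \<C>" for W
    proof -
      have "path_connected W" "W \<subseteq> S \<inter> V k" using C that by auto
      with no have "\<not> acc (A \<inter> W)" by blast
      then show ?thesis by (simp add: acc_def)
    qed
    then obtain j where j: "\<And>W. W \<in> \<C> \<Longrightarrow> A \<inter> W \<inter> V (j W) = {}" by metis
    obtain J where J: "\<And>W. W \<in> \<C> \<Longrightarrow> j W \<le> J"
      using C(1) finite_nat_set_iff_bounded_le[of "j ` \<C>"] by auto
    have "A \<inter> V J = {}"
    proof (rule ccontr)
      assume "A \<inter> V J \<noteq> {}"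
      then obtain a where a: "a \<in> A" "a \<in> V J" by blast
      then obtain W where "W \<in> \<C>" "a \<in> W" using A(2) C(3) by blast
      with a j[of W] anti[OF J] show False by blast
    qed
    with A(1) show False by (auto simp: acc_def)
  qed
  \<comment> \<open>Only the initial set has to meet \<open>B\<close>: the chain of overlapping sets
    joins a point of \<open>B\<close> to \<open>x\<close> inside \<open>S \<inter> V 0\<close>,
    which is the contradiction sought.\<close>
  define P where "P = (\<lambda>k W. path_connected W \<and> W \<subseteq> S \<inter> V k \<and> acc W \<and> (k = (0::nat) \<longrightarrow> W \<inter> B \<noteq> {}))"
  define Q where "Q = (\<lambda>(k::nat) W W'. W \<inter> W' \<noteq> ({} :: 'a set))"
  have acc_mono: "acc W" if "acc (A \<inter> W)" for A W using that by (auto simp: acc_def)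
  have acc_nonempty: "A \<noteq> {}" if "acc A" for A using that by (auto simp: acc_def)
  have 1: "\<exists>W. P 0 W"
  proof -
    have "B \<subseteq> S \<inter> V 0" by (auto simp: B_def)
    from pigeon[OF \<open>acc B\<close> this]
    obtain W where W: "path_connected W" "W \<subseteq> S \<inter> V 0" "acc (B \<inter> W)"
      by (elim exE conjE)
    have "P 0 W"
      unfolding P_def using W(1,2) acc_mono[OF W(3)] acc_nonempty[OF W(3)] by auto
    then show ?thesis ..
  qed
  have 2: "\<exists>W'. P (Suc k) W' \<and> Q k W W'" if "P k W" for W k
  proof -
    have W: "W \<subseteq> S \<inter> V k" "acc W" using that by (auto simp: P_def)
    have sub: "W \<inter> V (Suc k) \<subseteq> S \<inter> V (Suc k)" using W(1) by blast
    have acc: "acc (W \<inter> V (Suc k))"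
      unfolding acc_def
    proof
      fix j
      have "W \<inter> V (max j (Suc k)) \<noteq> {}" using W(2) by (auto simp: acc_def)
      then show "W \<inter> V (Suc k) \<inter> V j \<noteq> {}" using anti[of j "max j (Suc k)"] anti[of "Suc k" "max j (Suc k)"] by auto
    qed
    from pigeon[OF acc sub]
    obtain W' where W': "path_connected W'" "W' \<subseteq> S \<inter> V (Suc k)" "acc (W \<inter> V (Suc k) \<inter> W')"
      by (elim exE conjE)
    have "P (Suc k) W'"
      unfolding P_def using W'(1,2) acc_mono[OF W'(3)] by simp
    moreover have "Q k W W'"
      using acc_nonempty[OF W'(3)] by (auto simp: Q_def)
    ultimately show ?thesis by blast
  qed
  obtain W where W: "\<And>k. P k (W k)" "\<And>k. Q k (W k) (W (Suc k))"
    using dependent_nat_choice[of P Q, OF 1 2] by auto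
  obtain b where b: "b \<in> W 0" "b \<in> B" using W(1)[of 0] by (auto simp: P_def)
  have "\<exists>z. z \<in> W k \<inter> W (Suc k)" for k using W(2)[of k] by (auto simp: Q_def)
  then obtain z where z: "\<And>k. z k \<in> W k \<inter> W (Suc k)" by metis
  define y where "y = (\<lambda>k. case k of 0 \<Rightarrow> b | Suc k \<Rightarrow> z k)"
  have y: "y k \<in> W k" "y (Suc k) \<in> W k" for k
    using b z z[of "k - 1"] by (auto simp: y_def split: nat.split)
  have "\<exists>p. path p \<and> path_image p \<subseteq> W k \<and> pathstart p = y k \<and> pathfinish p = y (Suc k)" for k
    using W(1)[of k] y[of k] unfolding P_def path_connected_def by blast
  then obtain p where p: "\<And>k. path (p k)" "\<And>k. path_image (p k) \<subseteq> W k"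
    "\<And>k. pathstart (p k) = y k" "\<And>k. pathfinish (p k) = y (Suc k)" by metis
  obtain g where g: "path g" "pathstart g = y 0" "pathfinish g = x" "path_image g \<subseteq> insert x (S \<inter> V 0)"
  proof (rule path_infinite_join[of p "\<lambda>k. S \<inter> V k" y x])
    show "path_image (p k) \<subseteq> S \<inter> V k" for k
      using p(2)[of k] W(1)[of k] by (auto simp: P_def)
    show "S \<inter> V (Suc k) \<subseteq> S \<inter> V k" for k using V(1)[of k] by blast
  qed (use p V(2) in auto)
  have "path_component (S \<inter> V 0) b x"
    unfolding path_component_def using g x by (intro exI[of _ g]) (auto simp: y_def)
  then have "path_component (S \<inter> V 0) x b" by (rule path_component_sym)
  with b(2) show False by (simp add: B_def)
qed

text \<open>The ambient topology is a product of infinitely many factors, but coordinates from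
  \<open>n\<close> on vanish in n-space, so only the first \<open>n\<close> factors restrict
  \<open>y\<close>. The 1 in the minimum covers \<open>n = 0\<close>.\<close>

lemma Euclidean_space_nhds:
  assumes "open U" "x \<in> U" "x \<in> topspace (Euclidean_space n)"
  obtains \<epsilon> where "\<epsilon> > 0"
    "\<And>y. y \<in> topspace (Euclidean_space n) \<Longrightarrow> (\<And>i. i < n \<Longrightarrow> \<bar>y i - x i\<bar> < \<epsilon>) \<Longrightarrow> y \<in> U"
proof -
  have "openin (product_topology (\<lambda>i. euclidean) UNIV) U"
    using assms(1) by (simp add: euclidean_product_topology)
  from product_topology_open_contains_basis[OF this assms(2)] obtain X where
    X: "x \<in> (\<Pi>\<^sub>E i\<in>UNIV. X i)" "\<And>i. open (X i)" "(\<Pi>\<^sub>E i\<in>UNIV. X i) \<subseteq> U"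
    by auto
  have "\<exists>e>0. ball (x i) e \<subseteq> X i" for i
  proof -
    have "x i \<in> X i" using X(1) by (simp add: PiE_iff)
    with X(2)[of i] show ?thesis by (simp add: open_contains_ball)
  qed
  then obtain e where e: "\<And>i. e i > 0" "\<And>i. ball (x i) (e i) \<subseteq> X i" by metis
  define \<epsilon> where "\<epsilon> = Min (insert 1 (e ` {..<n}))"
  have "\<epsilon> > 0" using e(1) by (simp add: \<epsilon>_def)
  moreover have "y \<in> U"
    if y: "y \<in> topspace (Euclidean_space n)" "\<And>i. i < n \<Longrightarrow> \<bar>y i - x i\<bar> < \<epsilon>" for y
  proof -
    have "y i \<in> X i" for i
    proof (cases "i < n")
      case True
      then have "\<epsilon> \<le> e i" by (simp add: \<epsilon>_def)
      with y(2)[OF True] have "y i \<in> ball (x i) (e i)" by (simp add: dist_real_def abs_minus_commute)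
      with e(2) show ?thesis by blast
    next
      case False
      then have "y i = x i" using y(1) assms(3) by (simp add: topspace_Euclidean_space)
      with X(1) show ?thesis by auto
    qed
    with X(3) show ?thesis by auto
  qed
  ultimately show thesis by (rule that)
qed

lemma definable_Int_obox: "definable \<RR> n E \<Longrightarrow> definable \<RR> n (E \<inter> obox n a b)"
proof -
  assume E: "definable \<RR> n E"
  have "{x. restr n x \<in> E \<inter> obox n a b} = {x. restr n x \<in> E} \<inter> obox n a b"
    by (auto simp: obox_def)
  moreover have "definable_set \<RR> (obox n a b)"
    unfolding obox_def by (intro definable_set_Collect definable_pred_intros)
  ultimately show ?thesis
    using E by (auto simp: definable_iff_definable_set intro: definable_set_Int)
qed

lemma bounded_obox: "bounded_in_space n (E \<inter> obox n a b)"
proof -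
  define M where "M = Max (insert 0 ((\<lambda>i. max \<bar>a i\<bar> \<bar>b i\<bar>) ` {..<n}))"
  have "\<bar>x i\<bar> \<le> M" if "x \<in> obox n a b" "i < n" for x i
  proof -
    have "\<bar>x i\<bar> \<le> max \<bar>a i\<bar> \<bar>b i\<bar>" using that by (force simp: obox_def)
    also have "\<dots> \<le> M" unfolding M_def using that by (intro Max_ge) auto
    finally show ?thesis .
  qed
  then show ?thesis by (auto simp: bounded_in_space_def)
qed

text \<open>\<open>E\<close> may be unbounded; the finiteness theorem is applied to its traces on
  shrinking open boxes around \<open>x\<close>, which are bounded and definable. It suffices to find
  in each neighbourhood of a point a smaller one whose points are joined to it inside the larger,
  that is, path connectedness im kleinen everywhere.\<close>

lemma locally_path_connected_definable:
  assumes "tame \<RR>" and E: "definable \<RR> n E"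
  shows "locally_path_connected_space (subspace_topology n E)"
proof -
  have sub: "E \<subseteq> topspace (Euclidean_space n)" using E by (simp add: definable_iff_definable_set)
  show ?thesis
    unfolding subspace_topology_eq[OF sub] locally_path_connected_space_im_kleinen
  proof (intro allI impI, elim conjE)
    fix T x assume "openin (top_of_set E) T" "x \<in> T"
    then obtain U where U: "open U" "T = E \<inter> U" and x: "x \<in> E" "x \<in> U"
      by (auto simp: openin_open)
    obtain \<epsilon> where \<epsilon>: "\<epsilon> > 0" "\<And>y. y \<in> topspace (Euclidean_space n) \<Longrightarrow>
        (\<And>i. i < n \<Longrightarrow> \<bar>y i - x i\<bar> < \<epsilon>) \<Longrightarrow> y \<in> U"
      using Euclidean_space_nhds[OF U(1) x(2)] sub x(1) by blast
    define V where "V = (\<lambda>k. obox n (\<lambda>i. x i - \<epsilon> / real (Suc k)) (\<lambda>i. x i + \<epsilon> / real (Suc k)))"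
    have memV: "y \<in> V k \<longleftrightarrow> (\<forall>i<n. \<bar>y i - x i\<bar> < \<epsilon> / real (Suc k))" for y k
      by (auto simp: V_def obox_def abs_less_iff)
    have anti: "\<epsilon> / real (Suc (Suc k)) \<le> \<epsilon> / real (Suc k)" for k
      using \<epsilon>(1) by (intro divide_left_mono) auto
    have V0: "E \<inter> V 0 \<subseteq> T"
      using \<epsilon>(2) sub by (auto simp: memV U(2))
    obtain j where j: "\<And>y. y \<in> E \<inter> V j \<Longrightarrow> path_component (E \<inter> V 0) x y"
    proof (rule path_component_neighbourhood[of x E V])
      show "x \<in> V k" for k using \<epsilon>(1) by (simp add: memV)
      show "V (Suc k) \<subseteq> V k" for k
        unfolding subset_iff memV using anti[of k] by (meson less_le_trans)
      show "\<exists>k. E \<inter> V k \<subseteq> U'" if U': "open U'" "x \<in> U'" for U'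
      proof -
        obtain d where d: "d > 0" "\<And>y. y \<in> topspace (Euclidean_space n) \<Longrightarrow>
            (\<And>i. i < n \<Longrightarrow> \<bar>y i - x i\<bar> < d) \<Longrightarrow> y \<in> U'"
          using Euclidean_space_nhds[OF U'] sub x(1) by blast
        obtain k where k: "\<epsilon> / d < real k" using reals_Archimedean2 by blast
        then have "\<epsilon> / real (Suc k) < d" using d(1) by (simp add: field_simps)
        then have "E \<inter> V k \<subseteq> U'" using d(2) sub by (force simp: memV)
        then show ?thesis ..
      qed
      show "finitely_path_connected (E \<inter> V k)" for k
        unfolding V_def by (intro fpc_definable[where n = n, OF assms(1)] definable_Int_obox E bounded_obox)
    qed (use x in auto)
    show "\<exists>U. openin (top_of_set E) U \<and> x \<in> U \<and> U \<subseteq> T \<and>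
        (\<forall>y\<in>U. \<exists>C. path_connectedin (top_of_set E) C \<and> C \<subseteq> T \<and> x \<in> C \<and> y \<in> C)"
    proof (rule exI[of _ "E \<inter> V j"], intro conjI ballI)
      show "openin (top_of_set E) (E \<inter> V j)"
        unfolding V_def by (intro openin_open_Int open_obox)
      show "x \<in> E \<inter> V j" using x \<epsilon>(1) by (simp add: memV)
      have "V j \<subseteq> V 0"
      proof -
        have "\<epsilon> / real (Suc j) \<le> \<epsilon> / real (Suc 0)" using \<epsilon>(1) by (intro divide_left_mono) auto
        then show ?thesis unfolding subset_iff memV by (meson less_le_trans)
      qed
      with V0 show "E \<inter> V j \<subseteq> T" by blast
      fix y assume "y \<in> E \<inter> V j"
      from j[OF this] obtain g where g: "path g" "path_image g \<subseteq> E \<inter> V 0" "pathstart g = x" "pathfinish g = y"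
        unfolding path_component_def by blast
      have "path_connected (path_image g)" using g(1) by (rule path_connected_path_image)
      then show "\<exists>C. path_connectedin (top_of_set E) C \<and> C \<subseteq> T \<and> x \<in> C \<and> y \<in> C"
        using g V0 pathstart_in_path_image[of g] pathfinish_in_path_image[of g]
        by (intro exI[of _ "path_image g"]) (auto simp: path_connectedin_subtopology)
    qed
  qed
qed

lemma components_eq_of_locally_path_connected:
  assumes "locally_path_connected_space X"
  shows "connected_components_of X = path_components_of X \<and> connected_components_of X = quasi_components_of X"
  using path_components_eq_connected_components_of[OF assms] quasi_eq_connected_components_of[of X]
    locally_path_connected_imp_locally_connected_space[OF assms] by auto

section \<open>One-dimensional conditions\<close>

text \<open>Only the two ends can be frontier points. On an unbounded side \<open>Inf I\<close> or
  \<open>Sup I\<close> has no meaning, but it merely enlarges a finite set.\<close>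

lemma finite_frontier_open_interval:
  fixes I :: "real set"
  assumes "open I" "is_interval I"
  shows "finite (frontier I)"
proof -
  have "frontier I \<subseteq> {Inf I, Sup I}"
  proof
    fix t assume t: "t \<in> frontier I"
    have tI: "t \<notin> I" using t assms(1) by (simp add: frontier_def interior_open)
    have near: "\<exists>s. u < s \<and> s < v \<and> s \<in> I" if "u < t" "t < v" for u v
      using t that unfolding frontier_real_iff by blast
    consider "\<forall>u\<in>I. t \<le> u" | "\<forall>u\<in>I. u \<le> t"
      using assms(2) tI unfolding is_interval_1 by (meson linear)
    then show "t \<in> {Inf I, Sup I}"
    proof cases
      case 1
      have "Inf I = t"
      proof (rule cInf_eq)
        fix y assume y: "\<And>x. x \<in> I \<Longrightarrow> y \<le> x"
        show "y \<le> t"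
        proof (rule ccontr)
          assume "\<not> y \<le> t"
          then obtain s where "s < y" "s \<in> I" using near[of "t - 1" y] by auto
          with y[of s] show False by simp
        qed
      qed (use 1 in auto)
      then show ?thesis by simp
    next
      case 2
      have "Sup I = t"
      proof (rule cSup_eq)
        fix y assume y: "\<And>x. x \<in> I \<Longrightarrow> x \<le> y"
        show "t \<le> y"
        proof (rule ccontr)
          assume "\<not> t \<le> y"
          then obtain s where "y < s" "s \<in> I" using near[of y "t + 1"] by auto
          with y[of s] show False by simp
        qed
      qed (use 2 in auto)
      then show ?thesis by simp
    qed
  qed
  then show ?thesis by (rule finite_subset) simp
qed

lemma frontier_Un_subset_real: "frontier (S \<union> T) \<subseteq> frontier S \<union> frontier (T :: real set)"
proof -
  have "interior S \<subseteq> interior (S \<union> T)" "interior T \<subseteq> interior (S \<union> T)"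
    by (intro interior_mono; blast)+
  then show ?thesis by (auto simp: frontier_def closure_Un)
qed

lemma finite_frontier_of_union:
  assumes "finite_union_points_intervals A"
  shows "finite (frontier A)"
proof -
  obtain P \<I> where PI: "finite P" "finite \<I>" "\<forall>I\<in>\<I>. open I \<and> is_interval I" "A = P \<union> \<Union>\<I>"
    using assms unfolding finite_union_points_intervals_def by blast
  from PI(2,3) have "finite (frontier (\<Union>\<I>))"
  proof (induction \<I>)
    case (insert I \<I>)
    have "finite (frontier I \<union> frontier (\<Union>\<I>))"
      using insert finite_frontier_open_interval by auto
    then show ?case
      using finite_subset[OF frontier_Un_subset_real[of I "\<Union>\<I>"]] by simp
  qed simp
  moreover have "finite (frontier P)" using PI(1) by (simp add: frontier_finite_real)
  ultimately show ?thesis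
    unfolding PI(4) using finite_subset[OF frontier_Un_subset_real[of P "\<Union>\<I>"]] by simp
qed

text \<open>A point off the frontier lies in an interval free of frontier points, which by
  connectedness is inside or outside \<open>A\<close>. The family \<open>J\<close> has intervals for
  all pairs of frontier points, not only neighbouring ones; the selection
  \<open>I \<subseteq> A\<close> removes the wrong ones.\<close>

lemma finite_union_of_frontier:
  assumes "finite (frontier A)"
  shows "finite_union_points_intervals A"
proof -
  let ?F = "frontier A"
  define J where "J = (\<lambda>(s, t). {s<..<t}) ` (?F \<times> ?F) \<union> lessThan ` ?F \<union> greaterThan ` ?F \<union> {UNIV}"
  define \<I> where "\<I> = {I \<in> J. I \<subseteq> A}"
  have "finite J" using assms by (simp add: J_def)
  then have 1: "finite \<I>" by (simp add: \<I>_def)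
  have 2: "open I \<and> is_interval I" if "I \<in> \<I>" for I
    using that by (auto simp: \<I>_def J_def is_interval_connected_1)
  have "A = A \<inter> ?F \<union> \<Union>\<I>"
  proof (intro equalityI subsetI)
    fix x assume x: "x \<in> A"
    show "x \<in> A \<inter> ?F \<union> \<Union>\<I>"
    proof (cases "x \<in> ?F")
      case False
      have ex: "\<exists>I\<in>J. x \<in> I \<and> connected I \<and> I \<inter> ?F = {}"
      proof -
        define L where "L = {f \<in> ?F. f < x}"
        define U where "U = {f \<in> ?F. x < f}"
        have fin: "finite L" "finite U" using assms by (auto simp: L_def U_def)
        have F: "?F = L \<union> U" using False by (auto simp: L_def U_def) (metis linorder_neqE)
        have L: "Max L < x" "Max L \<in> ?F" "{Max L<..} \<inter> L = {}" if "L \<noteq> {}"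
        proof -
          have "Max L \<in> L" using fin(1) that by (rule Max_in)
          then show "Max L < x" "Max L \<in> ?F" by (simp_all add: L_def)
          show "{Max L<..} \<inter> L = {}" by (auto dest: Max_ge[OF fin(1)])
        qed
        have U: "x < Min U" "Min U \<in> ?F" "{..<Min U} \<inter> U = {}" if "U \<noteq> {}"
        proof -
          have "Min U \<in> U" using fin(2) that by (rule Min_in)
          then show "x < Min U" "Min U \<in> ?F" by (simp_all add: U_def)
          show "{..<Min U} \<inter> U = {}" by (auto dest: Min_le[OF fin(2)])
        qed
        consider "L = {}" "U = {}" | "L \<noteq> {}" "U = {}" | "L = {}" "U \<noteq> {}" | "L \<noteq> {}" "U \<noteq> {}" by blast
        then show ?thesis
        proof cases
          case 1
          then show ?thesis by (intro bexI[of _ UNIV]) (auto simp: F J_def)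
        next
          case 2
          have "{Max L<..} \<in> J" using L(2)[OF 2(1)] by (simp add: J_def)
          moreover have "{Max L<..} \<inter> ?F = {}" using L(3)[OF 2(1)] 2(2) F by blast
          ultimately show ?thesis using L(1)[OF 2(1)] by (intro bexI[of _ "{Max L<..}"]) auto
        next
          case 3
          have "{..<Min U} \<in> J" using U(2)[OF 3(2)] by (simp add: J_def)
          moreover have "{..<Min U} \<inter> ?F = {}" using U(3)[OF 3(2)] 3(1) F by blast
          ultimately show ?thesis using U(1)[OF 3(2)] by (intro bexI[of _ "{..<Min U}"]) auto
        next
          case 4
          have "{Max L<..<Min U} \<in> J"
            unfolding J_def using L(2)[OF 4(1)] U(2)[OF 4(2)]
            by (intro UnI1 image_eqI[of _ _ "(Max L, Min U)"]) auto
          moreover have "{Max L<..<Min U} \<inter> ?F = {}"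
          proof -
            have "{Max L<..<Min U} = {Max L<..} \<inter> {..<Min U}" by auto
            with L(3)[OF 4(1)] U(3)[OF 4(2)] F show ?thesis by blast
          qed
          ultimately show ?thesis
            using L(1)[OF 4(1)] U(1)[OF 4(2)] by (intro bexI[of _ "{Max L<..<Min U}"]) auto
        qed
      qed
      then obtain I where I: "I \<in> J" "x \<in> I" "connected I" "I \<inter> ?F = {}" by blast
      then have "I \<subseteq> A" using connected_Int_frontier[of I A] x by blast
      with I show ?thesis by (auto simp: \<I>_def)
    qed (use x in simp)
  qed (auto simp: \<I>_def)
  moreover have "finite (A \<inter> ?F)" using assms by simp
  ultimately show ?thesis
    unfolding finite_union_points_intervals_def using 1 2 by blast
qed

lemma frontier_Int_open_subset:
  assumes "open U"
  shows "frontier S \<inter> U \<subseteq> frontier (S \<inter> U)"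
proof
  fix x assume x: "x \<in> frontier S \<inter> U"
  then have "x \<in> closure (U \<inter> S)"
    using open_Int_closure_subset[OF assms, of S] by (auto simp: frontier_def)
  moreover have "x \<notin> interior (S \<inter> U)" using x by (auto simp: frontier_def)
  ultimately show "x \<in> frontier (S \<inter> U)" by (simp add: frontier_def Int_commute)
qed

text \<open>Cutting with an open set loses no frontier points inside it, so compactness transfers
  local finiteness to compact intervals. Conversely, cutting with the interval of radius 1 adds at
  most its endpoints to the frontier.\<close>

lemma locally_o_minimal_iff_tame: "locally_o_minimal \<RR> \<longleftrightarrow> tame \<RR>"
proof
  assume L: "locally_o_minimal \<RR>"
  show "tame \<RR>"
    unfolding tame_def
  proof (intro allI impI)
    fix S and a b :: real assume "definable_real \<RR> S"
    then have "\<exists>U. open U \<and> x \<in> U \<and> finite_union_points_intervals (S \<inter> U)" for x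
      using L by (auto simp: locally_o_minimal_def)
    then obtain U where U: "\<And>x. open (U x)" "\<And>x. x \<in> U x" "\<And>x. finite_union_points_intervals (S \<inter> U x)"
      by metis
    obtain T where T: "T \<subseteq> {a..b}" "finite T" "{a..b} \<subseteq> (\<Union>x\<in>T. U x)"
    proof (rule compactE_image[where f = U and C = "{a..b}" and S = "{a..b}"])
      show "{a..b} \<subseteq> (\<Union>x\<in>{a..b}. U x)" using U(2) by blast
    qed (use U(1) in auto)
    have "finite (frontier S \<inter> U x)" for x
      by (rule finite_subset[OF frontier_Int_open_subset[OF U(1)] finite_frontier_of_union[OF U(3)]])
    then have "finite (\<Union>x\<in>T. frontier S \<inter> U x)" using T(2) by blast
    moreover have "frontier S \<inter> {a..b} \<subseteq> (\<Union>x\<in>T. frontier S \<inter> U x)" using T(3) by blast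
    ultimately show "finite (frontier S \<inter> {a..b})" by (rule finite_subset[rotated])
  qed
next
  assume T: "tame \<RR>"
  show "locally_o_minimal \<RR>"
    unfolding locally_o_minimal_def
  proof (intro allI impI)
    fix S and x :: real assume S: "definable_real \<RR> S"
    let ?U = "{x - 1<..<x + 1}"
    have "frontier (S \<inter> ?U) \<subseteq> (frontier S \<inter> {x - 1..x + 1}) \<union> {x - 1, x + 1}"
    proof
      fix t assume t: "t \<in> frontier (S \<inter> ?U)"
      have "closure (S \<inter> ?U) \<subseteq> closure ?U" by (intro closure_mono) auto
      then have t1: "t \<in> {x - 1..x + 1}" using t by (auto simp: frontier_def)
      have "t \<in> frontier S" if "t \<in> ?U"
      proof -
        have "t \<in> closure S" using t closure_mono[of "S \<inter> ?U" S] by (auto simp: frontier_def)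
        moreover have "t \<notin> interior S" using t that by (auto simp: frontier_def interior_open)
        ultimately show ?thesis by (simp add: frontier_def)
      qed
      with t1 show "t \<in> (frontier S \<inter> {x - 1..x + 1}) \<union> {x - 1, x + 1}" by force
    qed
    moreover have "finite ((frontier S \<inter> {x - 1..x + 1}) \<union> {x - 1, x + 1})"
      using T S by (auto simp: tame_def)
    ultimately have "finite (frontier (S \<inter> ?U))" by (rule finite_subset)
    then have "finite_union_points_intervals (S \<inter> ?U)" by (rule finite_union_of_frontier)
    then show "\<exists>U. open U \<and> x \<in> U \<and> finite_union_points_intervals (S \<inter> U)"
      by (intro exI[of _ ?U]) auto
  qed
qed

lemma closed_discrete_iff_no_limpt:
  fixes A :: "'a::t1_space set"
  shows "closed A \<and> discrete A \<longleftrightarrow> (\<forall>x. \<not> x islimpt A)"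
  by (auto simp: closed_limpt discrete_def isolated_in_islimpt_iff)

text \<open>The frontier of \<open>S\<close> consists of \<open>S - interior S\<close> and the same
  set for \<open>- S\<close>; both are definable with empty interior, and a set without limit points
  is finite on compact intervals. Conversely, a set with empty interior lies in its own
  frontier.\<close>

lemma tame_iff_closed_discrete:
  "tame \<RR> \<longleftrightarrow> (\<forall>A. definable_real \<RR> A \<and> interior A = {} \<longrightarrow> closed A \<and> discrete A)"
proof
  assume T: "tame \<RR>"
  show "\<forall>A. definable_real \<RR> A \<and> interior A = {} \<longrightarrow> closed A \<and> discrete A"
    unfolding closed_discrete_iff_no_limpt
  proof (intro allI impI notI)
    fix A and x :: real assume A: "definable_real \<RR> A \<and> interior A = {}" and x: "x islimpt A"
    have "A \<subseteq> frontier A" using A closure_subset[of A] by (auto simp: frontier_def)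
    then have "{x - 1<..<x + 1} \<inter> A \<subseteq> frontier A \<inter> {x - 1..x + 1}" by auto
    moreover have "finite (frontier A \<inter> {x - 1..x + 1})" using T A by (auto simp: tame_def)
    ultimately have "finite ({x - 1<..<x + 1} \<inter> A)" by (rule finite_subset)
    moreover have "infinite ({x - 1<..<x + 1} \<inter> A)"
      using x unfolding islimpt_eq_acc_point by auto
    ultimately show False by simp
  qed
next
  assume R: "\<forall>A. definable_real \<RR> A \<and> interior A = {} \<longrightarrow> closed A \<and> discrete A"
  have fin: "finite ({a..b} \<inter> (S - interior S))" if S: "definable_real \<RR> S" for S and a b :: real
  proof -
    have int: "t \<in> interior S \<longleftrightarrow> (\<exists>u v. u < t \<and> t < v \<and> (\<forall>s. u < s \<and> s < v \<longrightarrow> s \<in> S))" for t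
    proof
      assume "t \<in> interior S"
      then obtain e where e: "e > 0" "ball t e \<subseteq> S" by (auto simp: mem_interior)
      have "s \<in> S" if "t - e < s \<and> s < t + e" for s
        using e(2) that by (auto simp: ball_def dist_real_def abs_less_iff)
      with e(1) show "\<exists>u v. u < t \<and> t < v \<and> (\<forall>s. u < s \<and> s < v \<longrightarrow> s \<in> S)"
        by (intro exI[of _ "t - e"] exI[of _ "t + e"]) auto
    next
      assume "\<exists>u v. u < t \<and> t < v \<and> (\<forall>s. u < s \<and> s < v \<longrightarrow> s \<in> S)"
      then obtain u v where uv: "u < t" "t < v" "\<forall>s. u < s \<and> s < v \<longrightarrow> s \<in> S" by blast
      then have "{u<..<v} \<subseteq> S" by auto
      with uv show "t \<in> interior S" by (intro interiorI[of "{u<..<v}"]) auto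
    qed
    have "definable_real \<RR> {t. t \<in> S \<and> \<not> (\<exists>u v. u < t \<and> t < v \<and> (\<forall>s. u < s \<and> s < v \<longrightarrow> s \<in> S))}"
      by (intro definable_real_Collect definable_pred_intros definable_pred_mem_real[OF S])
    then have "definable_real \<RR> (S - interior S)" by (simp add: int set_diff_eq)
    moreover have "interior (S - interior S) = {}"
      using interior_mono[of "S - interior S" S] interior_subset[of "S - interior S"] by blast
    ultimately have "\<forall>x. \<not> x islimpt (S - interior S)"
      using R closed_discrete_iff_no_limpt by blast
    then show ?thesis by (intro finite_not_islimpt_in_compact) auto
  qed
  show "tame \<RR>"
    unfolding tame_def
  proof (intro allI impI)
    fix S and a b :: real assume S: "definable_real \<RR> S"
    then have "definable_real \<RR> (- S)" by (simp add: definable_real_iff definable_pred_not)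
    with S have "finite ({a..b} \<inter> (S - interior S) \<union> {a..b} \<inter> (- S - interior (- S)))"
      using fin by blast
    moreover have "frontier S \<inter> {a..b} \<subseteq> {a..b} \<inter> (S - interior S) \<union> {a..b} \<inter> (- S - interior (- S))"
      by (auto simp: frontier_def interior_complement)
    ultimately show "finite (frontier S \<inter> {a..b})" by (rule finite_subset[rotated])
  qed
qed

section \<open>The expansion by the definable subsets of a bounded set\<close>

lemma wf_tm_expansion: "wf_tm (expansion_by_subsets \<RR> n E) t \<Longrightarrow> \<exists>i. t = Var i"
  by (cases t) (auto simp: expansion_by_subsets_def)

lemma sat_Rel_expansion:
  "sat (expansion_by_subsets \<RR> n E) e (Rel D ts) \<longleftrightarrow>
     (\<lambda>i. if i < n then map (eval_tm (expansion_by_subsets \<RR> n E) e) ts ! i else 0) \<in> D"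
proof -
  have "rel_interp (expansion_by_subsets \<RR> n E) D xs \<longleftrightarrow> (\<lambda>i. if i < n then xs ! i else 0) \<in> D" for xs
    by (simp add: expansion_by_subsets_def)
  then show ?thesis by (simp only: sat.simps)
qed

text \<open>Formulas of the expansion translate back into the original structure, since its
  relations are definable there and its terms are variables. The substitution \<open>T\<close> is
  general because a quantifier pushes a new point and shifts the others.\<close>

lemma definable_pred_sat_expansion:
  assumes "wf_fm (expansion_by_subsets \<RR> n E) \<phi>" and "\<And>m. simple_term (T m)"
  shows "definable_pred \<RR> (\<lambda>e. sat (expansion_by_subsets \<RR> n E) (\<lambda>m. T m e) \<phi>)"
  using assms
proof (induction \<phi> arbitrary: T)
  case (Eq s t)
  then have "wf_tm (expansion_by_subsets \<RR> n E) s" "wf_tm (expansion_by_subsets \<RR> n E) t" by simp_all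
  then obtain i j where "s = Var i" "t = Var j"
    using wf_tm_expansion by blast
  then show ?case using definable_pred_eq[OF Eq.prems(2) Eq.prems(2)] by simp
next
  case (Less s t)
  then have "wf_tm (expansion_by_subsets \<RR> n E) s" "wf_tm (expansion_by_subsets \<RR> n E) t" by simp_all
  then obtain i j where "s = Var i" "t = Var j"
    using wf_tm_expansion by blast
  then show ?case using definable_pred_less[OF Less.prems(2) Less.prems(2)] by simp
next
  case (Rel D ts)
  let ?S = "expansion_by_subsets \<RR> n E"
  have D: "definable \<RR> n D" "length ts = n" "\<And>t. t \<in> set ts \<Longrightarrow> \<exists>i. t = Var i"
    using Rel.prems(1) wf_tm_expansion[of \<RR> n E] by (auto simp: expansion_by_subsets_def)
  have st: "simple_term (\<lambda>e. if i < n then eval_tm ?S (\<lambda>m. T m e) (ts ! i) else 0)" for i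
  proof (cases "i < n")
    case True
    then obtain j where "ts ! i = Var j" using D(2,3) nth_mem by blast
    then show ?thesis using True Rel.prems(2)[of j] by simp
  qed (simp add: simple_term_const)
  have set: "definable_set \<RR> {x. restr n x \<in> D}"
    using D(1) by (simp add: definable_iff_definable_set)
  have "definable_pred \<RR> (\<lambda>e. (\<lambda>i. if i < n then eval_tm ?S (\<lambda>m. T m e) (ts ! i) else 0) \<in> {x. restr n x \<in> D})"
    using definable_pred_mem[OF set, of "\<lambda>e i. if i < n then eval_tm ?S (\<lambda>m. T m e) (ts ! i) else 0"] st
    by blast
  moreover have "sat ?S (\<lambda>m. T m e) (Rel D ts) \<longleftrightarrow>
      (\<lambda>i. if i < n then eval_tm ?S (\<lambda>m. T m e) (ts ! i) else 0) \<in> {x. restr n x \<in> D}" for e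
  proof -
    have "(\<lambda>i. if i < n then map (eval_tm ?S (\<lambda>m. T m e)) ts ! i else 0) =
        restr n (\<lambda>i. if i < n then eval_tm ?S (\<lambda>m. T m e) (ts ! i) else 0)"
      using D(2) by auto
    moreover have "sat ?S (\<lambda>m. T m e) (Rel D ts) \<longleftrightarrow>
        (\<lambda>i. if i < n then map (eval_tm ?S (\<lambda>m. T m e)) ts ! i else 0) \<in> D"
      by (rule sat_Rel_expansion)
    ultimately show ?thesis by (simp only: mem_Collect_eq)
  qed
  ultimately show ?case by (simp only:)
next
  case (Neg \<phi>)
  then show ?case by (simp add: definable_pred_not)
next
  case (Conj \<phi> \<psi>)
  then show ?case by (simp add: definable_pred_conj)
next
  case (Exi i \<phi>)
  let ?S = "expansion_by_subsets \<RR> n E"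
  define T' where "T' = (\<lambda>m e. if m = i then e 0 0 else T m (\<lambda>k. e (Suc k)))"
  have "simple_term (T' m)" for m
    using simple_term_subst[OF Exi.prems(2)[of m], of "\<lambda>e k. e (Suc k)"]
    by (cases "m = i") (simp_all add: T'_def simple_term_var)
  then have "definable_pred \<RR> (\<lambda>e. sat ?S (\<lambda>m. T' m e) \<phi>)"
    using Exi by auto
  moreover have "(\<lambda>m. T' m e) = (\<lambda>m. T m (\<lambda>k. e (Suc k)))(i := e 0 0)" for e
    by (auto simp: T'_def)
  ultimately have "definable_pred \<RR> (\<lambda>e. sat ?S ((\<lambda>m. T m (\<lambda>k. e (Suc k)))(i := e 0 0)) \<phi>)"
    by (simp only:)
  then show ?case
    using definable_pred_ex_real[of \<RR> "\<lambda>e a. sat ?S ((\<lambda>m. T m e)(i := a)) \<phi>"] by simp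
qed

text \<open>Tuples of a relation have their coordinates in \<open>{-B..B}\<close> and are fixed by
  \<open>h\<close>; by injectivity no other tuple can be moved into a relation. So \<open>h\<close>
  is an automorphism of the whole expansion.\<close>

lemma sat_expansion_automorphism:
  assumes bd: "\<And>x i. x \<in> E \<Longrightarrow> i < n \<Longrightarrow> \<bar>x i\<bar> \<le> B"
    and h: "\<And>y. k (h y) = y" "\<And>y. h (k y) = y" "\<And>x y. x < y \<Longrightarrow> h x < h y" "\<And>y. \<bar>y\<bar> \<le> B \<Longrightarrow> h y = y"
    and "wf_fm (expansion_by_subsets \<RR> n E) \<phi>"
  shows "sat (expansion_by_subsets \<RR> n E) (\<lambda>m. h (e m)) \<phi> \<longleftrightarrow> sat (expansion_by_subsets \<RR> n E) e \<phi>"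
  using assms(6)
proof (induction \<phi> arbitrary: e)
  case (Eq s t)
  then have "wf_tm (expansion_by_subsets \<RR> n E) s" "wf_tm (expansion_by_subsets \<RR> n E) t" by simp_all
  then obtain i j where "s = Var i" "t = Var j"
    using wf_tm_expansion by blast
  moreover have "h x = h y \<longleftrightarrow> x = y" for x y using h(1) by metis
  ultimately show ?case by simp
next
  case (Less s t)
  then have "wf_tm (expansion_by_subsets \<RR> n E) s" "wf_tm (expansion_by_subsets \<RR> n E) t" by simp_all
  then obtain i j where "s = Var i" "t = Var j"
    using wf_tm_expansion by blast
  moreover have "h x < h y \<longleftrightarrow> x < y" for x y using h(3) by (metis less_asym neqE)
  ultimately show ?case by simp
next
  case (Rel D ts)
  let ?S = "expansion_by_subsets \<RR> n E"
  have D: "D \<subseteq> E" "length ts = n" "\<And>t. t \<in> set ts \<Longrightarrow> \<exists>i. t = Var i"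
    using Rel.prems(1) wf_tm_expansion[of \<RR> n E] by (auto simp: expansion_by_subsets_def)
  define z where "z = (\<lambda>i. if i < n then eval_tm ?S e (ts ! i) else 0)"
  define z' where "z' = (\<lambda>i. if i < n then h (eval_tm ?S e (ts ! i)) else 0)"
  have "eval_tm ?S (\<lambda>m. h (e m)) (ts ! i) = h (eval_tm ?S e (ts ! i))" if i: "i < n" for i
  proof -
    obtain j where "ts ! i = Var j" using D(3)[of "ts ! i"] D(2) i by auto
    then show ?thesis by simp
  qed
  then have "(\<lambda>i. if i < n then map (eval_tm ?S (\<lambda>m. h (e m))) ts ! i else 0) = z'"
    using D(2) by (auto simp: z'_def)
  then have 1: "sat ?S (\<lambda>m. h (e m)) (Rel D ts) \<longleftrightarrow> z' \<in> D"
    by (simp only: sat_Rel_expansion)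
  have "(\<lambda>i. if i < n then map (eval_tm ?S e) ts ! i else 0) = z"
    using D(2) by (auto simp: z_def)
  then have 2: "sat ?S e (Rel D ts) \<longleftrightarrow> z \<in> D"
    by (simp only: sat_Rel_expansion)
  have "z' = z" if "z \<in> D \<or> z' \<in> D"
  proof
    fix i
    show "z' i = z i"
    proof (cases "i < n")
      case True
      from that show ?thesis
      proof
        assume "z \<in> D"
        then have "\<bar>z i\<bar> \<le> B" using bd D(1) True by blast
        then show ?thesis using h(4)[of "z i"] True by (simp add: z_def z'_def)
      next
        assume "z' \<in> D"
        then have "\<bar>z' i\<bar> \<le> B" using bd D(1) True by blast
        then have "h (z' i) = z' i" by (rule h(4))
        moreover have "z' i = h (z i)" using True by (simp add: z_def z'_def)
        ultimately show ?thesis using h(1) by metis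
      qed
    qed (simp add: z_def z'_def)
  qed
  with 1 2 show ?case by metis
next
  case (Exi i \<phi>)
  let ?S = "expansion_by_subsets \<RR> n E"
  have IH: "sat ?S (\<lambda>m. h (e m)) \<phi> \<longleftrightarrow> sat ?S e \<phi>" for e using Exi by simp
  have upd: "(\<lambda>m. h ((e(i := a)) m)) = (\<lambda>m. h (e m))(i := h a)" for a by auto
  have "sat ?S ((\<lambda>m. h (e m))(i := h a)) \<phi> \<longleftrightarrow> sat ?S (e(i := a)) \<phi>" for a
    using IH[of "e(i := a)"] unfolding upd .
  moreover have "(\<exists>a. sat ?S ((\<lambda>m. h (e m))(i := a)) \<phi>) \<longleftrightarrow> (\<exists>a. sat ?S ((\<lambda>m. h (e m))(i := h a)) \<phi>)"
    using h(2) by metis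
  ultimately show ?case by simp
qed auto

text \<open>The map is affine on \<open>{l..u}\<close> and on \<open>{u..r}\<close> and the identity
  elsewhere. Its inverse arises by exchanging \<open>u\<close> and \<open>v\<close>, which is why
  the auxiliary facts are proved for arbitrary \<open>u\<close> and \<open>v\<close>.\<close>

lemma ex_order_automorphism:
  fixes l u v r :: real
  assumes "l < u" "u < r" "l < v" "v < r"
  obtains h k where "\<And>y. k (h y) = y" "\<And>y. h (k y) = y" "\<And>x y. x < y \<Longrightarrow> h x < h y"
    "h u = v" "\<And>y. y \<le> l \<or> r \<le> y \<Longrightarrow> h y = y"
proof -
  define f where "f = (\<lambda>u v x. if x \<le> l \<or> r \<le> x then x
     else if x \<le> u then l + (v - l) / (u - l) * (x - l) else r - (r - v) / (r - u) * (r - x))"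
  have f: "x \<le> l \<or> r \<le> x \<Longrightarrow> f u v x = x"
      "l < x \<Longrightarrow> x \<le> u \<Longrightarrow> f u v x = l + (v - l) / (u - l) * (x - l)"
      "u < x \<Longrightarrow> x < r \<Longrightarrow> f u v x = r - (r - v) / (r - u) * (r - x)"
    if "l < u" "u < r" "l < v" "v < r" for u v x
    using that by (auto simp: f_def)
  have bounds: "l < x \<Longrightarrow> x \<le> u \<Longrightarrow> l < f u v x \<and> f u v x \<le> v"
      "u < x \<Longrightarrow> x < r \<Longrightarrow> v < f u v x \<and> f u v x < r"
    if uv: "l < u" "u < r" "l < v" "v < r" for u v x
  proof -
    assume x: "l < x" "x \<le> u"
    have "0 < (v - l) / (u - l) * (x - l)" using uv x by simp
    moreover have "(v - l) / (u - l) * (x - l) \<le> (v - l) / (u - l) * (u - l)"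
      using uv x by (intro mult_left_mono) auto
    ultimately show "l < f u v x \<and> f u v x \<le> v" using uv x by (simp add: f)
  next
    assume x: "u < x" "x < r"
    have "0 < (r - v) / (r - u) * (r - x)" using uv x by simp
    moreover have "(r - v) / (r - u) * (r - x) < (r - v) / (r - u) * (r - u)"
      using uv x by (intro mult_strict_left_mono) auto
    ultimately show "v < f u v x \<and> f u v x < r" using uv x by (simp add: f)
  qed
  have inverse: "f v u (f u v x) = x" if uv: "l < u" "u < r" "l < v" "v < r" for u v x
  proof -
    consider "x \<le> l \<or> r \<le> x" | "l < x" "x \<le> u" | "u < x" "x < r" by linarith
    then show ?thesis
    proof cases
      case 1
      then show ?thesis using uv by (simp add: f)
    next
      case 2
      have "f v u (f u v x) = l + (u - l) / (v - l) * (f u v x - l)"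
        using bounds(1)[OF uv 2] uv by (intro f(2)) auto
      also have "\<dots> = x" using uv 2 by (simp add: f(2))
      finally show ?thesis .
    next
      case 3
      have "f v u (f u v x) = r - (r - u) / (r - v) * (r - f u v x)"
        using bounds(2)[OF uv 3] uv by (intro f(3)) auto
      also have "\<dots> = x" using uv 3 by (simp add: f(3))
      finally show ?thesis .
    qed
  qed
  show thesis
  proof (rule that[of "f v u" "f u v"])
    show "f v u (f u v y) = y" "f u v (f v u y) = y" for y
      using inverse assms by auto
    show "f u v u = v" using assms f(2)[OF assms, of u] by simp
    show "f u v y = y" if "y \<le> l \<or> r \<le> y" for y using f(1)[OF assms that] .
    show "f u v x < f u v y" if "x < y" for x y
    proof -
      consider "x \<le> l \<or> r \<le> x" | "l < x" "x \<le> u" | "u < x" "x < r" by linarith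
      then show ?thesis
      proof cases
        case 1
        then consider "x \<le> l" | "r \<le> x" by blast
        then show ?thesis
        proof cases
          case 1
          consider "y \<le> l \<or> r \<le> y" | "l < y" "y \<le> u" | "u < y" "y < r" by linarith
          then show ?thesis
            using 1 that assms bounds[OF assms, of y] by cases (auto simp: f(1)[OF assms])
        next
          case 2
          with that show ?thesis by (simp add: f(1)[OF assms])
        qed
      next
        case 2
        consider "r \<le> y" | "y \<le> u" | "u < y" "y < r" by linarith
        then show ?thesis
        proof cases
          case 1
          then show ?thesis using bounds(1)[OF assms 2] assms by (simp add: f(1)[OF assms])
        next
          case 2
          have "(v - l) / (u - l) * (x - l) < (v - l) / (u - l) * (y - l)"
            using assms that by (intro mult_strict_left_mono) auto
          then show ?thesis using \<open>l < x\<close> \<open>x \<le> u\<close> 2 that by (simp add: f(2)[OF assms])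
        next
          case 3
          then show ?thesis using bounds(1)[OF assms 2] bounds(2)[OF assms 3] by simp
        qed
      next
        case 3
        show ?thesis
        proof (cases "r \<le> y")
          case True
          then show ?thesis using bounds(2)[OF assms 3] by (simp add: f(1)[OF assms])
        next
          case False
          have "(r - v) / (r - u) * (r - y) < (r - v) / (r - u) * (r - x)"
            using assms that by (intro mult_strict_left_mono) auto
          then show ?thesis using 3 False that by (simp add: f(3)[OF assms])
        qed
      qed
    qed
  qed
qed

text \<open>Inside \<open>{-B..B}\<close> the frontier of \<open>A\<close> is finite because
  \<open>A\<close> is definable in the original structure. Outside, a point that is not a parameter
  can be moved to any nearby point by an automorphism fixing the parameters and the relations, so
  membership in \<open>A\<close> is locally constant there.\<close>

lemma o_minimal_expansion_by_subsets:
  assumes "tame \<RR>" "bounded_in_space n E"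
  shows "o_minimal (expansion_by_subsets \<RR> n E)"
  unfolding o_minimal_def
proof (intro allI impI)
  let ?S = "expansion_by_subsets \<RR> n E"
  fix A assume "definable_real ?S A"
  then obtain \<phi> p where \<phi>: "wf_fm ?S \<phi>"
    and eq: "{x \<in> topspace (Euclidean_space 1). x 0 \<in> A} =
      {x \<in> topspace (Euclidean_space 1). sat ?S (\<lambda>i. if i < 1 then x i else p i) \<phi>}"
    unfolding definable_real_def definable_def by blast
  define env where "env = (\<lambda>t i. if i = 0 then t else p i)"
  have A: "t \<in> A \<longleftrightarrow> sat ?S (env t) \<phi>" for t
  proof -
    define x where "x = (\<lambda>i::nat. if i = 0 then t else 0)"
    have "x \<in> topspace (Euclidean_space 1)" by (simp add: x_def topspace_Euclidean_space)
    with eq have "x 0 \<in> A \<longleftrightarrow> sat ?S (\<lambda>i. if i < 1 then x i else p i) \<phi>" by blast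
    moreover have "(\<lambda>i. if i < 1 then x i else p i) = env t" by (auto simp: x_def env_def)
    moreover have "x 0 = t" by (simp add: x_def)
    ultimately show ?thesis by (simp only:)
  qed
  obtain B where B: "\<And>x i. x \<in> E \<Longrightarrow> i < n \<Longrightarrow> \<bar>x i\<bar> \<le> B"
    using assms(2) by (auto simp: bounded_in_space_def)
  \<comment> \<open>Only the values of variables occurring in the formula have to be fixed, and
    these are finitely many.\<close>
  define F where "F = p ` vars_fm \<phi>"
  have "finite F" by (simp add: F_def finite_vars_fm)
  have "frontier A \<subseteq> (frontier A \<inter> {-B..B}) \<union> F"
  proof (rule ccontr)
    assume "\<not> ?thesis"
    then have "\<exists>t. t \<in> frontier A \<and> t \<notin> {-B..B} \<union> F" by blast
    then obtain t where t: "t \<in> frontier A" "t \<notin> {-B..B} \<union> F" by blast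
    have "open (- ({-B..B} \<union> F))"
      using \<open>finite F\<close> by (intro open_Compl closed_Un closed_atLeastAtMost finite_imp_closed)
    then obtain d where d: "d > 0" "ball t d \<subseteq> - ({-B..B} \<union> F)" using t(2) openE by blast
    have const: "v \<in> A \<longleftrightarrow> t \<in> A" if v: "t - d < v" "v < t + d" for v
    proof -
      obtain h k where h: "\<And>y. k (h y) = y" "\<And>y. h (k y) = y" "\<And>x y. x < y \<Longrightarrow> h x < h y"
        "h t = v" "\<And>y. y \<le> t - d \<or> t + d \<le> y \<Longrightarrow> h y = y"
        by (rule ex_order_automorphism[OF _ _ v]) (use d(1) in auto)
      have fixed: "h y = y" if "y \<in> {-B..B} \<union> F" for y
      proof -
        have "y \<notin> ball t d" using d(2) that by blast
        then show ?thesis by (intro h(5)) (auto simp: dist_real_def abs_le_iff not_less)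
      qed
      have "t \<in> A \<longleftrightarrow> sat ?S (\<lambda>m. h (env t m)) \<phi>"
        unfolding A
        by (rule sat_expansion_automorphism[where h = h and k = k and B = B, symmetric])
          (use B h(1-3) \<phi> fixed in \<open>auto simp: abs_le_iff\<close>)
      also have "\<dots> \<longleftrightarrow> sat ?S (env v) \<phi>"
        by (rule sat_cong) (auto simp: env_def h(4) F_def intro!: fixed)
      finally show ?thesis using A by simp
    qed
    have "\<exists>s. t - d < s \<and> s < t + d \<and> s \<in> A" "\<exists>s. t - d < s \<and> s < t + d \<and> s \<notin> A"
      using t(1) d(1) by (simp_all add: frontier_real_iff)
    with const show False by blast
  qed
  moreover have "definable_real \<RR> A"
  proof -
    have "simple_term (\<lambda>e. env (e 0 0) m)" for m
      unfolding env_def by (intro simple_term_if simple_term_var simple_term_const)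
    then have "definable_pred \<RR> (\<lambda>e. sat ?S (\<lambda>m. env (e 0 0) m) \<phi>)"
      using definable_pred_sat_expansion[OF \<phi>, of "\<lambda>m e. env (e 0 0) m"] by blast
    then show ?thesis by (simp add: definable_real_iff A)
  qed
  then have "finite (frontier A \<inter> {-B..B})" using assms(1) by (auto simp: tame_def)
  ultimately have "finite (frontier A)"
    using \<open>finite F\<close> by (meson finite_Un finite_subset)
  then show "finite_union_points_intervals A" by (rule finite_union_of_frontier)
qed

text \<open>The bounded set \<open>S \<inter> {a..b}\<close>, seen in 1-space, is one of the symbols
  of its own expansion, hence definable in an o-minimal structure. Cutting \<open>S\<close> down to
  \<open>{a..b}\<close> affects the frontier within \<open>{a..b}\<close> only at \<open>a\<close>
  and \<open>b\<close>.\<close>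

lemma tame_of_o_minimal_expansions:
  assumes "\<And>n E. definable \<RR> n E \<Longrightarrow> bounded_in_space n E \<Longrightarrow> o_minimal (expansion_by_subsets \<RR> n E)"
  shows "tame \<RR>"
  unfolding tame_def
proof (intro allI impI)
  fix S and a b :: real assume S: "definable_real \<RR> S"
  define E where "E = {x \<in> topspace (Euclidean_space 1). x 0 \<in> S \<inter> {a..b}}"
  let ?S = "expansion_by_subsets \<RR> 1 E"
  have "definable_real \<RR> {t. t \<in> S \<and> a \<le> t \<and> t \<le> b}"
    by (intro definable_real_Collect definable_pred_intros definable_pred_mem_real[OF S])
  moreover have "{t. t \<in> S \<and> a \<le> t \<and> t \<le> b} = S \<inter> {a..b}" by auto
  ultimately have E: "definable \<RR> 1 E" by (simp add: definable_real_def E_def)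
  have "\<bar>x i\<bar> \<le> max \<bar>a\<bar> \<bar>b\<bar>" if "x \<in> E" "i < 1" for x i
    using that by (auto simp: E_def)
  then have "bounded_in_space 1 E" unfolding bounded_in_space_def by blast
  with E have om: "o_minimal ?S" by (rule assms)
  have "x 0 \<in> S \<inter> {a..b} \<longleftrightarrow> sat ?S (\<lambda>i. if i < 1 then x i else 0) (Rel E [Var 0])"
    if x: "x \<in> topspace (Euclidean_space 1)" for x
  proof -
    have "(\<lambda>i. if i < 1 then [x 0] ! i else 0) = x"
      using x by (auto simp: topspace_Euclidean_space)
    then show ?thesis using x by (simp add: expansion_by_subsets_def E_def)
  qed
  moreover have "wf_fm ?S (Rel E [Var 0])" using E by (simp add: expansion_by_subsets_def)
  ultimately have "definable_real ?S (S \<inter> {a..b})"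
    unfolding definable_real_def definable_def
    by (intro exI[of _ "Rel E [Var 0]"] exI[of _ "\<lambda>_. 0"]) blast
  with om have "finite (frontier (S \<inter> {a..b}))"
    unfolding o_minimal_def using finite_frontier_of_union by blast
  moreover have "frontier S \<inter> {a..b} \<subseteq> frontier (S \<inter> {a..b}) \<union> {a, b}"
  proof
    fix t assume t: "t \<in> frontier S \<inter> {a..b}"
    show "t \<in> frontier (S \<inter> {a..b}) \<union> {a, b}"
    proof (cases "t \<in> {a<..<b}")
      case True
      have "t \<in> closure (S \<inter> {a<..<b})"
        using t True frontier_Int_open_subset[of "{a<..<b}" S] by (auto simp: frontier_def)
      then have "t \<in> closure (S \<inter> {a..b})" using closure_mono[of "S \<inter> {a<..<b}" "S \<inter> {a..b}"] by force
      moreover have "t \<notin> interior (S \<inter> {a..b})" using t by (auto simp: frontier_def)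
      ultimately show ?thesis by (simp add: frontier_def)
    qed (use t in auto)
  qed
  ultimately show "finite (frontier S \<inter> {a..b})" by (meson finite_Un finite_insert finite.emptyI finite_subset)
qed

section \<open>Planar sets over an accumulation point\<close>

definition planar :: "real \<Rightarrow> real \<Rightarrow> nat \<Rightarrow> real" where
  "planar s t = (\<lambda>i. if i = 0 then s else if i = 1 then t else 0)"

lemma planar_simps [simp]: "planar s t 0 = s" "planar s t (Suc 0) = t"
  by (simp_all add: planar_def)

lemma planar_in [simp]: "planar s t \<in> topspace (Euclidean_space 2)"
  by (simp add: planar_def topspace_Euclidean_space)

lemma planar_eq:
  assumes "x \<in> topspace (Euclidean_space 2)"
  shows "x = planar (x 0) (x 1)"
proof
  fix i
  show "x i = planar (x 0) (x 1) i"
    using assms by (cases "i = 0"; cases "i = 1") (auto simp: planar_def topspace_Euclidean_space)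
qed

lemma continuous_on_planar:
  assumes "continuous_on S f" "continuous_on S g"
  shows "continuous_on S (\<lambda>u. planar (f u) (g u))"
proof (rule continuous_on_coordinatewise_then_product)
  show "continuous_on S (\<lambda>u. planar (f u) (g u) i)" for i
    using assms by (cases "i = 0"; cases "i = 1") (auto simp: planar_def)
qed

lemma definable_planar:
  assumes "definable_pred \<RR> (\<lambda>e. P (e 0 0) (e 0 1))"
  shows "definable \<RR> 2 {x \<in> topspace (Euclidean_space 2). P (x 0) (x 1)}"
proof -
  have "restr 2 x \<in> {x \<in> topspace (Euclidean_space 2). P (x 0) (x 1)} \<longleftrightarrow> P (x 0) (x 1)" for x
    by (simp add: topspace_Euclidean_space)
  then show ?thesis
    using assms by (auto simp: definable_iff_definable_set definable_set_def)
qed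

text \<open>With a second point \<open>s\<close> besides \<open>a\<close>, the set \<open>J\<close>
  would contain the open interval between them, which misses \<open>a\<close> and so lies in
  \<open>A\<close>. Applied to projections, this forces the first coordinate to stay at
  \<open>a\<close>.\<close>

lemma connected_empty_interior:
  fixes A J :: "real set"
  assumes "interior A = {}" "connected J" "J \<subseteq> insert a A" "a \<in> J"
  shows "J = {a}"
proof (rule ccontr)
  assume "J \<noteq> {a}"
  then obtain s where s: "s \<in> J" "s \<noteq> a" using assms(4) by blast
  define l where "l = min s a"
  define r where "r = max s a"
  have "{l..r} \<subseteq> J"
    by (rule connected_contains_Icc[OF assms(2)]) (use s assms(4) in \<open>auto simp: l_def r_def min_def max_def\<close>)
  moreover have "a = l \<or> a = r" by (auto simp: l_def r_def)
  ultimately have "w \<in> A" if "w \<in> {l<..<r}" for w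
  proof -
    have "w \<in> {l..r}" using that by auto
    with \<open>{l..r} \<subseteq> J\<close> assms(3) have "w \<in> insert a A" by blast
    with that \<open>a = l \<or> a = r\<close> show ?thesis by auto
  qed
  then have "{l<..<r} \<subseteq> A" by blast
  then have "{l<..<r} \<subseteq> interior A" by (intro interior_maximal) auto
  moreover have "l < r" using s(2) by (auto simp: l_def r_def)
  ultimately show False using assms(1) by (metis dense empty_iff greaterThanLessThan_iff subsetD)
qed

text \<open>\<open>planar u s\<close> and \<open>planar u t\<close> depend continuously on
  \<open>u\<close>, so one \<open>u\<close> near \<open>a\<close> serves both heights. A single
  tooth thus connects neighbourhoods of two points over \<open>a\<close>.\<close>

lemma limpt_two_neighbourhoods:
  fixes a :: real
  assumes "a islimpt A" "open U" "planar a s \<in> U" "open V" "planar a t \<in> V"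
  obtains u where "u \<in> A" "u \<noteq> a" "a - 1 < u" "u < a + 1" "planar u s \<in> U" "planar u t \<in> V"
proof -
  define W where "W = (\<lambda>u. planar u s) -` U \<inter> (\<lambda>u. planar u t) -` V \<inter> {a - 1<..<a + 1}"
  have "open W"
    unfolding W_def
    by (intro open_Int open_vimage assms open_greaterThanLessThan continuous_on_planar continuous_on_id continuous_on_const)
  moreover have "a \<in> W" using assms by (simp add: W_def)
  ultimately obtain u where "u \<in> A" "u \<in> W" "u \<noteq> a" using assms(1) unfolding islimpt_def by blast
  then show thesis by (intro that[of u]) (auto simp: W_def)
qed

lemma connected_segment: "connected (planar u ` {0..1})"
proof (rule connected_continuous_image)
  show "continuous_on {0..1} (planar u)"
    using continuous_on_planar[OF continuous_on_const continuous_on_id, of "{0..1}" u] by simp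
qed auto

text \<open>Vertical unit segments stand over the points of \<open>A\<close> near \<open>a\<close>,
  but over \<open>a\<close> only the two ends of the limit segment are kept. A clopen set containing
  the lower end contains lower ends of nearby teeth, thus whole teeth, thus the upper end by
  closedness: both ends share a quasicomponent. A connected set through both would have constant
  first coordinate \<open>a\<close>, and so only 0 and 1 as second coordinates.\<close>

lemma quasi_component_not_connected:
  assumes A: "definable_real \<RR> A" "interior A = {}" "a islimpt A"
  obtains E C where "definable \<RR> 2 E" "bounded_in_space 2 E"
    "C \<in> quasi_components_of (subspace_topology 2 E)" "\<not> connectedin (subspace_topology 2 E) C"
proof -
  define P where "P = (\<lambda>s t::real. (s \<in> A \<and> s \<noteq> a \<and> a - 1 < s \<and> s < a + 1 \<and> 0 \<le> t \<and> t \<le> 1) \<or>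
    (s = a \<and> (t = 0 \<or> t = 1)))"
  define E where "E = {x \<in> topspace (Euclidean_space 2). P (x 0) (x 1)}"
  have def_E: "definable \<RR> 2 E"
    unfolding E_def P_def
    by (intro definable_planar definable_pred_intros definable_pred_mem_real[OF A(1)])
  have "\<bar>x i\<bar> \<le> \<bar>a\<bar> + 1" if "x \<in> E" "i < 2" for x i
  proof -
    have "i = 0 \<or> i = 1" using that(2) by auto
    then show ?thesis using that(1) by (auto simp: E_def P_def)
  qed
  then have bd: "bounded_in_space 2 E" unfolding bounded_in_space_def by blast
  have X: "subspace_topology 2 E = top_of_set E"
    by (rule subspace_topology_eq) (auto simp: E_def)
  let ?X = "top_of_set E"
  have ends: "planar a 0 \<in> E" "planar a 1 \<in> E" by (simp_all add: E_def P_def)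
  define C where "C = quasi_component_of_set ?X (planar a 0)"
  have C: "C \<in> quasi_components_of ?X" using ends by (auto simp: C_def quasi_components_of_def)
  have "planar a 1 \<in> C"
    unfolding C_def mem_Collect_eq quasi_component_of
  proof (intro conjI allI impI)
    fix T assume T: "planar a 0 \<in> T \<and> closedin ?X T \<and> openin ?X T"
    show "planar a 1 \<in> T"
    proof (rule ccontr)
      assume not: "planar a 1 \<notin> T"
      obtain U where U: "open U" "T = E \<inter> U" using T by (auto simp: openin_open)
      obtain V where V: "closed V" "T = E \<inter> V" using T by (auto simp: closedin_closed)
      obtain u where u: "u \<in> A" "u \<noteq> a" "a - 1 < u" "u < a + 1" "planar u 0 \<in> U" "planar u 1 \<in> - V"
        by (rule limpt_two_neighbourhoods[OF A(3), of U 0 "- V" 1])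
          (use U V T not ends in auto)
      have sub: "planar u ` {0..1} \<subseteq> E" using u by (auto simp: E_def P_def)
      then have "connectedin ?X (planar u ` {0..1})"
        by (simp add: connectedin_subtopology connected_segment)
      then have "planar u ` {0..1} \<subseteq> T \<or> disjnt (planar u ` {0..1}) T"
        using connectedin_clopen_cases T by blast
      moreover have "planar u 0 \<in> planar u ` {0..1}" "planar u 1 \<in> planar u ` {0..1}" by auto
      moreover have "planar u 0 \<in> T" using u(5) sub U(2) by auto
      moreover have "planar u 1 \<notin> T" using u(6) V(2) by auto
      ultimately show False unfolding disjnt_iff by blast
    qed
  qed (use ends in auto)
  have "\<not> connectedin ?X C"
  proof
    assume "connectedin ?X C"
    then have conn: "connected C" and CE: "C \<subseteq> E" by (auto simp: connectedin_subtopology)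
    have a0: "planar a 0 \<in> C" using ends by (simp add: C_def)
    have "connected ((\<lambda>x. x 0) ` C)"
      by (rule connected_continuous_image[OF continuous_on_coordinate conn])
    moreover have "(\<lambda>x. x 0) ` C \<subseteq> insert a A" using CE by (auto simp: E_def P_def)
    moreover have "a \<in> (\<lambda>x. x 0) ` C" using a0 by (force intro: image_eqI[of _ _ "planar a 0"])
    ultimately have "(\<lambda>x. x 0) ` C = {a}" by (rule connected_empty_interior[OF A(2)])
    then have "x 1 \<in> {0, 1}" if "x \<in> C" for x
      using that CE by (force simp: E_def P_def)
    then have "(\<lambda>x. x 1) ` C \<subseteq> {0, 1}" by blast
    moreover have "connected ((\<lambda>x. x 1) ` C)"
      by (rule connected_continuous_image[OF continuous_on_coordinate conn])
    moreover have "0 \<in> (\<lambda>x. x 1) ` C" "1 \<in> (\<lambda>x. x 1) ` C"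
      using a0 \<open>planar a 1 \<in> C\<close> by (force intro: image_eqI[of _ _ "planar a 0"] image_eqI[of _ _ "planar a 1"])+
    ultimately have "{0..1::real} \<subseteq> {0, 1}" using connected_contains_Icc by blast
    moreover have "(1/2::real) \<in> {0..1}" by simp
    ultimately have "(1/2::real) \<in> {0, 1}" by blast
    then show False by simp
  qed
  with that[OF def_E bd] C show thesis unfolding X by blast
qed

text \<open>
  A comb whose teeth accumulate at the point \<open>(a, 1)\<close>: a path leaving this point would have to move
  its first coordinate inside a set with empty interior.
\<close>

lemma component_not_path_connected:
  assumes A: "definable_real \<RR> A" "interior A = {}" "a islimpt A"
  obtains E C where "definable \<RR> 2 E" "bounded_in_space 2 E"
    "C \<in> connected_components_of (subspace_topology 2 E)" "\<not> path_connectedin (subspace_topology 2 E) C"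
proof -
  define P where "P = (\<lambda>s t::real. (s \<in> A \<and> s \<noteq> a \<and> a - 1 < s \<and> s < a + 1 \<and> 0 \<le> t \<and> t \<le> 1) \<or>
    (a - 1 \<le> s \<and> s \<le> a + 1 \<and> t = 0) \<or> (s = a \<and> t = 1))"
  have def_P: "definable_pred \<RR> (\<lambda>e. P (e 0 0) (e 0 1))"
    unfolding P_def by (intro definable_pred_intros definable_pred_mem_real[OF A(1)])
  define E where "E = {x \<in> topspace (Euclidean_space 2). P (x 0) (x 1)}"
  have def_E: "definable \<RR> 2 E"
    unfolding E_def by (rule definable_planar[OF def_P])
  have "\<bar>x i\<bar> \<le> \<bar>a\<bar> + 1" if "x \<in> E" "i < 2" for x i
  proof -
    have "i = 0 \<or> i = 1" using that(2) by auto
    then show ?thesis using that(1) by (auto simp: E_def P_def)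
  qed
  then have bd: "bounded_in_space 2 E" unfolding bounded_in_space_def by blast
  have X: "subspace_topology 2 E = top_of_set E"
    by (rule subspace_topology_eq) (auto simp: E_def)
  define A' where "A' = {s \<in> A. s \<noteq> a \<and> a - 1 < s \<and> s < a + 1}"
  define base where "base = (\<lambda>s. planar s 0) ` {a - 1..a + 1}"
  \<comment> \<open>The comb without its tip \<open>planar a 1\<close>. The base is added to each
    tooth so that all members of the union share it.\<close>
  define K where "K = \<Union> (insert base ((\<lambda>s. base \<union> planar s ` {0..1}) ` A'))"
  have E_eq: "E = insert (planar a 1) K"
  proof (intro equalityI subsetI)
    fix x assume x: "x \<in> E"
    have "x \<in> topspace (Euclidean_space 2)" "P (x 0) (x 1)" using x by (auto simp: E_def)
    moreover from this(1) have "x = planar (x 0) (x 1)" by (rule planar_eq)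
    ultimately obtain s t where x: "x = planar s t" "P s t" by blast
    then consider "s \<in> A'" "0 \<le> t" "t \<le> 1" | "a - 1 \<le> s" "s \<le> a + 1" "t = 0" | "s = a" "t = 1"
      by (auto simp: P_def A'_def)
    then show "x \<in> insert (planar a 1) K"
    proof cases
      case 1
      then have "x \<in> planar s ` {0..1}" by (auto simp: x(1))
      with 1(1) show ?thesis by (auto simp: K_def)
    next
      case 2
      then have "x \<in> base" by (auto simp: x(1) base_def)
      then show ?thesis by (simp add: K_def)
    qed (simp add: x(1))
  next
    fix x assume "x \<in> insert (planar a 1) K"
    then have "x = planar a 1 \<or> x \<in> base \<or> (\<exists>s\<in>A'. x \<in> planar s ` {0..1})"
      unfolding K_def by blast
    then consider "x = planar a 1" | s where "a - 1 \<le> s" "s \<le> a + 1" "x = planar s 0"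
      | s t where "s \<in> A'" "0 \<le> t" "t \<le> 1" "x = planar s t"
      unfolding base_def image_iff Bex_def atLeastAtMost_iff by blast
    then show "x \<in> E"
      by cases (simp_all add: E_def P_def A'_def)
  qed
  have base: "connected base"
    unfolding base_def
    by (intro connected_continuous_image continuous_on_planar continuous_on_id continuous_on_const) auto
  have "connected K"
    unfolding K_def
  proof (rule connected_Union)
    fix S assume "S \<in> insert base ((\<lambda>s. base \<union> planar s ` {0..1}) ` A')"
    then consider "S = base" | s where "s \<in> A'" "S = base \<union> planar s ` {0..1}" by blast
    then show "connected S"
    proof cases
      case (2 s)
      have "planar s 0 \<in> base \<inter> planar s ` {0..1}" using 2(1) by (auto simp: base_def A'_def)
      then show ?thesis unfolding 2(2) by (intro connected_Un base connected_segment) blast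
    qed (simp add: base)
  next
    have "planar a 0 \<in> base" by (auto simp: base_def)
    then show "\<Inter> (insert base ((\<lambda>s. base \<union> planar s ` {0..1}) ` A')) \<noteq> {}" by blast
  qed
  moreover have "planar a 1 \<in> closure K"
    unfolding closure_iff_nhds_not_empty
  proof (intro allI impI)
    fix B U assume U: "U \<subseteq> B" "open U" "planar a 1 \<in> U"
    obtain u where u: "u \<in> A" "u \<noteq> a" "a - 1 < u" "u < a + 1" "planar u 1 \<in> U" "planar u 1 \<in> U"
      using limpt_two_neighbourhoods[OF A(3) U(2,3) U(2,3)] .
    then have "planar u 1 \<in> K" by (auto simp: K_def A'_def)
    with u(5) U(1) show "K \<inter> B \<noteq> {}" by blast
  qed
  then have "E \<subseteq> closure K" using closure_subset by (auto simp: E_eq)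
  ultimately have "connected E"
    using connected_intermediate_closure[of K E] by (auto simp: E_eq)
  then have "connected_space (top_of_set E)"
    by (metis connectedin_def connectedin_iff_connected)
  moreover have inE: "planar a 1 \<in> E" "planar a 0 \<in> E" by (simp_all add: E_def P_def)
  have "top_of_set E \<noteq> trivial_topology"
  proof
    assume "top_of_set E = trivial_topology"
    then have "topspace (top_of_set E) = {}" by (simp only: topspace_discrete_topology)
    with inE show False by simp
  qed
  ultimately have "connected_components_of (top_of_set E) = {E}"
    by (simp add: connected_components_of_eq_singleton)
  then have comp: "E \<in> connected_components_of (top_of_set E)" by simp
  have "\<not> path_connectedin (top_of_set E) E"
  proof
    assume "path_connectedin (top_of_set E) E"
    then have "path_connected E" by (simp add: path_connectedin_subtopology)
    then obtain g where g: "path g" "path_image g \<subseteq> E" "pathstart g = planar a 1" "pathfinish g = planar a 0"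
      unfolding path_connected_def using inE by blast
    have cont: "continuous_on {0..1} g" using g(1) by (simp add: path_def)
    have cont_i: "continuous_on S (\<lambda>t. g t i)" if "S \<subseteq> {0..1}" for S i
      using continuous_on_compose2[OF continuous_on_coordinate[of UNIV i] continuous_on_subset[OF cont that]] by auto
    have gE: "g t \<in> E" if "t \<in> {0..1}" for t using g(2) that by (auto simp: path_image_def)
    \<comment> \<open>Being at the tip is shown to be locally constant along the path, although the
      two ends of the path differ in this respect.\<close>
    have "(g 0 = planar a 1) = (g 1 = planar a 1)"
    proof (rule connected_local_const[where A = "{0..1::real}" and f = "\<lambda>t. g t = planar a 1"])
      show "\<forall>t\<in>{0..1}. \<forall>\<^sub>F u in at t within {0..1}. (g t = planar a 1) = (g u = planar a 1)"
      proof
        fix t :: real assume t: "t \<in> {0..1}"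
        show "\<forall>\<^sub>F u in at t within {0..1}. (g t = planar a 1) = (g u = planar a 1)"
        proof (cases "g t = planar a 1")
          case True
          have "((\<lambda>u. g u 1) \<longlongrightarrow> g t 1) (at t within {0..1})"
            using cont_i[of "{0..1}" 1] t by (auto simp: continuous_on_def)
          then have "\<forall>\<^sub>F u in at t within {0..1}. 1/2 < g u 1"
            by (rule order_tendstoD) (simp add: True)
          then obtain d where d: "d > 0" "\<And>u. u \<in> {0..1} \<Longrightarrow> u \<noteq> t \<Longrightarrow> dist u t < d \<Longrightarrow> 1/2 < g u 1"
            unfolding eventually_at by blast
          define J where "J = {0..1} \<inter> {t - d<..<t + d}"
          \<comment> \<open>Any height strictly between 0 and 1 would serve: above it the base is
            out of reach, so first coordinates lie in \<open>insert a A\<close>.\<close>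
          have half: "1/2 < g u 1" if "u \<in> J" for u
            using d(2)[of u] that True by (cases "u = t") (auto simp: J_def dist_real_def abs_less_iff)
          have "connected ((\<lambda>u. g u 0) ` J)"
          proof (rule connected_continuous_image)
            show "continuous_on J (\<lambda>u. g u 0)" by (rule cont_i) (auto simp: J_def)
            show "connected J"
              unfolding J_def by (intro convex_connected convex_Int convex_real_interval)
          qed
          moreover have "(\<lambda>u. g u 0) ` J \<subseteq> insert a A"
          proof
            fix s assume "s \<in> (\<lambda>u. g u 0) ` J"
            then obtain u where u: "u \<in> J" "s = g u 0" by blast
            have "P (g u 0) (g u 1)" using gE[of u] u(1) by (auto simp: E_def J_def)
            with half[OF u(1)] show "s \<in> insert a A" by (auto simp: P_def u(2))
          qed
          moreover have "a \<in> (\<lambda>u. g u 0) ` J"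
            using t d(1) True by (intro image_eqI[of _ _ t]) (auto simp: J_def)
          ultimately have Ja: "(\<lambda>u. g u 0) ` J = {a}" by (rule connected_empty_interior[OF A(2)])
          have "g u = planar a 1" if "u \<in> J" for u
          proof -
            have "g u 0 = a" using Ja that by blast
            moreover have "g u \<in> E" using gE that by (auto simp: J_def)
            moreover from this have "P (g u 0) (g u 1)" by (simp add: E_def)
            ultimately have "g u 1 = 1" using half[OF that] by (auto simp: P_def)
            with \<open>g u 0 = a\<close> \<open>g u \<in> E\<close> show ?thesis using planar_eq[of "g u"] by (simp add: E_def)
          qed
          then have "\<forall>u\<in>{0..1}. u \<noteq> t \<and> dist u t < d \<longrightarrow> (g t = planar a 1) = (g u = planar a 1)"
            using True by (auto simp: J_def dist_real_def abs_less_iff)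
          with d(1) show ?thesis unfolding eventually_at by blast
        next
          case False
          have "(g \<longlongrightarrow> g t) (at t within {0..1})" using cont t by (auto simp: continuous_on_def)
          then have "\<forall>\<^sub>F u in at t within {0..1}. g u \<noteq> planar a 1"
            using False by (rule tendsto_imp_eventually_ne)
          then show ?thesis by eventually_elim (simp add: False)
        qed
      qed
    qed auto
    then have "planar a 0 = planar a 1" using g(3,4) by (simp add: pathstart_def pathfinish_def)
    then have "planar a 0 1 = planar a 1 1" by simp
    then show False by simp
  qed
  with that[OF def_E bd] comp show thesis unfolding X by blast
qed

theorem proposition1p6:
  fixes \<RR> :: "('f, 'r) expansion"
  shows
    "(locally_o_minimal \<RR> \<longleftrightarrow>
        (\<forall>n E. definable \<RR> n E \<and> bounded_in_space n E \<longrightarrow>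
           o_minimal (expansion_by_subsets \<RR> n E)))
   \<and> (locally_o_minimal \<RR> \<longleftrightarrow>
        (\<forall>n E. definable \<RR> n E \<longrightarrow>
           locally_path_connected_space (subspace_topology n E)))
   \<and> (locally_o_minimal \<RR> \<longleftrightarrow>
        (\<forall>n E. definable \<RR> n E \<longrightarrow>
           connected_components_of (subspace_topology n E)
             = path_components_of (subspace_topology n E) \<and>
           connected_components_of (subspace_topology n E)
             = quasi_components_of (subspace_topology n E)))
   \<and> (locally_o_minimal \<RR> \<longleftrightarrow>
        (\<forall>E. definable \<RR> 2 E \<and> bounded_in_space 2 E \<longrightarrow>
           (\<forall>C \<in> connected_components_of (subspace_topology 2 E).
              path_connectedin (subspace_topology 2 E) C)))
   \<and> (locally_o_minimal \<RR> \<longleftrightarrow>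
        (\<forall>E. definable \<RR> 2 E \<and> bounded_in_space 2 E \<longrightarrow>
           (\<forall>C \<in> quasi_components_of (subspace_topology 2 E).
              connectedin (subspace_topology 2 E) C)))
   \<and> (locally_o_minimal \<RR> \<longleftrightarrow>
        (\<forall>A. definable_real \<RR> A \<and> interior A = {} \<longrightarrow> closed A \<and> discrete A))"
    (is "(?c1 \<longleftrightarrow> ?c2) \<and> (?c1 \<longleftrightarrow> ?c3) \<and> (?c1 \<longleftrightarrow> ?c4) \<and> (?c1 \<longleftrightarrow> ?c5) \<and> (?c1 \<longleftrightarrow> ?c6) \<and> (?c1 \<longleftrightarrow> ?c7)")
proof -
  have 12: "?c1 \<Longrightarrow> ?c2"
    using o_minimal_expansion_by_subsets by (auto simp: locally_o_minimal_iff_tame)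
  have 21: "?c2 \<Longrightarrow> ?c1"
    using tame_of_o_minimal_expansions[of \<RR>] by (simp add: locally_o_minimal_iff_tame)
  have 13: "?c1 \<Longrightarrow> ?c3"
    using locally_path_connected_definable by (auto simp: locally_o_minimal_iff_tame)
  have 34: "?c3 \<Longrightarrow> ?c4"
    using components_eq_of_locally_path_connected by blast
  have 45: "?c5" if 4: ?c4
  proof (intro allI impI ballI)
    fix E C assume "definable \<RR> 2 E \<and> bounded_in_space 2 E"
      and C: "C \<in> connected_components_of (subspace_topology 2 E)"
    then have "C \<in> path_components_of (subspace_topology 2 E)" using 4 by simp
    then show "path_connectedin (subspace_topology 2 E) C" by (rule path_connectedin_path_components_of)
  qed
  have 46: "?c6" if 4: ?c4
  proof (intro allI impI ballI)
    fix E C assume "definable \<RR> 2 E \<and> bounded_in_space 2 E"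
      and C: "C \<in> quasi_components_of (subspace_topology 2 E)"
    then have "connected_components_of (subspace_topology 2 E) = quasi_components_of (subspace_topology 2 E)"
      using 4 by blast
    with C have "C \<in> connected_components_of (subspace_topology 2 E)" by (simp only:)
    then show "connectedin (subspace_topology 2 E) C" by (rule connectedin_connected_components_of)
  qed
  have 57: "?c7" if 5: ?c5
    unfolding closed_discrete_iff_no_limpt
  proof (intro allI impI notI, elim conjE)
    fix A and a :: real assume "definable_real \<RR> A" "interior A = {}" "a islimpt A"
    from component_not_path_connected[OF this] 5 show False by metis
  qed
  have 67: "?c7" if 6: ?c6
    unfolding closed_discrete_iff_no_limpt
  proof (intro allI impI notI, elim conjE)
    fix A and a :: real assume "definable_real \<RR> A" "interior A = {}" "a islimpt A"
    from quasi_component_not_connected[OF this] 6 show False by metis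
  qed
  have 17: "?c1 \<longleftrightarrow> ?c7"
    by (simp only: locally_o_minimal_iff_tame tame_iff_closed_discrete)
  \<comment> \<open>\<open>?c2\<close> and \<open>?c7\<close> are linked to \<open>?c1\<close>
    directly; \<open>?c3\<close> and \<open>?c4\<close> lie on the way from \<open>?c1\<close> to
    \<open>?c5\<close> and \<open>?c6\<close>, and each of these two leads to
    \<open>?c7\<close>.\<close>
  show ?thesis
    using 12 21 13 34 45 46 57 67 17 by argo
qed

end
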